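(* Let $n\ge2$ and let $\mathcal{L}=\{L_1,\dots,L_n\}$ be an elliptic system of linearly independent complex vector fields on $\mathbb{R}^N$ with constant complex coefficients, and let $1<p<\infty$, $\frac1p+\frac1{p'}=1$. Then there is a constant $C>0$ such that, whenever $W\in L^{p'}(\mathbb{R}^N,\mathbb{C}^n)$ and $\operatorname{curl}_{\mathcal{L}}W$ has components in $L^{p'}(\mathbb{R}^N)$, the inequality $$\|V\cdot W\|_{h^1}\le C\,\|V\|_{L^p}\left(\|W\|_{L^{p'}}+\|\operatorname{curl}_{\mathcal{L}}W\|_{L^{p'}}\right)$$ holds for every $V\in L^p(\mathbb{R}^N,\mathbb{C}^n)$ satisfying $\operatorname{div}_{\mathcal{L}^*}V=0$ in the sense of distributions; the constant $C$ does not depend on $V$ or $W$.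
   Context: Let $N\ge2$. A complex vector field with constant coefficients on $\mathbb{R}^N$ is $L_j=\sum_{k=1}^N c_{jk}\,\partial_{x_k}$ with $c_{jk}\in\mathbb{C}$; its formal adjoint is $L_j^*=-\sum_k\overline{c_{jk}}\,\partial_{x_k}$. The system is elliptic if for real $\xi\in\mathbb{R}^N$, $\sum_k c_{jk}\xi_k=0$ for all $j$ implies $\xi=0$ (equivalently, $\sum_jL_j^*L_j$ is elliptic). In the sense of distributions: $\operatorname{div}_{\mathcal{L}^*}V=\sum_jL_j^*V_j$ and $\operatorname{curl}_{\mathcal{L}}W=(L_iW_j-L_jW_i)_{1\le i,j\le n}$. The product is Hermitian: $V\cdot W=\sum_jV_j\overline{W_j}$. Local Hardy space norm: fix $\varphi\in\mathcal{S}(\mathbb{R}^N)$ with $\int\varphi\ne0$, $\varphi_t(x)=t^{-N}\varphi(x/t)$; then $\|f\|_{h^1}=\|m_\varphi f\|_{L^1}$ with $m_\varphi f(x)=\sup_{0<t<1}|\langle f,\varphi_t(x-\cdot)\rangle|$. Different $\varphi$ give equivalent norms. *)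

theory Defs
  imports "HOL-Analysis.Analysis"
begin

section \<open>Smooth, test and Schwartz functions on \<open>real ^ 'N\<close>\<close>

definition partial :: "'N \<Rightarrow> (real ^ 'N \<Rightarrow> complex) \<Rightarrow> real ^ 'N \<Rightarrow> complex" where
  "partial k f = (\<lambda>x. frechet_derivative f (at x) (axis k 1))"

definition iter_partial :: "'N list \<Rightarrow> (real ^ 'N \<Rightarrow> complex) \<Rightarrow> real ^ 'N \<Rightarrow> complex" where
  "iter_partial ks f = foldr partial ks f"

text \<open>Differentiability of all iterated partial derivatives makes them all continuous,
  so this is the usual class of infinitely differentiable functions.\<close>

definition smooth :: "(real ^ 'N \<Rightarrow> complex) \<Rightarrow> bool" where
  "smooth f \<longleftrightarrow> (\<forall>ks x. iter_partial ks f differentiable (at x))"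

definition test_function :: "(real ^ 'N \<Rightarrow> complex) \<Rightarrow> bool" where
  "test_function f \<longleftrightarrow> smooth f \<and> compact (closure {x. f x \<noteq> 0})"

definition schwartz :: "(real ^ 'N \<Rightarrow> complex) \<Rightarrow> bool" where
  "schwartz f \<longleftrightarrow> smooth f \<and>
     (\<forall>ks m. \<exists>B. \<forall>x. (1 + norm x) ^ m * norm (iter_partial ks f x) \<le> B)"

section \<open>Distributions\<close>

text \<open>A distribution is represented by its action on functions, and the pairing is bilinear
  (no conjugation).  Continuity is not part of the type: the only distributions below
  are those given by locally integrable functions, and their derivatives.\<close>

type_synonym 'N distribution = "(real ^ 'N \<Rightarrow> complex) \<Rightarrow> complex"

definition regular :: "(real ^ 'N \<Rightarrow> complex) \<Rightarrow> 'N distribution" where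
  "regular f = (\<lambda>\<phi>. LINT x|lebesgue. f x * \<phi> x)"

definition dist_eq :: "('N::finite) distribution \<Rightarrow> 'N distribution \<Rightarrow> bool" where
  "dist_eq S T \<longleftrightarrow> (\<forall>\<phi>. test_function \<phi> \<longrightarrow> S \<phi> = T \<phi>)"

definition dist_partial :: "'N::finite \<Rightarrow> 'N distribution \<Rightarrow> 'N distribution" where
  "dist_partial k T = (\<lambda>\<phi>. - T (partial k \<phi>))"

section \<open>Systems of vector fields with constant complex coefficients\<close>

text \<open>The vector field with coefficients \<open>a\<close> is identified with \<open>a :: complex ^ 'N\<close>, and a system
  of vector fields indexed by \<open>'n\<close> with its coefficient matrix.\<close>

definition vf_apply :: "complex ^ 'N \<Rightarrow> 'N distribution \<Rightarrow> 'N distribution" where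
  "vf_apply a T = (\<lambda>\<phi>. \<Sum>k\<in>UNIV. a $ k * dist_partial k T \<phi>)"

definition vf_adjoint :: "complex ^ 'N \<Rightarrow> complex ^ 'N" where
  "vf_adjoint a = (\<chi> k. - cnj (a $ k))"

definition lin_indep_system :: "complex ^ 'N ^ 'n \<Rightarrow> bool" where
  "lin_indep_system L \<longleftrightarrow> inj (($) L) \<and> vec.independent (range (($) L))"

definition elliptic_system :: "complex ^ 'N ^ 'n \<Rightarrow> bool" where
  "elliptic_system L \<longleftrightarrow>
     (\<forall>\<xi> :: real ^ 'N. (\<forall>j. (\<Sum>k\<in>UNIV. L $ j $ k * complex_of_real (\<xi> $ k)) = 0) \<longrightarrow> \<xi> = 0)"

definition div_adj :: "complex ^ 'N ^ 'n \<Rightarrow> (real ^ 'N \<Rightarrow> complex ^ 'n) \<Rightarrow> 'N distribution" where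
  "div_adj L V = (\<lambda>\<phi>. \<Sum>j\<in>UNIV. vf_apply (vf_adjoint (L $ j)) (regular (\<lambda>x. V x $ j)) \<phi>)"

definition curl :: "complex ^ 'N ^ 'n \<Rightarrow> (real ^ 'N \<Rightarrow> complex ^ 'n) \<Rightarrow> 'n \<Rightarrow> 'n \<Rightarrow> 'N distribution" where
  "curl L W i j = (\<lambda>\<phi>. vf_apply (L $ i) (regular (\<lambda>x. W x $ j)) \<phi>
                      - vf_apply (L $ j) (regular (\<lambda>x. W x $ i)) \<phi>)"

section \<open>Lebesgue and local Hardy spaces\<close>

definition in_Lp :: "real \<Rightarrow> (real ^ 'N \<Rightarrow> 'b::euclidean_space) \<Rightarrow> bool" where
  "in_Lp p f \<longleftrightarrow> f \<in> borel_measurable lebesgue \<and> integrable lebesgue (\<lambda>x. norm (f x) powr p)"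

definition Lp_norm :: "real \<Rightarrow> (real ^ 'N \<Rightarrow> 'b::euclidean_space) \<Rightarrow> real" where
  "Lp_norm p f = (LINT x|lebesgue. norm (f x) powr p) powr (1 / p)"

text \<open>The distribution \<open>curl L W\<close> is given by the matrix-valued function \<open>G\<close>, which is then
  unique up to null sets; the norm on matrices is the Euclidean (Frobenius) one.\<close>

definition curl_is :: "complex ^ 'N ^ 'n \<Rightarrow> (real ^ 'N \<Rightarrow> complex ^ 'n) \<Rightarrow> (real ^ 'N \<Rightarrow> complex ^ 'n ^ 'n) \<Rightarrow> bool" where
  "curl_is L W G \<longleftrightarrow> (\<forall>i j. dist_eq (curl L W i j) (regular (\<lambda>x. G x $ i $ j)))"

definition herm_prod :: "complex ^ 'n \<Rightarrow> complex ^ 'n \<Rightarrow> complex" where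
  "herm_prod v w = (\<Sum>j\<in>UNIV. v $ j * cnj (w $ j))"

definition dilate :: "real \<Rightarrow> (real ^ 'N \<Rightarrow> complex) \<Rightarrow> real ^ 'N \<Rightarrow> complex" where
  "dilate t \<phi> = (\<lambda>x. \<phi> (x /\<^sub>R t) /\<^sub>R t ^ CARD('N))"

definition local_maximal :: "(real ^ 'N \<Rightarrow> complex) \<Rightarrow> 'N distribution \<Rightarrow> real ^ 'N \<Rightarrow> ennreal" where
  "local_maximal \<phi> T x = (SUP t\<in>{0<..<1}. ennreal (norm (T (\<lambda>y. dilate t \<phi> (x - y)))))"

definition h1_norm :: "(real ^ 'N \<Rightarrow> complex) \<Rightarrow> 'N distribution \<Rightarrow> ennreal" where
  "h1_norm \<phi> T = (\<integral>\<^sup>+ x. local_maximal \<phi> T x \<partial>lebesgue)"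

end

theory Submission
  imports Defs
begin

text \<open>Write \<open>w\<close> for the conjugate of \<open>W\<close> and \<open>m\<close> for the conjugate of \<open>L\<close>, so that \<open>\<Sum>j. m\<^sub>j V\<^sub>j = 0\<close> and
  \<open>m\<^sub>i w\<^sub>j - m\<^sub>j w\<^sub>i = g\<^sub>i\<^sub>j\<close>. By ellipticity \<open>\<Sum>i. m\<^sub>i\<^sup>* m\<^sub>i\<close> is, after a linear change of variables, the
  Laplacian, because its symbol is a real positive definite quadratic form. Hence there are explicit
  kernels \<open>K\<^sub>i = O(\<bar>x\<bar> powr (1 - N))\<close> with \<open>\<Sum>i. m\<^sub>i K\<^sub>i = \<delta>\<close>. For cutoffs \<open>\<psi>1\<close>, \<open>\<psi>2\<close> with \<open>\<psi>1 * \<psi>2 = \<phi>\<close> this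
  decomposes \<open>\<psi>2 w\<close> into a gradient \<open>m\<^sub>j u\<close> and an error, both given by the \<open>K\<^sub>i\<close>
  applied to \<open>w\<close> and \<open>g\<close>. In the integral of \<open>\<phi> V \<cdot> w\<close> the gradient is moved onto \<open>\<psi>1\<close>, since \<open>V\<close> is divergence
  free. What remains are bilinear forms with kernel \<open>\<bar>y - z\<bar> powr (1 - N)\<close>, whose smoothing
  leaves room for exponents \<open>p / q\<close> and \<open>p' / q\<close> with \<open>q > 1\<close>. Rescaling bounds the local maximal function of
  \<open>V \<cdot> w\<close> by \<open>M(\<bar>V\<bar> powr (p / q)) powr (q / p) * M((\<bar>w\<bar> + \<bar>g\<bar>) powr (p' / q)) powr (q / p')\<close>, and
  the Hardy-Littlewood theorem in \<open>L\<^sup>q\<close> together with Hoelder's inequality concludes.\<close>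

section \<open>Calculus of smooth functions\<close>

text \<open>Two obstacles shape the argument. In a true fundamental solution a derivative of the
  kernel has size \<open>\<bar>x\<bar> powr (- N)\<close>, which leads to singular integrals. The
  kernels therefore carry a parameter \<open>e > 0\<close> that makes them smooth: every
  manipulation is then Fubini or the definition of a weak derivative, and since no derivative is
  left on a kernel at the end, only size bounds uniform in \<open>e\<close> are needed. The other
  obstacle is that \<phi> is merely a Schwartz function. It is split as
  \<open>(\<phi> / weight) * weight\<close>, two factors decaying like \<open>weight\<close>, each
  multiplied by a dilated cutoff. The bilinear forms are thus weighted forms on the whole space, and
  the weight is dominated by a summable combination of dyadic balls, which is how maximal functions
  appear. The gain \<open>q > 1\<close> is essential because the maximal theorem fails in
  \<open>L^1\<close>. It costs a power \<open>r = 1 / (2 - q)\<close> of the kernel, locally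
  integrable exactly when \<open>N * (q - 1) < 1\<close>. Locality enters through scaling: rescaling
  by \<open>t\<close> multiplies the curl by \<open>t\<close>, which is harmless for
  \<open>t < 1\<close>.\<close>

lemma partial_eqI: "(f has_derivative f') (at x) \<Longrightarrow> partial k f x = f' (axis k 1)"
  unfolding partial_def using frechet_derivative_at by metis

text \<open>Iterated partials of \<open>f\<close> stay in any set closed under
  \<open>partial\<close>; differentiability on that set then gives smoothness without formulas for
  higher derivatives.\<close>

lemma smooth_coinduct:
  assumes "f \<in> S"
    and "\<And>f x. f \<in> S \<Longrightarrow> f differentiable (at x)"
    and "\<And>f k. f \<in> S \<Longrightarrow> partial k f \<in> S"
  shows "smooth f"
proof -
  have "iter_partial ks f \<in> S" for ks
    by (induction ks) (use assms in \<open>auto simp: iter_partial_def\<close>)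
  then show ?thesis
    unfolding smooth_def using assms(2) by blast
qed

lemma smooth_differentiable: "smooth f \<Longrightarrow> f differentiable (at x)"
  unfolding smooth_def iter_partial_def by (metis foldr.simps(1) id_apply)

lemma smooth_partial: "smooth f \<Longrightarrow> smooth (partial k f)"
proof -
  have "iter_partial ks (partial k f) = iter_partial (ks @ [k]) f" for ks
    by (simp add: iter_partial_def)
  then show "smooth f \<Longrightarrow> smooth (partial k f)"
    unfolding smooth_def by metis
qed

lemma smooth_continuous_on: "smooth f \<Longrightarrow> continuous_on A f"
  by (meson continuous_at_imp_continuous_on differentiable_imp_continuous_within smooth_differentiable)

lemma smooth_borel: "smooth f \<Longrightarrow> f \<in> borel_measurable borel"
  by (intro borel_measurable_continuous_onI smooth_continuous_on)

lemma partial_const: "partial k (\<lambda>x. c) = (\<lambda>x. 0)"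
  by (rule ext, rule trans[OF partial_eqI[OF has_derivative_const]]) simp

lemma partial_add:
  assumes "f differentiable (at x)" "g differentiable (at x)"
  shows "partial k (\<lambda>x. f x + g x) x = partial k f x + partial k g x"
  using has_derivative_add[OF frechet_derivative_works[THEN iffD1, OF assms(1)] frechet_derivative_works[THEN iffD1, OF assms(2)]]
  by (subst partial_eqI) (auto simp: partial_def)

lemma partial_mult:
  assumes "f differentiable (at x)" "g differentiable (at x)"
  shows "partial k (\<lambda>x. f x * g x) x = partial k f x * g x + f x * partial k g x"
  using has_derivative_mult[OF frechet_derivative_works[THEN iffD1, OF assms(1)] frechet_derivative_works[THEN iffD1, OF assms(2)]]
  by (subst partial_eqI) (auto simp: partial_def add.commute)

lemma partial_affine:
  assumes "f differentiable (at (a + c *\<^sub>R x))"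
  shows "partial k (\<lambda>x. f (a + c *\<^sub>R x)) x = of_real c * partial k f (a + c *\<^sub>R x)"
proof -
  let ?D = "frechet_derivative f (at (a + c *\<^sub>R x))"
  have D: "(f has_derivative ?D) (at (a + c *\<^sub>R x))"
    using assms frechet_derivative_works by blast
  have "((\<lambda>x. f (a + c *\<^sub>R x)) has_derivative (\<lambda>h. ?D (c *\<^sub>R h))) (at x)"
    by (rule has_derivative_compose[where f = "\<lambda>x. a + c *\<^sub>R x" and g = f and g' = ?D])
       (auto intro!: derivative_eq_intros D)
  moreover have "?D (c *\<^sub>R h) = of_real c * ?D h" for h
    using linear_scale[OF has_derivative_linear[OF D]] by (simp add: scaleR_conv_of_real)
  ultimately show ?thesis
    by (subst partial_eqI) (auto simp: partial_def)
qed

lemma partial_cnj: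
  assumes "f differentiable (at x)"
  shows "partial k (\<lambda>x. cnj (f x)) x = cnj (partial k f x)"
  using has_derivative_cnj[OF frechet_derivative_works[THEN iffD1, OF assms]]
  by (subst partial_eqI) (auto simp: partial_def)

text \<open>Generated by pointwise sums and products only; constants enter as members of
  \<open>S\<close>.\<close>

inductive_set fun_algebra :: "(real ^ 'N \<Rightarrow> complex) set \<Rightarrow> (real ^ 'N \<Rightarrow> complex) set"
  for S where
  base: "f \<in> S \<Longrightarrow> f \<in> fun_algebra S"
| add: "f \<in> fun_algebra S \<Longrightarrow> g \<in> fun_algebra S \<Longrightarrow> (\<lambda>x. f x + g x) \<in> fun_algebra S"
| mult: "f \<in> fun_algebra S \<Longrightarrow> g \<in> fun_algebra S \<Longrightarrow> (\<lambda>x. f x * g x) \<in> fun_algebra S"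

text \<open>Sums and products differentiate into sums and products, so only the derivatives of the
  generators must be shown to stay in the algebra.\<close>

lemma smooth_fun_algebra:
  assumes "\<And>f x. f \<in> S \<Longrightarrow> f differentiable (at x)"
    and "\<And>f k. f \<in> S \<Longrightarrow> partial k f \<in> fun_algebra S"
    and "f \<in> fun_algebra S"
  shows "smooth f"
proof (rule smooth_coinduct)
  show "f \<in> fun_algebra S" by fact
  show diff: "f differentiable (at x)" if "f \<in> fun_algebra S" for f and x
    using that by (induction) (auto intro: assms(1) differentiable_add differentiable_mult)
  show "partial k f \<in> fun_algebra S" if "f \<in> fun_algebra S" for f k
    using that
  proof induction
    case (add f g)
    then have "partial k (\<lambda>x. f x + g x) = (\<lambda>x. partial k f x + partial k g x)"
      by (auto simp: diff partial_add)
    then show ?case by (simp only:) (intro fun_algebra.add add)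
  next
    case (mult f g)
    then have "partial k (\<lambda>x. f x * g x) = (\<lambda>x. partial k f x * g x + f x * partial k g x)"
      by (auto simp: diff partial_mult)
    then show ?case by (simp only:) (intro fun_algebra.add fun_algebra.mult mult)
  qed (use assms in auto)
qed

lemma smooth_fun_algebra_smooth: "f \<in> fun_algebra (Collect smooth) \<Longrightarrow> smooth f"
  by (erule smooth_fun_algebra[rotated 2])
     (auto intro: smooth_differentiable smooth_partial fun_algebra.base)

lemma smooth_add: "smooth f \<Longrightarrow> smooth g \<Longrightarrow> smooth (\<lambda>x. f x + g x)"
  by (intro smooth_fun_algebra_smooth fun_algebra.intros) auto

lemma smooth_mult: "smooth f \<Longrightarrow> smooth g \<Longrightarrow> smooth (\<lambda>x. f x * g x)"
  by (intro smooth_fun_algebra_smooth fun_algebra.intros) auto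

lemma smooth_const: "smooth (\<lambda>x. c)"
  by (rule smooth_coinduct[of _ "{\<lambda>x. c, \<lambda>x. 0}"]) (auto simp: partial_const)

lemma smooth_sum:
  assumes "\<And>i. i \<in> I \<Longrightarrow> smooth (f i)"
  shows "smooth (\<lambda>x. \<Sum>i\<in>I. f i x)"
  using assms by (induction I rule: infinite_finite_induct) (auto simp: smooth_const smooth_add)

lemma has_derivative_coord:
  "((\<lambda>x. complex_of_real (x $ k)) has_derivative (\<lambda>h. complex_of_real (h $ k))) (at x)"
  by (intro bounded_linear_imp_has_derivative bounded_linear_compose[OF bounded_linear_of_real bounded_linear_vec_nth])

lemma partial_coord:
  "partial l (\<lambda>x. complex_of_real (x $ k)) x = (if l = k then 1 else 0)"
  by (subst partial_eqI[OF has_derivative_coord]) (auto simp: axis_def)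

lemma smooth_coord:
  fixes k :: "'N::finite"
  shows "smooth (\<lambda>x. complex_of_real (x $ k))"
proof -
  let ?S = "{\<lambda>x. complex_of_real (x $ k)} \<union> range (\<lambda>c x. c)"
  have const: "(\<lambda>x. c) \<in> ?S" for c by blast
  show ?thesis
  proof (rule smooth_coinduct[of _ ?S])
    fix f assume "f \<in> ?S"
    then consider "f = (\<lambda>x. complex_of_real (x $ k))" | c where "f = (\<lambda>x. c)" by blast
    note cases = this
    show "f differentiable (at x)" for x
      by (cases rule: cases) (use has_derivative_coord in \<open>auto simp: differentiable_def intro: has_derivative_const\<close>)
    show "partial l f \<in> ?S" for l
    proof (cases rule: cases)
      case 1
      then have "partial l f = (\<lambda>x. if l = k then 1 else 0)" by (auto simp: partial_coord)
      then show ?thesis using const by simp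
    next
      case 2
      then have "partial l f = (\<lambda>x. 0)" by (simp add: partial_const)
      then show ?thesis using const by simp
    qed
  qed blast
qed

lemma smooth_affine:
  assumes "smooth f"
  shows "smooth (\<lambda>x. f (a + c *\<^sub>R x))"
\<comment> \<open>Each differentiation brings out a factor \<open>c\<close>, hence the closure under
  scalar factors \<open>b\<close>.\<close>
proof (rule smooth_coinduct[of _ "{\<lambda>x. b * f (a + c *\<^sub>R x) | f b. smooth f}"])
  show "(\<lambda>x. f (a + c *\<^sub>R x)) \<in> {\<lambda>x. b * f (a + c *\<^sub>R x) | f b. smooth f}"
    using assms by (auto intro!: exI[of _ f] exI[of _ 1])
  fix h assume "h \<in> {\<lambda>x. b * f (a + c *\<^sub>R x) | f b. smooth f}"
  then obtain f b where h: "h = (\<lambda>x. b * f (a + c *\<^sub>R x))" and f: "smooth f" by auto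
  have d: "(\<lambda>x. f (a + c *\<^sub>R x)) differentiable (at x)" for x
    using differentiable_compose[OF smooth_differentiable[OF f], of "\<lambda>x. a + c *\<^sub>R x" x UNIV]
    by (simp add: differentiable_add)
  then show "h differentiable (at x)" for x
    unfolding h by (intro differentiable_mult) auto
  show "partial k h \<in> {\<lambda>x. b * f (a + c *\<^sub>R x) | f b. smooth f}" for k
  proof -
    have "partial k h = (\<lambda>x. (b * of_real c) * partial k f (a + c *\<^sub>R x))"
      unfolding h by (auto simp: partial_mult d partial_const partial_affine smooth_differentiable f)
    then show ?thesis using smooth_partial[OF f] by blast
  qed
qed

lemma smooth_cnj:
  assumes "smooth f"
  shows "smooth (\<lambda>x. cnj (f x))"
proof (rule smooth_coinduct[of _ "{\<lambda>x. cnj (f x) | f. smooth f}"])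
  fix h assume "h \<in> {\<lambda>x. cnj (f x) | f. smooth f}"
  then obtain f where h: "h = (\<lambda>x. cnj (f x))" and f: "smooth f" by auto
  show "h differentiable (at x)" for x
    unfolding h using has_derivative_cnj smooth_differentiable[OF f, of x] by (fastforce simp: differentiable_def)
  have "partial k h = (\<lambda>x. cnj (partial k f x))" for k
    unfolding h by (auto simp: partial_cnj smooth_differentiable f)
  then show "partial k h \<in> {\<lambda>x. cnj (f x) | f. smooth f}" for k using smooth_partial[OF f] by auto
qed (use assms in auto)

text \<open>Two terms in the derivative accommodate both the powers \<open>r powr s\<close> and the functions
  \<open>exp (- 1 / r) / r ^ m\<close>.\<close>

lemma smooth_compose_real:
  fixes g :: "real ^ 'N \<Rightarrow> real" and F :: "'i \<Rightarrow> real \<Rightarrow> real"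
  assumes g: "smooth (\<lambda>x. complex_of_real (g x))"
    and F: "\<And>i x. (F i has_real_derivative a i * F (d i) (g x) + b i * F (e i) (g x)) (at (g x))"
  shows "smooth (\<lambda>x. complex_of_real (F i (g x)))"
    and "partial k (\<lambda>x. complex_of_real (F i (g x))) x =
      of_real (a i * F (d i) (g x) + b i * F (e i) (g x)) * partial k (\<lambda>x. complex_of_real (g x)) x"
proof -
  have D: "((\<lambda>x. complex_of_real (F i (g x))) has_derivative
      (\<lambda>h. of_real (a i * F (d i) (g x) + b i * F (e i) (g x)) *
        frechet_derivative (\<lambda>x. complex_of_real (g x)) (at x) h)) (at x)" for i x
  proof -
    let ?G = "frechet_derivative (\<lambda>x. complex_of_real (g x)) (at x)"
    have G: "((\<lambda>x. complex_of_real (g x)) has_derivative ?G) (at x)"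
      using smooth_differentiable[OF g] frechet_derivative_works by blast
    from has_derivative_Re[OF this] have gD: "(g has_derivative (\<lambda>h. Re (?G h))) (at x)" by simp
    \<comment> \<open>The derivative of a real-valued function takes real values; this lets the
      chain rule for the real function \<open>F i\<close> be read as an identity between complex
      derivatives.\<close>
    have "?G = (\<lambda>h. of_real (Re (?G h)))"
      using has_derivative_unique[OF G has_derivative_of_real[OF gD]] by simp
    then have e: "of_real (Re (?G h)) = ?G h" for h by metis
    have "((\<lambda>x. complex_of_real (F i (g x))) has_derivative
      (\<lambda>h. of_real ((a i * F (d i) (g x) + b i * F (e i) (g x)) * Re (?G h)))) (at x)"
      by (intro has_derivative_of_real has_derivative_compose[OF gD] F[unfolded has_field_derivative_def])
    then show ?thesis by (simp only: of_real_mult e)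
  qed
  then have P: "partial k (\<lambda>x. complex_of_real (F i (g x))) x =
      of_real (a i * F (d i) (g x) + b i * F (e i) (g x)) * partial k (\<lambda>x. complex_of_real (g x)) x" for i k x
    by (subst partial_eqI[OF D]) (simp add: partial_def)
  then show "partial k (\<lambda>x. complex_of_real (F i (g x))) x =
      of_real (a i * F (d i) (g x) + b i * F (e i) (g x)) * partial k (\<lambda>x. complex_of_real (g x)) x" .
  \<comment> \<open>All smooth functions join the generators because the inner derivative of
    \<open>g\<close> appears as a factor.\<close>
  let ?S = "range (\<lambda>i x. complex_of_real (F i (g x))) \<union> Collect smooth"
  show "smooth (\<lambda>x. complex_of_real (F i (g x)))"
  proof (rule smooth_fun_algebra[of ?S])
    fix f assume "f \<in> ?S"
    then consider i where "f = (\<lambda>x. complex_of_real (F i (g x)))" | "smooth f" by auto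
    note cases = this
    show "f differentiable (at x)" for x
    proof (cases rule: cases)
      case 1
      then show ?thesis unfolding differentiable_def using D by blast
    qed (rule smooth_differentiable)
    show "partial k f \<in> fun_algebra ?S" for k
    proof (cases rule: cases)
      case (1 i)
      have "partial k f = (\<lambda>x. (of_real (a i) * of_real (F (d i) (g x)) + of_real (b i) * of_real (F (e i) (g x)))
          * partial k (\<lambda>x. complex_of_real (g x)) x)"
        unfolding 1 P by simp
      then show ?thesis
        by (auto intro!: fun_algebra.mult fun_algebra.add intro: fun_algebra.base smooth_const smooth_partial[OF g])
    qed (auto intro: fun_algebra.base smooth_partial)
  qed (auto intro: fun_algebra.base)
qed

lemma smooth_powr:
  fixes g :: "real ^ 'N \<Rightarrow> real"
  assumes "smooth (\<lambda>x. complex_of_real (g x))" "\<And>x. g x > 0"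
  shows "smooth (\<lambda>x. complex_of_real (g x powr s))"
    and "partial k (\<lambda>x. complex_of_real (g x powr s)) x =
      of_real (s * g x powr (s - 1)) * partial k (\<lambda>x. complex_of_real (g x)) x"
  using smooth_compose_real[OF assms(1), where F = "\<lambda>s r. r powr s" and a = "\<lambda>s. s" and d = "\<lambda>s. s - 1"
      and b = "\<lambda>s. 0" and e = "\<lambda>s. s" and i = s]
  by (auto simp: assms has_real_derivative_powr)

section \<open>A flat function of one variable\<close>

lemma power_div_fact_le_exp:
  fixes x :: real
  assumes "0 \<le> x"
  shows "x ^ n / fact n \<le> exp x"
proof -
  have "(\<Sum>k\<in>{n}. x ^ k /\<^sub>R fact k) \<le> (\<Sum>k. x ^ k /\<^sub>R fact k)"
    by (rule sum_le_suminf) (use assms in \<open>auto simp: summable_exp\<close>)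
  then show ?thesis by (simp add: exp_def divide_inverse mult.commute)
qed

text \<open>The division by \<open>r ^ m\<close> makes the family closed under differentiation up to
  coefficients: the derivative of \<open>exp_cut m\<close> involves \<open>exp_cut (m + 2)\<close>
  and \<open>exp_cut (m + 1)\<close>. The cutoff uses \<open>m = 0\<close>.\<close>

definition exp_cut :: "nat \<Rightarrow> real \<Rightarrow> real" where
  "exp_cut m r = (if r > 0 then exp (- 1 / r) / r ^ m else 0)"

text \<open>Away from 0 this is a computation. At 0 a quadratic bound, obtained from one term of the
  exponential series, makes the difference quotient vanish.\<close>

lemma exp_cut_deriv:
  "(exp_cut m has_real_derivative 1 * exp_cut (m + 2) r + (- real m) * exp_cut (m + 1) r) (at r)"
proof -
  consider "r > 0" | "r < 0" | "r = 0" by linarith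
  then show ?thesis
  proof cases
    case 1
    have "((\<lambda>r. exp (- 1 / r) * r powr (- real m)) has_real_derivative
       exp (- 1 / r) * (1 / r^2) * r powr (- real m) + exp (- 1 / r) * (- real m * r powr (- real m - 1))) (at r)"
      using 1 by (auto intro!: derivative_eq_intros simp: power2_eq_square)
    moreover have "exp (- 1 / r) * (1 / r^2) * r powr (- real m) + exp (- 1 / r) * (- real m * r powr (- real m - 1))
       = 1 * exp_cut (m + 2) r + (- real m) * exp_cut (m + 1) r"
      using 1 by (simp add: exp_cut_def powr_diff powr_minus powr_realpow power_add field_simps power2_eq_square)
    ultimately have "((\<lambda>r. exp (- 1 / r) * r powr (- real m)) has_real_derivative
       1 * exp_cut (m + 2) r + (- real m) * exp_cut (m + 1) r) (at r)" by simp
    then show ?thesis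
      by (rule has_field_derivative_transform_within_open[of _ _ _ "{0<..}"])
         (use 1 in \<open>auto simp: exp_cut_def powr_minus powr_realpow divide_inverse\<close>)
  next
    case 2
    have "((\<lambda>r. 0) has_real_derivative 0) (at r)" by simp
    then have "(exp_cut m has_real_derivative 0) (at r)"
      by (rule has_field_derivative_transform_within_open[of _ _ _ "{..<0}"]) (use 2 in \<open>auto simp: exp_cut_def\<close>)
    then show ?thesis using 2 by (simp add: exp_cut_def)
  next
    case 3
    \<comment> \<open>The exponent \<open>m + 2\<close> pays for the division by
      \<open>h ^ m\<close> and leaves \<open>h ^ 2\<close>.\<close>
    have bound: "\<bar>exp_cut m h\<bar> \<le> fact (m + 2) * h ^ 2" for h
    proof (cases "h > 0")
      case True
      have "(1 / h) ^ (m + 2) / fact (m + 2) \<le> exp (1 / h)"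
        by (rule power_div_fact_le_exp) (use True in simp)
      then have "inverse (exp (1 / h)) \<le> inverse ((1 / h) ^ (m + 2) / fact (m + 2))"
        by (rule le_imp_inverse_le) (use True in \<open>simp only: zero_less_divide_iff zero_less_power fact_gt_zero simp_thms zero_less_one\<close>)
      then have "exp (- 1 / h) \<le> fact (m + 2) * h ^ 2 * h ^ m"
        using True by (simp add: exp_minus inverse_eq_divide field_simps power_add power2_eq_square)
      then show ?thesis using True
        by (simp add: exp_cut_def pos_divide_le_eq)
    qed (simp add: exp_cut_def)
    have "((\<lambda>h. exp_cut m h / h) \<longlongrightarrow> 0) (at 0)"
    proof (rule Lim_null_comparison[of _ "\<lambda>h. fact (m + 2) * \<bar>h\<bar>"])
      show "\<forall>\<^sub>F h in at 0. norm (exp_cut m h / h) \<le> fact (m + 2) * \<bar>h\<bar>"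
      proof (rule always_eventually, safe)
        fix h :: real
        show "norm (exp_cut m h / h) \<le> fact (m + 2) * \<bar>h\<bar>"
          using bound[of h]
          by (cases "h = 0") (auto simp: divide_le_eq power2_eq_square abs_mult[symmetric] mult.assoc)
      qed
      show "((\<lambda>h::real. fact (m + 2) * \<bar>h\<bar>) \<longlongrightarrow> 0) (at 0)"
        by (rule tendsto_eq_intros refl | simp)+
    qed
    then have "(exp_cut m has_real_derivative 0) (at 0)"
      by (simp add: has_field_derivative_iff exp_cut_def[of m 0])
    then show ?thesis using 3 by (simp add: exp_cut_def)
  qed
qed

text \<open>The coefficients \<open>a\<close> and \<open>b\<close> let one statement serve both the
  cutoff, built on \<open>1 - (norm x)\<^sup>2\<close>, and the weight, built on
  \<open>1 + (norm x)\<^sup>2\<close>.\<close>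

lemma
  fixes x :: "real ^ 'N"
  shows smooth_norm_sq: "smooth (\<lambda>x :: real ^ 'N. complex_of_real (a + b * (norm x)\<^sup>2))"
  and partial_norm_sq: "partial k (\<lambda>x. complex_of_real (a + b * (norm x)\<^sup>2)) x = of_real (2 * b * x $ k)"
proof -
  have "(norm x)\<^sup>2 = (\<Sum>k\<in>UNIV. x $ k * x $ k)" for x :: "real ^ 'N"
    by (simp add: power2_norm_eq_inner inner_vec_def)
  then have "(\<lambda>x :: real ^ 'N. complex_of_real (a + b * (norm x)\<^sup>2))
      = (\<lambda>x. of_real a + of_real b * (\<Sum>k\<in>UNIV. complex_of_real (x $ k) * complex_of_real (x $ k)))"
    by (simp only: of_real_add of_real_mult of_real_sum)
  then show "smooth (\<lambda>x :: real ^ 'N. complex_of_real (a + b * (norm x)\<^sup>2))"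
    by (simp only:) (intro smooth_add smooth_mult smooth_const smooth_sum smooth_coord)
  have "((\<lambda>x. complex_of_real (a + b * (norm x)\<^sup>2)) has_derivative (\<lambda>h. of_real (b * (x \<bullet> h + h \<bullet> x)))) (at x)"
    unfolding power2_norm_eq_inner by (rule derivative_eq_intros refl | simp)+
  from partial_eqI[OF this] show "partial k (\<lambda>x. complex_of_real (a + b * (norm x)\<^sup>2)) x = of_real (2 * b * x $ k)"
    by (simp add: inner_axis inner_axis')
qed

section \<open>Test functions and the standard cutoff\<close>

lemma test_function_iff:
  "test_function f \<longleftrightarrow> smooth f \<and> (\<exists>R. \<forall>x. f x \<noteq> 0 \<longrightarrow> norm x \<le> R)"
proof -
  have "compact (closure {x. f x \<noteq> 0}) \<longleftrightarrow> bounded {x. f x \<noteq> 0}"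
    by (simp add: compact_eq_bounded_closed) (meson bounded_closure bounded_subset closure_subset)
  then show ?thesis by (auto simp: test_function_def bounded_iff)
qed

lemma test_function_smooth: "test_function f \<Longrightarrow> smooth f"
  by (simp add: test_function_def)

lemma test_function_mult: "test_function f \<Longrightarrow> smooth g \<Longrightarrow> test_function (\<lambda>x. f x * g x)"
  unfolding test_function_iff by (auto intro: smooth_mult)

lemma test_function_mult': "smooth g \<Longrightarrow> test_function f \<Longrightarrow> test_function (\<lambda>x. g x * f x)"
  unfolding test_function_iff by (auto intro: smooth_mult)

lemma test_function_cnj: "test_function f \<Longrightarrow> test_function (\<lambda>x. cnj (f x))"
  unfolding test_function_iff by (auto intro: smooth_cnj)

lemma test_function_affine:
  assumes "test_function f" "c \<noteq> 0"
  shows "test_function (\<lambda>x. f (a + c *\<^sub>R x))"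
proof -
  obtain R where R: "\<And>x. f x \<noteq> 0 \<Longrightarrow> norm x \<le> R" and f: "smooth f"
    using assms by (auto simp: test_function_iff)
  have "norm x \<le> (R + norm a) / \<bar>c\<bar>" if "f (a + c *\<^sub>R x) \<noteq> 0" for x
  proof -
    have "norm (c *\<^sub>R x) \<le> norm (a + c *\<^sub>R x) + norm a"
      by (metis add.commute add_diff_cancel_left' norm_triangle_sub norm_minus_commute norm_triangle_ineq4)
    then have "\<bar>c\<bar> * norm x \<le> R + norm a" using R[OF that] by simp
    then show ?thesis using assms(2) by (simp add: field_simps)
  qed
  then show ?thesis using smooth_affine[OF f] by (auto simp: test_function_iff)
qed

lemma test_function_partial:
  assumes "test_function f"
  shows "test_function (partial k f)"
proof -
  obtain R where R: "\<And>x. f x \<noteq> 0 \<Longrightarrow> norm x \<le> R" and f: "smooth f"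
    using assms by (auto simp: test_function_iff)
  have "partial k f x = 0" if "norm x > R" for x
  proof -
    have "((\<lambda>x. 0) has_derivative (\<lambda>x. 0)) (at x)" by simp
    then have "(f has_derivative (\<lambda>x. 0)) (at x)"
      by (rule has_derivative_transform_within_open[of _ _ _ _ "- cball 0 R"])
         (use that R in \<open>auto simp: open_Compl not_le\<close>, metis not_le)
    then show ?thesis by (subst partial_eqI) auto
  qed
  then show ?thesis using smooth_partial[OF f] unfolding test_function_iff by (meson not_le)
qed

lemma test_function_bounded:
  assumes "test_function f"
  obtains B where "B \<ge> 0" "\<And>x. norm (f x) \<le> B"
proof -
  have "compact (closure {x. f x \<noteq> 0})" using assms by (simp add: test_function_def)
  then have "bounded (f ` closure {x. f x \<noteq> 0})"
    by (intro compact_imp_bounded compact_continuous_image smooth_continuous_on test_function_smooth assms)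
  then obtain B where B: "\<And>x. x \<in> closure {x. f x \<noteq> 0} \<Longrightarrow> norm (f x) \<le> B"
    unfolding bounded_iff by auto
  have "norm (f x) \<le> max B 0" for x
    using B[of x] closure_subset[of "{x. f x \<noteq> 0}"] by (cases "f x = 0") (auto simp: le_max_iff_disj)
  then show ?thesis using that[of "max B 0"] by auto
qed

text \<open>The factor \<open>exp 1\<close> normalises the value at 0 to 1, so that the dilates
  \<open>cutoff (c *\<^sub>R x)\<close> tend to 1 pointwise as \<open>c\<close> tends to 0.\<close>

definition cutoff :: "real ^ 'N \<Rightarrow> complex" where
  "cutoff x = of_real (exp 1 * exp_cut 0 (1 - (norm x)\<^sup>2))"

lemma cutoff_0: "cutoff 0 = 1"
  by (simp add: cutoff_def exp_cut_def exp_minus)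

lemma test_function_cutoff: "test_function (cutoff :: real ^ 'N \<Rightarrow> complex)"
proof -
  have "smooth (\<lambda>x :: real ^ 'N. complex_of_real (exp_cut 0 (1 + (-1) * (norm x)\<^sup>2)))"
    by (rule smooth_compose_real(1)[OF smooth_norm_sq exp_cut_deriv])
  then have "smooth (\<lambda>x :: real ^ 'N. complex_of_real (exp 1) * complex_of_real (exp_cut 0 (1 + (-1) * (norm x)\<^sup>2)))"
    by (intro smooth_mult smooth_const)
  moreover have "(\<lambda>x :: real ^ 'N. complex_of_real (exp 1) * complex_of_real (exp_cut 0 (1 + (-1) * (norm x)\<^sup>2))) = cutoff"
    by (auto simp: cutoff_def)
  moreover have "norm x \<le> 1" if "cutoff x \<noteq> 0" for x :: "real ^ 'N"
  proof (rule ccontr)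
    assume "\<not> norm x \<le> 1"
    then have "(norm x)\<^sup>2 \<ge> 1" by (simp add: one_le_power)
    then show False using that by (simp add: cutoff_def exp_cut_def)
  qed
  ultimately show ?thesis by (auto simp: test_function_iff)
qed

section \<open>The Hardy-Littlewood maximal function\<close>

lemma ball_sets_borel [measurable]: "ball x r \<in> sets borel" for x :: "'a::metric_space"
  by simp

lemma nn_integral_lborel_affine:
  fixes f :: "'a::euclidean_space \<Rightarrow> ennreal"
  assumes [measurable]: "f \<in> borel_measurable borel" and c: "c \<noteq> 0"
  shows "(\<integral>\<^sup>+y. f y \<partial>lborel) = ennreal (\<bar>c\<bar> ^ DIM('a)) * (\<integral>\<^sup>+y. f (a + c *\<^sub>R y) \<partial>lborel)"
  by (subst lborel_affine[OF c, of a])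
     (simp add: nn_integral_density nn_integral_distr nn_integral_cmult)

text \<open>Countable subadditivity with the sum written as an integral over a counting measure. The
  mass of the disjoint Vitali balls is summed in the same form, so the two sides can be compared
  termwise.\<close>

lemma emeasure_UN_countable_le:
  assumes "countable I" "\<And>i. i \<in> I \<Longrightarrow> X i \<in> sets M"
  shows "emeasure M (\<Union>i\<in>I. X i) \<le> (\<integral>\<^sup>+i. emeasure M (X i) \<partial>count_space I)"
proof -
  have "(\<Union>i\<in>I. X i) \<in> sets M" using assms by auto
  then have "emeasure M (\<Union>i\<in>I. X i) = (\<integral>\<^sup>+x. indicator (\<Union>i\<in>I. X i) x \<partial>M)" by simp
  also have "\<dots> \<le> (\<integral>\<^sup>+x. \<integral>\<^sup>+i. indicator (X i) x \<partial>count_space I \<partial>M)"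
  proof (rule nn_integral_mono)
    fix x
    show "indicator (\<Union>i\<in>I. X i) x \<le> (\<integral>\<^sup>+i. indicator (X i) x \<partial>count_space I)"
    proof (cases "x \<in> (\<Union>i\<in>I. X i)")
      case True
      then obtain i where "i \<in> I" "x \<in> X i" by auto
      then show ?thesis using nn_integral_ge_point[of i I "\<lambda>i. indicator (X i) x"] True by simp
    qed simp
  qed
  also have "\<dots> = (\<integral>\<^sup>+i. \<integral>\<^sup>+x. indicator (X i) x \<partial>M \<partial>count_space I)"
    by (rule nn_integral_count_space_nn_integral) (use assms in auto)
  also have "\<dots> = (\<integral>\<^sup>+i. emeasure M (X i) \<partial>count_space I)"
    by (rule nn_integral_cong) (use assms in auto)
  finally show ?thesis .
qed

text \<open>The average over a ball is normalised by \<open>r ^ DIM('a)\<close> instead of the volume.\<close>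

definition maximal_fun :: "('a::euclidean_space \<Rightarrow> ennreal) \<Rightarrow> 'a \<Rightarrow> ennreal" where
  "maximal_fun f x = (SUP r\<in>{0<..}. ennreal (1 / r ^ DIM('a)) * (\<integral>\<^sup>+y. f y * indicator (ball x r) y \<partial>lborel))"

lemma maximal_fun_upper:
  fixes x :: "'a::euclidean_space"
  assumes "r > 0"
  shows "(\<integral>\<^sup>+y. f y * indicator (ball x r) y \<partial>lborel) \<le> ennreal (r ^ DIM('a)) * maximal_fun f x"
proof -
  let ?I = "(\<integral>\<^sup>+y. f y * indicator (ball x r) y \<partial>lborel)"
  have "?I = ennreal (r ^ DIM('a)) * (ennreal (1 / r ^ DIM('a)) * ?I)"
    using assms by (simp add: mult.assoc[symmetric] ennreal_mult'[symmetric])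
  also have "\<dots> \<le> ennreal (r ^ DIM('a)) * maximal_fun f x"
    unfolding maximal_fun_def using assms by (intro mult_left_mono SUP_upper) auto
  finally show ?thesis .
qed

text \<open>Lower semicontinuity: by monotone convergence the integral over a witnessing ball can be
  replaced by that over a slightly smaller concentric ball, and the latter lies in the balls of the
  original radius about all nearby centres. Measurability of the maximal function rests on
  this.\<close>

lemma open_maximal_fun:
  fixes f :: "'a::euclidean_space \<Rightarrow> ennreal"
  assumes [measurable]: "f \<in> borel_measurable borel"
  shows "open {x. c < maximal_fun f x}"
proof (rule openI)
  fix x assume "x \<in> {x. c < maximal_fun f x}"
  then obtain r where r: "r > 0" and c: "c < ennreal (1 / r ^ DIM('a)) * (\<integral>\<^sup>+y. f y * indicator (ball x r) y \<partial>lborel)"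
    by (auto simp: maximal_fun_def less_SUP_iff)
  let ?s = "\<lambda>k::nat. r * (1 - 1 / (real k + 1))"
  have s: "incseq ?s" using r by (intro incseq_SucI mult_left_mono) (auto simp: field_simps)
  have SUP: "(SUP k. indicator (ball x (?s k)) y :: ennreal) = indicator (ball x r) y" for y
  proof (rule antisym)
    show "(SUP k. indicator (ball x (?s k)) y :: ennreal) \<le> indicator (ball x r) y"
    proof (rule SUP_least)
      fix k
      have "?s k \<le> r" using r by (simp add: field_simps)
      then show "indicator (ball x (?s k)) y \<le> (indicator (ball x r) y :: ennreal)"
        by (auto simp: indicator_def)
    qed
    show "indicator (ball x r) y \<le> (SUP k. indicator (ball x (?s k)) y :: ennreal)"
    proof (cases "y \<in> ball x r")
      case True
      have "?s \<longlonglongrightarrow> r * (1 - 0)"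
        by (intro tendsto_intros) (use LIMSEQ_inverse_real_of_nat in \<open>simp add: inverse_eq_divide add.commute\<close>)
      then have "\<forall>\<^sub>F k in sequentially. dist x y < ?s k"
        using True by (intro order_tendstoD) auto
      then obtain k where "y \<in> ball x (?s k)" by (auto simp: eventually_sequentially)
      then show ?thesis using True by (intro SUP_upper2[of k]) auto
    qed simp
  qed
  have "(\<integral>\<^sup>+y. f y * indicator (ball x r) y \<partial>lborel) = (\<integral>\<^sup>+y. (SUP k. f y * indicator (ball x (?s k)) y) \<partial>lborel)"
    by (simp only: SUP[symmetric] SUP_mult_left_ennreal)
  also have "\<dots> = (SUP k. \<integral>\<^sup>+y. f y * indicator (ball x (?s k)) y \<partial>lborel)"
  proof (rule nn_integral_monotone_convergence_SUP)
    show "incseq (\<lambda>k y. f y * indicator (ball x (?s k)) y)"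
      using incseqD[OF s] by (auto simp: incseq_def le_fun_def indicator_def intro!: mult_left_mono) force
  qed measurable
  finally obtain k where k: "c < ennreal (1 / r ^ DIM('a)) * (\<integral>\<^sup>+y. f y * indicator (ball x (?s k)) y \<partial>lborel)"
    using c by (auto simp: SUP_mult_left_ennreal less_SUP_iff)
  have lt: "?s k < r" using r by (simp add: field_simps)
  show "\<exists>e>0. ball x e \<subseteq> {x. c < maximal_fun f x}"
  proof (intro exI conjI subsetI)
    show "r - ?s k > 0" using lt by simp
    fix z assume z: "z \<in> ball x (r - ?s k)"
    have sub: "ball x (?s k) \<subseteq> ball z r"
    proof
      fix y assume "y \<in> ball x (?s k)"
      then show "y \<in> ball z r" using z dist_triangle[of z y x] by (simp add: dist_commute)
    qed
    have "c < ennreal (1 / r ^ DIM('a)) * (\<integral>\<^sup>+y. f y * indicator (ball x (?s k)) y \<partial>lborel)" by fact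
    also have "\<dots> \<le> ennreal (1 / r ^ DIM('a)) * (\<integral>\<^sup>+y. f y * indicator (ball z r) y \<partial>lborel)"
      using sub by (intro mult_left_mono nn_integral_mono) (auto simp: indicator_def)
    also have "\<dots> \<le> maximal_fun f z"
      unfolding maximal_fun_def using r by (intro SUP_upper) auto
    finally show "z \<in> {x. c < maximal_fun f x}" by simp
  qed
qed

lemma borel_measurable_maximal_fun [measurable]:
  fixes f :: "'a::euclidean_space \<Rightarrow> ennreal"
  assumes "f \<in> borel_measurable borel"
  shows "maximal_fun f \<in> borel_measurable borel"
  by (rule borel_measurableI_greater) (use open_maximal_fun[OF assms] in simp)

text \<open>Each point of the level set is the centre of a ball of radius \<open>r\<close> with mass
  above \<open>l * r ^ DIM('a)\<close>. The Vitali lemma selects disjoint balls whose fivefold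
  enlargements cover the level set, hence the factor \<open>5 ^ DIM('a)\<close>; disjointness bounds
  the total mass by the integral of \<open>f\<close>.\<close>

lemma maximal_fun_weak_type:
  fixes f :: "'a::euclidean_space \<Rightarrow> ennreal"
  assumes [measurable]: "f \<in> borel_measurable borel" and l: "l > 0"
  shows "emeasure lborel {x. ennreal l < maximal_fun f x}
    \<le> ennreal (unit_ball_vol DIM('a) * 5 ^ DIM('a) / l) * (\<integral>\<^sup>+y. f y \<partial>lborel)"
proof (cases "(\<integral>\<^sup>+y. f y \<partial>lborel) = top")
  case True
  moreover have "unit_ball_vol DIM('a) * 5 ^ DIM('a) / l > 0" using l by simp
  then have "ennreal (unit_ball_vol DIM('a) * 5 ^ DIM('a) / l) * top = top"
    by (metis ennreal_mult_eq_top_iff ennreal_eq_0_iff not_le)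
  ultimately show ?thesis by simp
next
  case False
  then obtain I where I: "I \<ge> 0" "(\<integral>\<^sup>+y. f y \<partial>lborel) = ennreal I"
    by (cases "(\<integral>\<^sup>+y. f y \<partial>lborel)") auto
  let ?n = "DIM('a)"
  let ?w = "unit_ball_vol ?n"
  let ?J = "\<lambda>i. (\<integral>\<^sup>+y. f y * indicator (ball (fst i) (snd i)) y \<partial>lborel)"
  define K where "K = {i :: 'a \<times> real. snd i > 0 \<and> ennreal l < ennreal (1 / snd i ^ ?n) * ?J i}"
  have KJ: "ennreal (l * r ^ ?n) \<le> ?J i" if "i \<in> K" "r = snd i" for i r
  proof -
    have r: "r > 0" and "ennreal l < ennreal (1 / r ^ ?n) * ?J i" using that by (auto simp: K_def)
    then have "ennreal (r ^ ?n) * ennreal l \<le> ennreal (r ^ ?n) * (ennreal (1 / r ^ ?n) * ?J i)"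
      by (intro mult_left_mono) auto
    also have "\<dots> = ?J i"
      using r by (simp add: mult.assoc[symmetric] ennreal_mult'[symmetric])
    finally show ?thesis using r l by (simp add: ennreal_mult'[symmetric] mult.commute)
  qed
  \<comment> \<open>The Vitali lemma asks for bounded radii. A ball in \<open>K\<close> satisfies
    \<open>l * r ^ ?n \<le> I\<close>, so \<open>I / l\<close> bounds \<open>r\<close> when
    \<open>r > 1\<close>; the \<open>1\<close> covers the small radii.\<close>
  define B where "B = max 1 (I / l)"
  have bound: "0 < snd i \<and> snd i \<le> B" if "i \<in> K" for i
  proof -
    have "snd i > 0" using that by (simp add: K_def)
    have "ennreal (l * snd i ^ ?n) \<le> ?J i" using KJ that by simp
    also have "\<dots> \<le> ennreal I" unfolding I(2)[symmetric] by (intro nn_integral_mono) (auto simp: indicator_def)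
    finally have "snd i ^ ?n \<le> I / l" using I l by (simp add: field_simps)
    moreover have "snd i \<le> 1 \<or> snd i \<le> snd i ^ ?n"
      using self_le_power[of "snd i" ?n] by force
    ultimately show ?thesis using \<open>snd i > 0\<close> by (auto simp: B_def le_max_iff_disj)
  qed
  let ?S = "{x. ennreal l < maximal_fun f x}"
  have "?S \<subseteq> (\<Union>i\<in>K. ball (fst i) (snd i))"
    by (force simp: K_def maximal_fun_def less_SUP_iff)
  then obtain C where C: "countable C" "C \<subseteq> K"
     "pairwise (\<lambda>i j. disjnt (ball (fst i) (snd i)) (ball (fst j) (snd j))) C"
     "?S \<subseteq> (\<Union>i\<in>C. ball (fst i) (5 * snd i))"
    by (rule Vitali_covering_lemma_balls[OF _ bound])
  have "emeasure lborel ?S \<le> emeasure lborel (\<Union>i\<in>C. ball (fst i) (5 * snd i))"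
    using C by (intro emeasure_mono) (auto intro!: open_UN)
  also have "\<dots> \<le> (\<integral>\<^sup>+i. emeasure lborel (ball (fst i) (5 * snd i)) \<partial>count_space C)"
    by (rule emeasure_UN_countable_le) (use C in auto)
  also have "\<dots> \<le> (\<integral>\<^sup>+i. ennreal (?w * 5 ^ ?n / l) * ?J i \<partial>count_space C)"
  proof (rule nn_integral_mono)
    fix i assume "i \<in> space (count_space C)"
    then have i: "i \<in> K" using C by auto
    have "emeasure lborel (ball (fst i) (5 * snd i)) = ennreal (?w * (5 * snd i) ^ ?n)"
      using bound[OF i] by (intro emeasure_ball) auto
    also have "\<dots> = ennreal (?w * 5 ^ ?n / l) * ennreal (l * snd i ^ ?n)"
      using l bound[OF i] by (simp add: ennreal_mult'[symmetric] power_mult_distrib)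
    also have "\<dots> \<le> ennreal (?w * 5 ^ ?n / l) * ?J i"
      by (intro mult_left_mono KJ[OF i]) auto
    finally show "emeasure lborel (ball (fst i) (5 * snd i)) \<le> ennreal (?w * 5 ^ ?n / l) * ?J i" .
  qed
  also have "\<dots> = ennreal (?w * 5 ^ ?n / l) * (\<integral>\<^sup>+i. ?J i \<partial>count_space C)"
    by (rule nn_integral_cmult) simp
  also have "(\<integral>\<^sup>+i. ?J i \<partial>count_space C) = (\<integral>\<^sup>+i. emeasure (density lborel f) (ball (fst i) (snd i)) \<partial>count_space C)"
    by (intro nn_integral_cong) (simp add: emeasure_density)
  also have "\<dots> = emeasure (density lborel f) (\<Union>i\<in>C. ball (fst i) (snd i))"
    by (rule emeasure_UN_countable[symmetric])
       (use C in \<open>auto simp: disjoint_family_on_def pairwise_def disjnt_def\<close>)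
  also have "\<dots> \<le> emeasure (density lborel f) (space (density lborel f))"
    by (rule emeasure_space)
  also have "\<dots> = (\<integral>\<^sup>+y. f y \<partial>lborel)" by (simp add: emeasure_density)
  finally show ?thesis by (simp add: mult_left_mono)
qed

section \<open>From weak type to strong type\<close>

lemma maximal_fun_add_le:
  fixes f g :: "'a::euclidean_space \<Rightarrow> ennreal"
  assumes [measurable]: "f \<in> borel_measurable borel" "g \<in> borel_measurable borel"
  shows "maximal_fun (\<lambda>y. f y + g y) x \<le> maximal_fun f x + maximal_fun g x"
  unfolding maximal_fun_def
proof (rule SUP_least)
  fix r :: real assume r: "r \<in> {0<..}"
  let ?a = "ennreal (1 / r ^ DIM('a))"
  have "?a * (\<integral>\<^sup>+y. (f y + g y) * indicator (ball x r) y \<partial>lborel)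
    = ?a * (\<integral>\<^sup>+y. f y * indicator (ball x r) y \<partial>lborel) + ?a * (\<integral>\<^sup>+y. g y * indicator (ball x r) y \<partial>lborel)"
    by (simp add: distrib_right nn_integral_add distrib_left)
  also have "\<dots> \<le> (SUP r\<in>{0<..}. ennreal (1 / r ^ DIM('a)) * (\<integral>\<^sup>+y. f y * indicator (ball x r) y \<partial>lborel)) +
     (SUP r\<in>{0<..}. ennreal (1 / r ^ DIM('a)) * (\<integral>\<^sup>+y. g y * indicator (ball x r) y \<partial>lborel))"
    using r by (intro add_mono SUP_upper) auto
  finally show "?a * (\<integral>\<^sup>+y. (f y + g y) * indicator (ball x r) y \<partial>lborel) \<le> \<dots>" .
qed

lemma maximal_fun_mono:
  "(\<And>y. f y \<le> g y) \<Longrightarrow> maximal_fun f x \<le> maximal_fun g x"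
  unfolding maximal_fun_def by (intro SUP_mono') (auto intro!: mult_left_mono nn_integral_mono mult_right_mono)

lemma maximal_fun_const:
  fixes x :: "'a::euclidean_space"
  assumes "c \<ge> 0"
  shows "maximal_fun (\<lambda>_. ennreal c) x \<le> ennreal (unit_ball_vol DIM('a) * c)"
  unfolding maximal_fun_def
proof (rule SUP_least)
  fix r :: real assume r: "r \<in> {0<..}"
  then have "ennreal (1 / r ^ DIM('a)) * (\<integral>\<^sup>+y. ennreal c * indicator (ball x r) y \<partial>lborel)
     = ennreal (1 / r ^ DIM('a)) * (ennreal c * ennreal (unit_ball_vol DIM('a) * r ^ DIM('a)))"
    by (subst nn_integral_cmult) (auto simp: emeasure_ball)
  also have "\<dots> = ennreal (unit_ball_vol DIM('a) * c)"
    using r assms by (simp add: ennreal_mult'[symmetric] field_simps)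
  finally show "ennreal (1 / r ^ DIM('a)) * (\<integral>\<^sup>+y. ennreal c * indicator (ball x r) y \<partial>lborel)
    \<le> ennreal (unit_ball_vol DIM('a) * c)" by simp
qed

lemma nn_integral_powr_0:
  assumes a: "a > -1" and T: "T \<ge> 0"
  shows "(\<integral>\<^sup>+l. ennreal (l powr a) * indicator {0<..<T} l \<partial>lborel) = ennreal (T powr (a + 1) / (a + 1))"
proof -
  have "((\<lambda>l. if l \<in> {0..T} then l powr a else 0) has_integral T powr (a + 1) / (a + 1)) UNIV"
    using has_integral_powr_from_0[OF a T] by (simp only: has_integral_restrict_UNIV)
  then have "(\<integral>\<^sup>+l. ennreal (if l \<in> {0..T} then l powr a else 0) \<partial>lborel) = ennreal (T powr (a + 1) / (a + 1))"
    by (intro nn_integral_has_integral_lborel) auto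
  moreover have "(\<integral>\<^sup>+l. ennreal (l powr a) * indicator {0<..<T} l \<partial>lborel)
    = (\<integral>\<^sup>+l. ennreal (if l \<in> {0..T} then l powr a else 0) \<partial>lborel)"
  proof (rule nn_integral_cong_AE)
    have "AE l in lborel. l \<noteq> T" by (rule AE_lborel_singleton)
    then show "AE l in lborel. ennreal (l powr a) * indicator {0<..<T} l = ennreal (if l \<in> {0..T} then l powr a else 0)"
      by eventually_elim (auto simp: indicator_def)
  qed
  ultimately show ?thesis by simp
qed

text \<open>By the choice of \<open>c\<close>, the part of \<open>g\<close> below height
  \<open>c * l\<close> has maximal function at most \<open>l / 2\<close>, so only the part above
  that height can push \<open>maximal_fun g\<close> beyond \<open>l\<close>. The weak type bound is
  applied to that part at level \<open>l / 2\<close>.\<close>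

lemma maximal_fun_level:
  fixes g :: "'a::euclidean_space \<Rightarrow> real"
  assumes [measurable]: "g \<in> borel_measurable borel" and l: "l > 0" and g: "\<And>x. 0 \<le> g x"
  defines "c \<equiv> 1 / (2 * unit_ball_vol DIM('a))"
  shows "emeasure lborel {x. ennreal l < maximal_fun g x}
    \<le> ennreal (2 * unit_ball_vol DIM('a) * 5 ^ DIM('a) / l) * (\<integral>\<^sup>+y. ennreal (g y) * indicator {c * l<..} (g y) \<partial>lborel)"
proof -
  let ?w = "unit_ball_vol DIM('a)"
  let ?h = "\<lambda>y. ennreal (g y) * indicator {c * l<..} (g y)"
  have w: "?w > 0" by simp
  have c: "c > 0" unfolding c_def using w by (intro divide_pos_pos) auto
  have "maximal_fun g x \<le> maximal_fun ?h x + ennreal (l / 2)" for x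
  proof -
    have "maximal_fun g x \<le> maximal_fun (\<lambda>y. ?h y + ennreal (c * l)) x"
      by (rule maximal_fun_mono) (auto simp: indicator_def ennreal_leI)
    also have "\<dots> \<le> maximal_fun ?h x + maximal_fun (\<lambda>_. ennreal (c * l)) x"
      by (rule maximal_fun_add_le) auto
    also have "maximal_fun (\<lambda>_. ennreal (c * l)) x \<le> ennreal (?w * (c * l))"
      by (rule maximal_fun_const) (use c l in auto)
    also have "?w * (c * l) = l / 2" by (simp add: c_def less_imp_neq[OF w, symmetric])
    finally show ?thesis by (simp add: add_left_mono)
  qed
  then have "ennreal (l / 2) < maximal_fun ?h x" if "ennreal l < maximal_fun g x" for x
  proof (rule_tac ccontr)
    assume *: "\<not> ennreal (l / 2) < maximal_fun ?h x" "\<And>x. maximal_fun g x \<le> maximal_fun ?h x + ennreal (l / 2)"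
    then have "maximal_fun g x \<le> ennreal (l / 2) + ennreal (l / 2)"
      by (meson add_right_mono not_le order_trans)
    also have "\<dots> = ennreal l" using l by (simp add: ennreal_plus[symmetric] del: ennreal_plus)
    finally show False using that by simp
  qed
  then have "emeasure lborel {x. ennreal l < maximal_fun g x} \<le> emeasure lborel {x. ennreal (l / 2) < maximal_fun ?h x}"
    by (intro emeasure_mono) (auto intro!: borel_open open_maximal_fun)
  also have "\<dots> \<le> ennreal (?w * 5 ^ DIM('a) / (l / 2)) * (\<integral>\<^sup>+y. ?h y \<partial>lborel)"
    by (rule maximal_fun_weak_type) (use l in auto)
  also have "?w * 5 ^ DIM('a) / (l / 2) = 2 * ?w * 5 ^ DIM('a) / l" by simp
  finally show ?thesis .
qed

text \<open>The level estimate is integrated against \<open>l powr (q - 1)\<close>. After exchanging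
  the integrals there remains, for fixed \<open>y\<close>, the integral of
  \<open>l powr (q - 2)\<close> over \<open>0 < l < g y / c\<close>, which converges at 0 because
  \<open>q > 1\<close>.\<close>

lemma maximal_fun_strong_type:
  fixes q :: real
  assumes q: "q > 1"
  obtains C where "C > 0" "\<And>g :: 'a::euclidean_space \<Rightarrow> real.
      g \<in> borel_measurable borel \<Longrightarrow> (\<And>x. 0 \<le> g x) \<Longrightarrow> (\<integral>\<^sup>+x. ennreal (g x powr q) \<partial>lborel) < top \<Longrightarrow>
      (AE x in lborel. maximal_fun g x < top) \<and>
      (\<integral>\<^sup>+x. ennreal (enn2real (maximal_fun g x) powr q) \<partial>lborel) \<le> ennreal C * (\<integral>\<^sup>+x. ennreal (g x powr q) \<partial>lborel)"
proof -
  let ?w = "unit_ball_vol (real DIM('a))"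
  define c where "c = 1 / (2 * ?w)"
  define A where "A = 2 * ?w * 5 ^ DIM('a)"
  have w: "?w > 0" by simp
  have c: "c > 0" unfolding c_def using w by (intro divide_pos_pos) auto
  have A: "A > 0" unfolding A_def using w by simp
  define D where "D = A * (1 / c) powr (q - 1) / (q - 1)"
  have D: "D > 0" unfolding D_def using A c q by simp
  have main: "(AE x in lborel. maximal_fun g x < top) \<and>
      (\<integral>\<^sup>+x. ennreal (enn2real (maximal_fun g x) powr q) \<partial>lborel) \<le> ennreal (q * D) * (\<integral>\<^sup>+x. ennreal (g x powr q) \<partial>lborel)"
    if [measurable]: "g \<in> borel_measurable borel" and g: "\<And>x. 0 \<le> g x"
      and fin: "(\<integral>\<^sup>+x. ennreal (g x powr q) \<partial>lborel) < top" for g :: "'a \<Rightarrow> real"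
  proof -
    let ?M = "maximal_fun (\<lambda>x. ennreal (g x))"
    \<comment> \<open>The layer-cake integral: it equals \<open>?M x powr q / q\<close> where
      \<open>?M x\<close> is finite, and is infinite where \<open>?M x\<close> is. Only lower bounds
      for it are needed.\<close>
    define LC where "LC x = (\<integral>\<^sup>+l. ennreal (l powr (q - 1)) * indicator {l. 0 < l \<and> ennreal l < ?M x} l \<partial>lborel)" for x
    have M[measurable]: "?M \<in> borel_measurable borel" by measurable
    have LC_meas[measurable]: "LC \<in> borel_measurable borel"
    proof -
      have "(\<lambda>p. ennreal (snd p powr (q - 1)) * indicator {l. 0 < l \<and> ennreal l < ?M (fst p)} (snd p)) \<in> borel_measurable (borel \<Otimes>\<^sub>M lborel)"
        unfolding indicator_def by measurable
      then show ?thesis unfolding LC_def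
        by (intro lborel.borel_measurable_nn_integral) (simp add: split_beta')
    qed
    have "(\<integral>\<^sup>+x. LC x \<partial>lborel) = (\<integral>\<^sup>+l. \<integral>\<^sup>+x. ennreal (l powr (q - 1)) * indicator {l. 0 < l \<and> ennreal l < ?M x} l \<partial>lborel \<partial>lborel)"
      unfolding LC_def
      by (rule lborel_pair.Fubini') (unfold split_beta' indicator_def greaterThan_iff, measurable)
    also have "\<dots> \<le> (\<integral>\<^sup>+l. \<integral>\<^sup>+y. ennreal (A * l powr (q - 2)) * indicator {0<..} l * (ennreal (g y) * indicator {c * l<..} (g y)) \<partial>lborel \<partial>lborel)"
    proof (rule nn_integral_mono)
      fix l :: real
      show "(\<integral>\<^sup>+x. ennreal (l powr (q - 1)) * indicator {l. 0 < l \<and> ennreal l < ?M x} l \<partial>lborel)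
        \<le> (\<integral>\<^sup>+y. ennreal (A * l powr (q - 2)) * indicator {0<..} l * (ennreal (g y) * indicator {c * l<..} (g y)) \<partial>lborel)"
      proof (cases "l > 0")
        case True
        have "(\<integral>\<^sup>+x. ennreal (l powr (q - 1)) * indicator {l. 0 < l \<and> ennreal l < ?M x} l \<partial>lborel)
          = (\<integral>\<^sup>+x. ennreal (l powr (q - 1)) * indicator {x. ennreal l < ?M x} x \<partial>lborel)"
          using True by (intro nn_integral_cong) (auto simp: indicator_def)
        also have "\<dots> = ennreal (l powr (q - 1)) * emeasure lborel {x. ennreal l < ?M x}"
          by (rule nn_integral_cmult_indicator) (auto intro!: borel_open open_maximal_fun)
        also have "\<dots> \<le> ennreal (l powr (q - 1)) * (ennreal (A / l) * (\<integral>\<^sup>+y. ennreal (g y) * indicator {c * l<..} (g y) \<partial>lborel))"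
          unfolding A_def c_def by (intro mult_left_mono maximal_fun_level True g) auto
        also have "\<dots> = ennreal (l powr (q - 1) * (A / l)) * (\<integral>\<^sup>+y. ennreal (g y) * indicator {c * l<..} (g y) \<partial>lborel)"
          using True A by (simp add: ennreal_mult'[symmetric] mult.assoc[symmetric])
        also have "l powr (q - 1) * (A / l) = A * l powr (q - 2)"
          using True by (simp add: powr_diff field_simps power2_eq_square)
        finally show ?thesis using True by (simp add: nn_integral_cmult)
      qed (simp add: indicator_def)
    qed
    also have "\<dots> = (\<integral>\<^sup>+y. \<integral>\<^sup>+l. ennreal (A * l powr (q - 2)) * indicator {0<..} l * (ennreal (g y) * indicator {c * l<..} (g y)) \<partial>lborel \<partial>lborel)"
      by (rule lborel_pair.Fubini'[symmetric]) (unfold split_beta' indicator_def greaterThan_iff, measurable)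
    also have "\<dots> = (\<integral>\<^sup>+y. ennreal D * ennreal (g y powr q) \<partial>lborel)"
    proof (rule nn_integral_cong)
      fix y
      have "(\<integral>\<^sup>+l. ennreal (A * l powr (q - 2)) * indicator {0<..} l * (ennreal (g y) * indicator {c * l<..} (g y)) \<partial>lborel)
        = (\<integral>\<^sup>+l. ennreal (A * g y) * (ennreal (l powr (q - 2)) * indicator {0<..<g y / c} l) \<partial>lborel)"
        using A g[of y] c
        by (intro nn_integral_cong) (auto simp: indicator_def ennreal_mult mult_ac field_simps)
      also have "\<dots> = ennreal (A * g y) * ennreal ((g y / c) powr (q - 2 + 1) / (q - 2 + 1))"
        using q c g[of y] by (subst nn_integral_cmult) (auto simp: nn_integral_powr_0)
      also have "\<dots> = ennreal (D * g y powr q)"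
      proof -
        have "A * g y * ((g y / c) powr (q - 2 + 1) / (q - 2 + 1)) = D * (g y * g y powr (q - 1))"
          using c g[of y] unfolding D_def by (simp add: powr_divide field_simps)
        also have "g y * g y powr (q - 1) = g y powr q"
          using g[of y] by (cases "g y = 0") (auto simp: powr_diff)
        finally show ?thesis using A g[of y] q by (subst ennreal_mult[symmetric]) auto
      qed
      finally show "(\<integral>\<^sup>+l. ennreal (A * l powr (q - 2)) * indicator {0<..} l * (ennreal (g y) * indicator {c * l<..} (g y)) \<partial>lborel)
        = ennreal D * ennreal (g y powr q)" using D by (simp add: ennreal_mult)
    qed
    also have "\<dots> = ennreal D * (\<integral>\<^sup>+y. ennreal (g y powr q) \<partial>lborel)"
      by (rule nn_integral_cmult) measurable
    finally have LC_le: "(\<integral>\<^sup>+x. LC x \<partial>lborel) \<le> ennreal D * (\<integral>\<^sup>+y. ennreal (g y powr q) \<partial>lborel)" .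
    have LC_ge: "ennreal (T powr q / q) \<le> LC x" if "T \<ge> 0" "ennreal T \<le> ?M x" for T x
    proof -
      have "ennreal (T powr q / q) = (\<integral>\<^sup>+l. ennreal (l powr (q - 1)) * indicator {0<..<T} l \<partial>lborel)"
        using nn_integral_powr_0[of "q - 1" T] q that by simp
      also have "\<dots> \<le> LC x" unfolding LC_def
      proof (intro nn_integral_mono mult_left_mono)
        fix l
        have "ennreal l < ?M x" if "0 < l" "l < T"
          using that \<open>ennreal T \<le> ?M x\<close> by (meson ennreal_lessI less_le_trans order.strict_trans)
        then show "indicator {0<..<T} l \<le> (indicator {l. 0 < l \<and> ennreal l < ?M x} l :: ennreal)"
          by (auto simp: indicator_def)
      qed simp
      finally show ?thesis .
    qed
    have "(\<integral>\<^sup>+x. LC x \<partial>lborel) < top"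
      by (rule le_less_trans[OF LC_le]) (use fin in \<open>simp add: ennreal_mult_less_top\<close>)
    then have "AE x in lborel. LC x \<noteq> top"
      using nn_integral_PInf_AE[of LC lborel] by (auto simp: infinity_ennreal_def)
    then have fin_AE: "AE x in lborel. ?M x < top"
    proof eventually_elim
      case (elim x)
      show ?case
      proof (rule ccontr)
        assume "\<not> ?M x < top"
        then have top: "?M x = top" using top.not_eq_extremum by blast
        obtain L where L: "L \<ge> 0" "LC x = ennreal L" using elim by (cases "LC x") auto
        \<comment> \<open>Where \<open>?M x\<close> is infinite every height is admissible; this one
          makes the lower bound \<open>L + 1\<close>.\<close>
        have "ennreal (((q * (L + 1)) powr (1 / q)) powr q / q) \<le> ennreal L"
          unfolding L(2)[symmetric] by (rule LC_ge) (auto simp: top)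
        then show False using L(1) q by (simp add: powr_powr)
      qed
    qed
    have "(\<integral>\<^sup>+x. ennreal (enn2real (?M x) powr q) \<partial>lborel) \<le> (\<integral>\<^sup>+x. ennreal q * LC x \<partial>lborel)"
    proof (rule nn_integral_mono_AE)
      show "AE x in lborel. ennreal (enn2real (?M x) powr q) \<le> ennreal q * LC x"
        using fin_AE
      proof eventually_elim
        case (elim x)
        have "ennreal q * ennreal (enn2real (?M x) powr q / q) \<le> ennreal q * LC x"
          by (intro mult_left_mono LC_ge) (use elim in \<open>auto simp: less_top\<close>)
        then show ?case using q by (simp add: ennreal_mult'[symmetric])
      qed
    qed
    also have "\<dots> = ennreal q * (\<integral>\<^sup>+x. LC x \<partial>lborel)" by (rule nn_integral_cmult) measurable
    also have "\<dots> \<le> ennreal q * (ennreal D * (\<integral>\<^sup>+y. ennreal (g y powr q) \<partial>lborel))"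
      by (intro mult_left_mono LC_le) simp
    also have "\<dots> = ennreal (q * D) * (\<integral>\<^sup>+y. ennreal (g y powr q) \<partial>lborel)"
      using q D by (simp add: ennreal_mult mult.assoc)
    finally show ?thesis using fin_AE by blast
  qed
  show thesis
    by (rule that[of "q * D"]) (use q D main in auto)
qed

section \<open>Riesz potentials and weights\<close>

lemma powr_nonpos_le_1: "1 \<le> x \<Longrightarrow> a \<le> 0 \<Longrightarrow> x powr a \<le> (1::real)"
  using powr_mono2'[of a 1 x] by simp

lemma ennreal_le_suminf: "f k \<le> (\<Sum>k. f k :: ennreal)"
  using sum_le_suminf[of f "{k}"] by simp

text \<open>Decays like the power \<open>- n - 2\<close> of the norm, \<open>n\<close> being the
  dimension: the two powers beyond the critical one make dyadic sums converge. The square of the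
  norm keeps it smooth, and it has the shape of \<open>delta 1\<close> below.\<close>

definition weight :: "'a::euclidean_space \<Rightarrow> real" where
  "weight y = (1 + (norm y)\<^sup>2) powr (- (real DIM('a) / 2 + 1))"

lemma weight_pos: "weight y > 0"
proof -
  have "1 + (norm y)\<^sup>2 > 0" by (simp add: add_pos_nonneg)
  then show ?thesis unfolding weight_def by simp
qed

lemma weight_le_1: "weight y \<le> 1"
  unfolding weight_def by (rule powr_nonpos_le_1) auto

lemma borel_measurable_weight [measurable]: "weight \<in> borel_measurable borel"
  unfolding weight_def[abs_def] by measurable

text \<open>With \<open>k\<close> the least index such that \<open>norm y < 2 ^ k\<close>, a
  positive \<open>k\<close> puts \<open>y\<close> outside the ball of radius
  \<open>2 ^ (k - 1)\<close>, where the weight is at most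
  \<open>(1 / 2 ^ (n + 2)) ^ (k - 1)\<close>. The prefactor accounts for this shift of the index and
  also covers \<open>k = 0\<close>.\<close>

lemma weight_le_suminf:
  fixes y :: "'a::euclidean_space"
  shows "ennreal (weight y) \<le> (\<Sum>k. ennreal (2 ^ (DIM('a) + 2) * (1 / 2 ^ (DIM('a) + 2)) ^ k) * indicator (ball 0 (2 ^ k)) y)"
proof -
  let ?n = "DIM('a)"
  let ?f = "\<lambda>k. ennreal (2 ^ (?n + 2) * (1 / 2 ^ (?n + 2)) ^ k) * indicator (ball 0 (2 ^ k)) y"
  have ex: "\<exists>k::nat. norm y < 2 ^ k" by (rule real_arch_pow) simp
  define k where "k = (LEAST k::nat. norm y < 2 ^ k)"
  have k: "norm y < 2 ^ k" unfolding k_def using ex by (rule LeastI_ex)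
  have "weight y \<le> 2 ^ (?n + 2) * (1 / 2 ^ (?n + 2)) ^ k"
  proof (cases k)
    case 0
    have "(1::real) \<le> 2 ^ (?n + 2)" by (rule one_le_power) simp
    then show ?thesis using 0 order_trans[OF weight_le_1[of y]] by simp
  next
    case (Suc m)
    then have "\<not> norm y < 2 ^ m" using not_less_Least[of m "\<lambda>k. norm y < 2 ^ k"] by (simp add: k_def)
    then have "(2 ^ m)\<^sup>2 \<le> (norm y)\<^sup>2" by (intro power_mono) auto
    then have "4 ^ m \<le> 1 + (norm y)\<^sup>2" 
      by (simp add: power2_eq_square power_mult_distrib[symmetric])
    then have "weight y \<le> (4 ^ m) powr (- (real ?n / 2 + 1))"
      unfolding weight_def by (intro powr_mono2') auto
    also have "\<dots> = (1 / 2 ^ (?n + 2)) ^ m"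
    proof -
      have "(4 :: real) ^ m = (2 ^ m) powr 2"
        by (simp add: power2_eq_square power_mult_distrib[symmetric])
      moreover have "2 * (- (real ?n / 2 + 1)) = - real (?n + 2)" by simp
      ultimately have "(4 ^ m) powr (- (real ?n / 2 + 1)) = (2 ^ m) powr (- real (?n + 2))"
        by (simp only: powr_powr)
      also have "\<dots> = 1 / (2 ^ m) ^ (?n + 2)"
        by (simp only: powr_minus_divide powr_realpow zero_less_power zero_less_numeral)
      also have "\<dots> = (1 / 2 ^ (?n + 2)) ^ m"
        by (simp only: power_one_over power_mult[symmetric] mult.commute[of m])
      finally show ?thesis .
    qed
    also have "\<dots> = 2 ^ (?n + 2) * (1 / 2 ^ (?n + 2)) ^ k"
      unfolding Suc by simp
    finally show ?thesis .
  qed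
  then have "ennreal (weight y) \<le> ?f k"
    using k by (simp add: ennreal_leI)
  also have "\<dots> \<le> (\<Sum>k. ?f k)" by (rule ennreal_le_suminf)
  finally show ?thesis .
qed

lemma suminf_ennreal_geometric:
  assumes "0 \<le> c" "0 \<le> x" "x < 1"
  shows "(\<Sum>k. ennreal (c * x ^ k)) = ennreal (c / (1 - x))"
proof (rule sums_unique[symmetric], rule sums_ennreal[THEN iffD2])
  show "(\<lambda>k. c * x ^ k) sums (c / (1 - x))"
    using sums_mult[OF geometric_sums[of x], of c] assms by simp
qed (use assms in auto)

text \<open>The ball of radius \<open>2 ^ k\<close> contributes at most \<open>(2 ^ k) ^ n\<close>
  times the maximal function, against a coefficient of order \<open>(1 / 2 ^ (n + 2)) ^ k\<close>.
  The ratio \<open>1 / 4\<close> remains, and its geometric sum \<open>4 / 3\<close> times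
  \<open>2 ^ (n + 2)\<close> is rounded up to \<open>2 ^ n * 8\<close>. Negative \<open>s\<close> is
  the case that occurs in a convolution.\<close>

lemma nn_integral_weight_le_maximal_fun:
  fixes x :: "'a::euclidean_space"
  assumes [measurable]: "f \<in> borel_measurable borel" and s: "s \<noteq> 0"
  shows "(\<integral>\<^sup>+y. ennreal (weight y) * f (x + s *\<^sub>R y) \<partial>lborel) \<le> ennreal (2 ^ DIM('a) * 8) * maximal_fun f x"
proof -
  let ?n = "DIM('a)"
  have s': "\<bar>s\<bar> ^ ?n > 0" using s by simp
  have "(\<integral>\<^sup>+y. ennreal (weight y) * f (x + s *\<^sub>R y) \<partial>lborel)
    \<le> (\<integral>\<^sup>+y. (\<Sum>k. ennreal (2 ^ (?n + 2) * (1 / 2 ^ (?n + 2)) ^ k) * indicator (ball 0 (2 ^ k)) y) * f (x + s *\<^sub>R y) \<partial>lborel)"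
    by (intro nn_integral_mono mult_right_mono weight_le_suminf) auto
  also have "\<dots> = (\<integral>\<^sup>+y. (\<Sum>k. ennreal (2 ^ (?n + 2) * (1 / 2 ^ (?n + 2)) ^ k) * (f (x + s *\<^sub>R y) * indicator (ball 0 (2 ^ k)) y)) \<partial>lborel)"
    by (subst ennreal_suminf_multc[symmetric]) (simp add: mult_ac)
  also have "\<dots> = (\<Sum>k. \<integral>\<^sup>+y. ennreal (2 ^ (?n + 2) * (1 / 2 ^ (?n + 2)) ^ k) * (f (x + s *\<^sub>R y) * indicator (ball 0 (2 ^ k)) y) \<partial>lborel)"
    by (rule nn_integral_suminf) measurable
  also have "\<dots> = (\<Sum>k. ennreal (2 ^ (?n + 2) * (1 / 2 ^ (?n + 2)) ^ k) * (\<integral>\<^sup>+y. f (x + s *\<^sub>R y) * indicator (ball 0 (2 ^ k)) y \<partial>lborel))"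
    by (subst nn_integral_cmult) auto
  also have "\<dots> \<le> (\<Sum>k. ennreal (2 ^ (?n + 2) * (1 / 4) ^ k) * maximal_fun f x)"
  proof (intro suminf_le summableI)
    fix k
    have "ennreal (\<bar>s\<bar> ^ ?n) * (\<integral>\<^sup>+y. f (x + s *\<^sub>R y) * indicator (ball 0 (2 ^ k)) y \<partial>lborel)
      = ennreal (\<bar>s\<bar> ^ ?n) * (\<integral>\<^sup>+y. f (x + s *\<^sub>R y) * indicator (ball x (\<bar>s\<bar> * 2 ^ k)) (x + s *\<^sub>R y) \<partial>lborel)"
      using s by (intro arg_cong[where f = "\<lambda>z. _ * z"] nn_integral_cong) (auto simp: indicator_def dist_norm)
    also have "\<dots> = (\<integral>\<^sup>+y. f y * indicator (ball x (\<bar>s\<bar> * 2 ^ k)) y \<partial>lborel)"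
      by (rule nn_integral_lborel_affine[symmetric]) (use s in auto)
    also have "\<dots> \<le> ennreal ((\<bar>s\<bar> * 2 ^ k) ^ ?n) * maximal_fun f x"
      by (rule maximal_fun_upper) (use s in auto)
    also have "\<dots> = ennreal (\<bar>s\<bar> ^ ?n) * (ennreal ((2 ^ k) ^ ?n) * maximal_fun f x)"
      by (simp add: power_mult_distrib ennreal_mult mult.assoc)
    finally have le: "(\<integral>\<^sup>+y. f (x + s *\<^sub>R y) * indicator (ball 0 (2 ^ k)) y \<partial>lborel) \<le> ennreal ((2 ^ k) ^ ?n) * maximal_fun f x"
      using s' by (subst (asm) ennreal_mult_le_mult_iff) auto
    have "ennreal (2 ^ (?n + 2) * (1 / 2 ^ (?n + 2)) ^ k) * (\<integral>\<^sup>+y. f (x + s *\<^sub>R y) * indicator (ball 0 (2 ^ k)) y \<partial>lborel)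
      \<le> ennreal (2 ^ (?n + 2) * (1 / 2 ^ (?n + 2)) ^ k) * (ennreal ((2 ^ k) ^ ?n) * maximal_fun f x)"
      by (intro mult_left_mono le) auto
    also have "\<dots> = ennreal (2 ^ (?n + 2) * (1 / 2 ^ (?n + 2)) ^ k * (2 ^ k) ^ ?n) * maximal_fun f x"
      by (simp add: ennreal_mult mult.assoc)
    also have "(1 / 2 ^ (?n + 2)) ^ k * (2 ^ k) ^ ?n = (1 / 4 :: real) ^ k"
    proof -
      have "(1 / 2 ^ (?n + 2)) ^ k * (2 ^ k) ^ ?n = (1 / 2 ^ (?n + 2) * 2 ^ ?n :: real) ^ k"
        by (simp only: power_mult_distrib power_mult[symmetric] mult.commute[of k])
      also have "1 / 2 ^ (?n + 2) * 2 ^ ?n = (1 / 4 :: real)"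
        by simp
      finally show ?thesis by simp
    qed
    then have "2 ^ (?n + 2) * (1 / 2 ^ (?n + 2)) ^ k * (2 ^ k) ^ ?n = 2 ^ (?n + 2) * (1 / 4 :: real) ^ k"
      by simp
    finally show "ennreal (2 ^ (?n + 2) * (1 / 2 ^ (?n + 2)) ^ k) * (\<integral>\<^sup>+y. f (x + s *\<^sub>R y) * indicator (ball 0 (2 ^ k)) y \<partial>lborel)
      \<le> ennreal (2 ^ (?n + 2) * (1 / 4) ^ k) * maximal_fun f x" .
  qed
  also have "\<dots> = ennreal (2 ^ (?n + 2) / (1 - 1 / 4)) * maximal_fun f x"
    by (subst ennreal_suminf_multc, subst suminf_ennreal_geometric) (auto simp: one_less_power)
  also have "\<dots> \<le> ennreal (2 ^ ?n * 8) * maximal_fun f x"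
  proof (intro mult_right_mono ennreal_leI)
    show "2 ^ (?n + 2) / (1 - 1 / 4) \<le> 2 ^ ?n * (8::real)"
      by (simp add: field_simps)
  qed simp
  finally show ?thesis .
qed

lemma nn_integral_weight_le:
  "(\<integral>\<^sup>+y. ennreal (weight (y :: 'a::euclidean_space)) \<partial>lborel) \<le> ennreal (2 ^ DIM('a) * 8 * unit_ball_vol DIM('a))"
proof -
  have "(\<integral>\<^sup>+y. ennreal (weight (y :: 'a)) \<partial>lborel) \<le> ennreal (2 ^ DIM('a) * 8) * maximal_fun (\<lambda>_. ennreal 1) (0::'a)"
    using nn_integral_weight_le_maximal_fun[of "\<lambda>_. ennreal 1" 1 "0::'a"] by simp
  also have "\<dots> \<le> ennreal (2 ^ DIM('a) * 8) * ennreal (unit_ball_vol DIM('a) * 1)"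
    by (intro mult_left_mono maximal_fun_const) auto
  finally show ?thesis by (simp add: ennreal_mult)
qed

text \<open>On the dyadic shell inside radius \<open>(1 / 2) ^ m\<close> the power is at most
  \<open>2 powr s * (2 powr s) ^ m\<close>, while the volume is of order
  \<open>((1 / 2) ^ m) ^ n\<close>; the resulting geometric series has ratio
  \<open>2 powr (s - n) < 1\<close>.\<close>

lemma nn_integral_norm_powr_ball:
  fixes s :: real
  assumes s: "0 \<le> s" "s < DIM('a::euclidean_space)"
  shows "(\<integral>\<^sup>+y. ennreal (norm (y :: 'a) powr (- s)) * indicator (ball 0 1) y \<partial>lborel) < top"
proof -
  let ?n = "DIM('a)"
  let ?w = "unit_ball_vol ?n"
  have "(\<integral>\<^sup>+y. ennreal (norm (y :: 'a) powr (- s)) * indicator (ball 0 1) y \<partial>lborel)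
    \<le> (\<integral>\<^sup>+y. (\<Sum>j. ennreal (2 powr s * (2 powr s) ^ j) * indicator (ball (0::'a) ((1 / 2) ^ j)) y) \<partial>lborel)"
  proof (rule nn_integral_mono)
    fix y :: 'a
    let ?f = "\<lambda>j. ennreal (2 powr s * (2 powr s) ^ j) * indicator (ball (0::'a) ((1 / 2) ^ j)) y"
    show "ennreal (norm y powr (- s)) * indicator (ball 0 1) y \<le> (\<Sum>j. ?f j)"
    proof (cases "y \<noteq> 0 \<and> norm y < 1")
      case True
      then have ex: "\<exists>j. (1 / 2) ^ j \<le> norm y"
        using real_arch_pow_inv[of "norm y" "1/2"] by (auto intro: less_imp_le)
      define j where "j = (LEAST j. (1 / 2) ^ j \<le> norm y)"
      have j: "(1 / 2) ^ j \<le> norm y" unfolding j_def using ex by (rule LeastI_ex)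
      then have "j \<noteq> 0" using True by (intro notI) auto
      then obtain m where m: "j = Suc m" by (cases j) auto
      then have m': "norm y < (1 / 2) ^ m" using not_less_Least[of m "\<lambda>j. (1 / 2) ^ j \<le> norm y"] by (simp add: j_def)
      have "norm y powr (- s) \<le> ((1 / 2) ^ j) powr (- s)"
        using j s by (intro powr_mono2') auto
      also have "\<dots> = (2 powr s) ^ j"
        by (simp add: powr_minus power_one_over powr_divide powr_realpow[symmetric] powr_powr mult.commute)
      finally have "norm y powr (- s) \<le> 2 powr s * (2 powr s) ^ m" by (simp add: m)
      then have "ennreal (norm y powr (- s)) * indicator (ball 0 1) y \<le> ?f m"
        using m' True by (simp add: ennreal_leI)
      also have "\<dots> \<le> (\<Sum>j. ?f j)" by (rule ennreal_le_suminf)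
      finally show ?thesis .
    qed auto
  qed
  also have "\<dots> = (\<Sum>j. \<integral>\<^sup>+y. ennreal (2 powr s * (2 powr s) ^ j) * indicator (ball (0::'a) ((1 / 2) ^ j)) y \<partial>lborel)"
    by (rule nn_integral_suminf) measurable
  also have "\<dots> = (\<Sum>j. ennreal ((2 powr s * ?w) * (2 powr (s - ?n)) ^ j))"
  proof (rule suminf_cong)
    fix j
    have "(\<integral>\<^sup>+y. ennreal (2 powr s * (2 powr s) ^ j) * indicator (ball (0::'a) ((1 / 2) ^ j)) y \<partial>lborel)
      = ennreal (2 powr s * (2 powr s) ^ j) * ennreal (?w * ((1 / 2) ^ j) ^ ?n)"
      by (subst nn_integral_cmult_indicator) (auto simp: emeasure_ball)
    also have "\<dots> = ennreal ((2 powr s * ?w) * (2 powr s * (1 / 2) ^ ?n) ^ j)"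
      by (simp add: ennreal_mult[symmetric] power_mult_distrib power_mult[symmetric] mult_ac)
    also have "2 powr s * (1 / 2) ^ ?n = 2 powr (s - ?n)"
      by (simp add: powr_diff powr_realpow power_one_over)
    finally show "(\<integral>\<^sup>+y. ennreal (2 powr s * (2 powr s) ^ j) * indicator (ball (0::'a) ((1 / 2) ^ j)) y \<partial>lborel)
      = ennreal ((2 powr s * ?w) * (2 powr (s - ?n)) ^ j)" .
  qed
  also have "\<dots> < top"
    by (subst suminf_ennreal_geometric) (use s in \<open>auto simp: powr_less_one\<close>)
  finally show ?thesis .
qed

text \<open>Up to a constant, the kernel of the Riesz potential of order 1. Its value at 0 is 0 by
  the convention for \<open>powr\<close>.\<close>

definition riesz :: "'a::euclidean_space \<Rightarrow> real" where
  "riesz x = norm x powr (1 - real DIM('a))"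

lemma borel_measurable_riesz [measurable]: "riesz \<in> borel_measurable borel"
  unfolding riesz_def[abs_def] by measurable

lemma riesz_nonneg: "riesz x \<ge> 0"
  by (simp add: riesz_def)

lemma riesz_minus: "riesz (x - y) = riesz (y - x)"
  by (simp add: riesz_def norm_minus_commute)

text \<open>Near the singularity the weight is at most 1 and the power of the kernel is locally
  integrable by the condition on \<open>r\<close>; away from it that power is at most 1 and the
  weight is integrable. Translating the first part makes the bound uniform in
  \<open>y\<close>.\<close>

lemma nn_integral_riesz_weight:
  assumes r: "r \<ge> 0" "r * (real DIM('a::euclidean_space) - 1) < DIM('a)"
  obtains C where "C > 0" "\<And>y :: 'a. (\<integral>\<^sup>+z. ennreal (riesz (y - z) powr r * weight z) \<partial>lborel) \<le> ennreal C"
proof -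
  let ?n = "DIM('a)"
  define s where "s = r * (real ?n - 1)"
  have n: "real ?n \<ge> 1" by (simp add: Suc_leI)
  have s: "0 \<le> s" "s < ?n" using r n by (auto simp: s_def)
  let ?J = "(\<integral>\<^sup>+y. ennreal (norm (y :: 'a) powr (- s)) * indicator (ball 0 1) y \<partial>lborel)"
  have J: "?J < top" by (rule nn_integral_norm_powr_ball[OF s])
  define C where "C = enn2real ?J + 2 ^ ?n * 8 * unit_ball_vol ?n"
  have "C > 0" unfolding C_def by (simp add: add_nonneg_pos)
  have "(\<integral>\<^sup>+z. ennreal (riesz (y - z) powr r * weight z) \<partial>lborel) \<le> ennreal C" for y :: 'a
  proof -
    have "(\<integral>\<^sup>+z. ennreal (riesz (y - z) powr r * weight z) \<partial>lborel)
      \<le> (\<integral>\<^sup>+z. (ennreal (norm (y - z) powr (- s)) * indicator (ball 0 1) (y - z)) + ennreal (weight z) \<partial>lborel)"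
    proof (rule nn_integral_mono)
      fix z
      have eq: "riesz (y - z) powr r = norm (y - z) powr (- s)"
        by (simp add: riesz_def powr_powr s_def algebra_simps)
      show "ennreal (riesz (y - z) powr r * weight z) \<le> (ennreal (norm (y - z) powr (- s)) * indicator (ball 0 1) (y - z)) + ennreal (weight z)"
      proof (cases "y - z \<in> ball 0 1")
        case True
        have "riesz (y - z) powr r * weight z \<le> norm (y - z) powr (- s)"
          unfolding eq using weight_le_1[of z] weight_pos[of z] by (intro mult_left_le) auto
        then show ?thesis using True by (simp add: ennreal_leI add_increasing2)
      next
        case False
        then have "norm (y - z) powr (- s) \<le> 1" using s by (intro powr_nonpos_le_1) auto
        then have "riesz (y - z) powr r * weight z \<le> weight z"
          unfolding eq using weight_pos[of z] by (simp add: mult_left_le_one_le)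
        then show ?thesis using False by (simp add: ennreal_leI)
      qed
    qed
    also have "\<dots> = (\<integral>\<^sup>+z. ennreal (norm (y - z) powr (- s)) * indicator (ball 0 1) (y - z) \<partial>lborel) + (\<integral>\<^sup>+(z::'a). ennreal (weight z) \<partial>lborel)"
      by (rule nn_integral_add) measurable
    also have "(\<integral>\<^sup>+z. ennreal (norm (y - z) powr (- s)) * indicator (ball 0 1) (y - z) \<partial>lborel) = ?J"
      using nn_integral_lborel_affine[of "\<lambda>y::'a. ennreal (norm y powr (- s)) * indicator (ball 0 1) y" "-1" y] by simp
    also have "?J + (\<integral>\<^sup>+z. ennreal (weight (z::'a)) \<partial>lborel) \<le> ennreal (enn2real ?J) + ennreal (2 ^ ?n * 8 * unit_ball_vol ?n)"
      by (intro add_mono nn_integral_weight_le) (use J in auto)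
    also have "\<dots> = ennreal C" unfolding C_def by (simp add: ennreal_plus)
    finally show ?thesis .
  qed
  then show thesis using that \<open>C > 0\<close> by blast
qed

text \<open>Convexity of \<open>exp\<close> at the logarithms; if an argument is 0, the left side
  vanishes.\<close>

lemma weighted_arith_geo_mean3:
  fixes a b c :: real
  assumes "a \<ge> 0" "b \<ge> 0" "c \<ge> 0" "a + b + c = 1" "x \<ge> 0" "y \<ge> 0" "z \<ge> 0"
  shows "x powr a * y powr b * z powr c \<le> a * x + b * y + c * z"
proof (cases "x = 0 \<or> y = 0 \<or> z = 0")
  case True
  then show ?thesis using assms by (auto intro!: add_nonneg_nonneg mult_nonneg_nonneg)
next
  case False
  then have pos: "x > 0" "y > 0" "z > 0" using assms by auto
  have "exp (\<Sum>i\<in>{0,1,2::nat}. [a, b, c] ! i *\<^sub>R ([ln x, ln y, ln z] ! i))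
    \<le> (\<Sum>i\<in>{0,1,2::nat}. [a, b, c] ! i * exp ([ln x, ln y, ln z] ! i))"
    by (rule convex_on_sum[OF _ _ exp_convex]) (use assms in auto)
  then show ?thesis using pos by (simp add: powr_def exp_add mult.assoc)
qed

text \<open>The exponents leave room for Young's inequality \<open>1 / \<beta> + 1 / r + 1 / \<alpha> = 2\<close> with \<open>r > 1\<close>.\<close>

lemma riesz_bilinear_bound:
  fixes a b d r \<alpha> \<beta> :: real
  assumes nn: "a \<ge> 0" "b \<ge> 0" "d \<ge> 0" "r \<ge> 0" "\<alpha> > 0" "\<beta> > 0"
    and exps: "d + a + b = 1" "\<beta> * (d + a) = 1" "\<alpha> * (d + b) = 1" "r * (a + b) = 1"
    and r: "r * (real DIM('a::euclidean_space) - 1) < DIM('a)"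
  obtains C where "C > 0" "\<And>(v :: 'a \<Rightarrow> real) u F G.
    v \<in> borel_measurable borel \<Longrightarrow> u \<in> borel_measurable borel \<Longrightarrow> (\<And>y. 0 \<le> v y) \<Longrightarrow> (\<And>y. 0 \<le> u y) \<Longrightarrow>
    0 \<le> F \<Longrightarrow> 0 \<le> G \<Longrightarrow>
    (\<integral>\<^sup>+y. ennreal (weight y * v y powr \<beta>) \<partial>lborel) \<le> ennreal F \<Longrightarrow>
    (\<integral>\<^sup>+y. ennreal (weight y * u y powr \<alpha>) \<partial>lborel) \<le> ennreal G \<Longrightarrow>
    (\<integral>\<^sup>+y. \<integral>\<^sup>+z. ennreal (weight y * weight z * (v y * u z * riesz (y - z))) \<partial>lborel \<partial>lborel)
      \<le> ennreal (C * F powr (1 / \<beta>) * G powr (1 / \<alpha>))"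
proof -
  obtain K where K: "K > 0" "\<And>y :: 'a. (\<integral>\<^sup>+z. ennreal (riesz (y - z) powr r * weight z) \<partial>lborel) \<le> ennreal K"
    using nn_integral_riesz_weight[OF nn(4) r] by blast
  define C where "C = d + a * K + b * K + 1"
  have C: "C > 0" using nn K(1) by (simp add: C_def add_nonneg_pos)
  \<comment> \<open>The normalised case: the integrand is a weighted geometric mean of three
    products, pairing \<open>v\<close> with \<open>u\<close>, \<open>v\<close> with the kernel and
    \<open>u\<close> with the kernel. Each has a bounded weighted integral by Fubini.\<close>
  have unit: "(\<integral>\<^sup>+y. \<integral>\<^sup>+z. ennreal (weight y * weight z * (v y * u z * riesz (y - z))) \<partial>lborel \<partial>lborel) \<le> ennreal C"
    if [measurable]: "v \<in> borel_measurable borel" "u \<in> borel_measurable borel"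
      and v: "\<And>y. 0 \<le> v y" and u: "\<And>y. 0 \<le> u y"
      and F: "(\<integral>\<^sup>+y. ennreal (weight y * v y powr \<beta>) \<partial>lborel) \<le> 1"
      and G: "(\<integral>\<^sup>+y. ennreal (weight y * u y powr \<alpha>) \<partial>lborel) \<le> 1" for v u :: "'a \<Rightarrow> real"
  proof -
    let ?f = "\<lambda>y. weight y * v y powr \<beta>" and ?g = "\<lambda>z. weight z * u z powr \<alpha>"
    let ?k = "\<lambda>y z. riesz (y - z) powr r"
    have f: "?f y \<ge> 0" and g: "?g y \<ge> 0" for y using weight_pos[of y] by (auto intro: less_imp_le)
    have pt: "weight y * weight z * (v y * u z * riesz (y - z))
       \<le> d * (?f y * ?g z) + a * (?f y * (?k y z * weight z)) + b * (?g z * (?k z y * weight y))" for y z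
    proof -
      \<comment> \<open>The last three identities in \<open>exps\<close> make the powers
        \<open>d\<close>, \<open>a\<close>, \<open>b\<close> of these terms reproduce
        \<open>v y * u z * riesz (y - z)\<close>; the first makes \<open>d\<close>,
        \<open>a\<close>, \<open>b\<close> the weights of a mean.\<close>
      let ?X = "v y powr \<beta> * u z powr \<alpha>" and ?Y = "v y powr \<beta> * ?k y z" and ?Z = "u z powr \<alpha> * ?k y z"
      have "?X powr d * ?Y powr a * ?Z powr b
        = (v y powr (\<beta> * d) * v y powr (\<beta> * a)) * (u z powr (\<alpha> * d) * u z powr (\<alpha> * b)) * (riesz (y - z) powr (r * a) * riesz (y - z) powr (r * b))"
        by (simp add: powr_mult powr_powr mult_ac)
      also have "\<dots> = v y powr (\<beta> * (d + a)) * u z powr (\<alpha> * (d + b)) * riesz (y - z) powr (r * (a + b))"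
        by (simp add: powr_add[symmetric] distrib_left)
      also have "\<dots> = v y * u z * riesz (y - z)"
        unfolding exps using v[of y] u[of z] riesz_nonneg[of "y - z"] by simp
      finally have "v y * u z * riesz (y - z) \<le> d * ?X + a * ?Y + b * ?Z"
        using weighted_arith_geo_mean3[of d a b ?X ?Y ?Z] nn exps by simp
      then have "weight y * weight z * (v y * u z * riesz (y - z)) \<le> weight y * weight z * (d * ?X + a * ?Y + b * ?Z)"
        using weight_pos[of y] weight_pos[of z] by (intro mult_left_mono) auto
      then show ?thesis by (simp add: algebra_simps riesz_minus[of z y])
    qed
    have "(\<integral>\<^sup>+y. \<integral>\<^sup>+z. ennreal (weight y * weight z * (v y * u z * riesz (y - z))) \<partial>lborel \<partial>lborel)
      \<le> (\<integral>\<^sup>+y. \<integral>\<^sup>+z. (ennreal d * (ennreal (?f y) * ennreal (?g z)) + ennreal a * (ennreal (?f y) * ennreal (?k y z * weight z)))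
          + ennreal b * (ennreal (?g z) * ennreal (?k z y * weight y)) \<partial>lborel \<partial>lborel)"
    proof (intro nn_integral_mono)
      fix y z :: 'a
      show "ennreal (weight y * weight z * (v y * u z * riesz (y - z)))
        \<le> (ennreal d * (ennreal (?f y) * ennreal (?g z)) + ennreal a * (ennreal (?f y) * ennreal (?k y z * weight z)))
          + ennreal b * (ennreal (?g z) * ennreal (?k z y * weight y))"
        using ennreal_leI[OF pt[of y z]] nn f[of y] g[of z] weight_pos[of y] weight_pos[of z]
        by (simp add: ennreal_mult[symmetric] ennreal_plus[symmetric] del: ennreal_plus)
    qed
    also have "\<dots> = (\<integral>\<^sup>+y. \<integral>\<^sup>+z. ennreal d * (ennreal (?f y) * ennreal (?g z)) \<partial>lborel \<partial>lborel)
       + (\<integral>\<^sup>+y. \<integral>\<^sup>+z. ennreal a * (ennreal (?f y) * ennreal (?k y z * weight z)) \<partial>lborel \<partial>lborel)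
       + (\<integral>\<^sup>+y. \<integral>\<^sup>+z. ennreal b * (ennreal (?g z) * ennreal (?k z y * weight y)) \<partial>lborel \<partial>lborel)"
      by (simp add: nn_integral_add)
    also have "(\<integral>\<^sup>+y. \<integral>\<^sup>+z. ennreal b * (ennreal (?g z) * ennreal (?k z y * weight y)) \<partial>lborel \<partial>lborel)
       = (\<integral>\<^sup>+z. \<integral>\<^sup>+y. ennreal b * (ennreal (?g z) * ennreal (?k z y * weight y)) \<partial>lborel \<partial>lborel)"
      by (rule lborel_pair.Fubini') (unfold split_beta', measurable)
    also have "(\<integral>\<^sup>+y. \<integral>\<^sup>+z. ennreal d * (ennreal (?f y) * ennreal (?g z)) \<partial>lborel \<partial>lborel)
       = ennreal d * ((\<integral>\<^sup>+y. ennreal (?f y) \<partial>lborel) * (\<integral>\<^sup>+z. ennreal (?g z) \<partial>lborel))"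
      by (simp add: nn_integral_cmult nn_integral_multc)
    also have "(\<integral>\<^sup>+y. \<integral>\<^sup>+z. ennreal a * (ennreal (?f y) * ennreal (?k y z * weight z)) \<partial>lborel \<partial>lborel)
       = ennreal a * (\<integral>\<^sup>+y. ennreal (?f y) * (\<integral>\<^sup>+z. ennreal (?k y z * weight z) \<partial>lborel) \<partial>lborel)"
      by (simp add: nn_integral_cmult)
    also have "(\<integral>\<^sup>+z. \<integral>\<^sup>+y. ennreal b * (ennreal (?g z) * ennreal (?k z y * weight y)) \<partial>lborel \<partial>lborel)
       = ennreal b * (\<integral>\<^sup>+z. ennreal (?g z) * (\<integral>\<^sup>+y. ennreal (?k z y * weight y) \<partial>lborel) \<partial>lborel)"
      by (simp add: nn_integral_cmult)
    also have "ennreal d * ((\<integral>\<^sup>+y. ennreal (?f y) \<partial>lborel) * (\<integral>\<^sup>+z. ennreal (?g z) \<partial>lborel))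
        + ennreal a * (\<integral>\<^sup>+y. ennreal (?f y) * (\<integral>\<^sup>+z. ennreal (?k y z * weight z) \<partial>lborel) \<partial>lborel)
        + ennreal b * (\<integral>\<^sup>+z. ennreal (?g z) * (\<integral>\<^sup>+y. ennreal (?k z y * weight y) \<partial>lborel) \<partial>lborel)
      \<le> ennreal d * (1 * 1) + ennreal a * (\<integral>\<^sup>+y. ennreal (?f y) * ennreal K \<partial>lborel)
        + ennreal b * (\<integral>\<^sup>+z. ennreal (?g z) * ennreal K \<partial>lborel)"
      by (intro add_mono mult_left_mono mult_mono nn_integral_mono F G K) auto
    also have "\<dots> = ennreal d + ennreal a * ((\<integral>\<^sup>+y. ennreal (?f y) \<partial>lborel) * ennreal K)
        + ennreal b * ((\<integral>\<^sup>+z. ennreal (?g z) \<partial>lborel) * ennreal K)"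
      by (simp add: nn_integral_multc)
    also have "\<dots> \<le> ennreal d + ennreal a * (1 * ennreal K) + ennreal b * (1 * ennreal K)"
      by (intro add_mono mult_left_mono mult_right_mono F G) auto
    also have "\<dots> = ennreal (d + a * K + b * K)"
      using nn K(1) by (simp add: ennreal_mult[symmetric] ennreal_plus[symmetric] del: ennreal_plus)
    also have "\<dots> \<le> ennreal C" by (rule ennreal_leI) (simp add: C_def)
    finally show ?thesis .
  qed
  have pos: "(\<integral>\<^sup>+y. \<integral>\<^sup>+z. ennreal (weight y * weight z * (v y * u z * riesz (y - z))) \<partial>lborel \<partial>lborel)
      \<le> ennreal (C * F powr (1 / \<beta>) * G powr (1 / \<alpha>))"
    if [measurable]: "v \<in> borel_measurable borel" "u \<in> borel_measurable borel"
      and v: "\<And>y. 0 \<le> v y" and u: "\<And>y. 0 \<le> u y" and FG: "0 < F" "0 < G"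
      and F: "(\<integral>\<^sup>+y. ennreal (weight y * v y powr \<beta>) \<partial>lborel) \<le> ennreal F"
      and G: "(\<integral>\<^sup>+y. ennreal (weight y * u y powr \<alpha>) \<partial>lborel) \<le> ennreal G" for v u :: "'a \<Rightarrow> real" and F G
  proof -
    let ?s = "F powr (1 / \<beta>)" and ?t = "G powr (1 / \<alpha>)"
    have st: "?s > 0" "?t > 0" using FG by auto
    have norm1: "(\<integral>\<^sup>+y. ennreal (weight y * (f y / H powr (1 / \<gamma>)) powr \<gamma>) \<partial>lborel) \<le> 1"
      if [measurable]: "f \<in> borel_measurable borel" and "\<And>y. 0 \<le> f y" "H > 0" "\<gamma> > 0"
        and H: "(\<integral>\<^sup>+y. ennreal (weight y * f y powr \<gamma>) \<partial>lborel) \<le> ennreal H" for f :: "'a \<Rightarrow> real" and H \<gamma>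
    proof -
      have "(\<integral>\<^sup>+y. ennreal (weight y * (f y / H powr (1 / \<gamma>)) powr \<gamma>) \<partial>lborel)
        = (\<integral>\<^sup>+y. ennreal (1 / H) * ennreal (weight y * f y powr \<gamma>) \<partial>lborel)"
        using that by (intro nn_integral_cong) (simp add: powr_divide powr_powr ennreal_mult'[symmetric])
      also have "\<dots> = ennreal (1 / H) * (\<integral>\<^sup>+y. ennreal (weight y * f y powr \<gamma>) \<partial>lborel)"
        by (rule nn_integral_cmult) measurable
      also have "\<dots> \<le> ennreal (1 / H) * ennreal H" by (intro mult_left_mono H) auto
      also have "\<dots> = 1" using \<open>H > 0\<close> by (simp add: ennreal_mult'[symmetric])
      finally show ?thesis .
    qed
    have "(\<integral>\<^sup>+y. \<integral>\<^sup>+z. ennreal (weight y * weight z * (v y * u z * riesz (y - z))) \<partial>lborel \<partial>lborel)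
      = (\<integral>\<^sup>+y. \<integral>\<^sup>+z. ennreal (?s * ?t) * ennreal (weight y * weight z * ((v y / ?s) * (u z / ?t) * riesz (y - z))) \<partial>lborel \<partial>lborel)"
      using st by (intro nn_integral_cong) (simp add: ennreal_mult'[symmetric] field_simps)
    also have "\<dots> = ennreal (?s * ?t) * (\<integral>\<^sup>+y. \<integral>\<^sup>+z. ennreal (weight y * weight z * ((v y / ?s) * (u z / ?t) * riesz (y - z))) \<partial>lborel \<partial>lborel)"
      by (subst nn_integral_cmult, measurable, subst nn_integral_cmult) auto
    also have "\<dots> \<le> ennreal (?s * ?t) * ennreal C"
      by (intro mult_left_mono unit norm1) (use v u F G FG nn in auto)
    also have "\<dots> = ennreal (C * ?s * ?t)"
      using C by (simp add: ennreal_mult'[symmetric] mult_ac)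
    finally show ?thesis .
  qed
  show thesis
  proof (rule that[OF C])
    fix v u :: "'a \<Rightarrow> real" and F G
    assume as: "v \<in> borel_measurable borel" "u \<in> borel_measurable borel" "\<And>y. 0 \<le> v y" "\<And>y. 0 \<le> u y" "0 \<le> F" "0 \<le> G"
      "(\<integral>\<^sup>+y. ennreal (weight y * v y powr \<beta>) \<partial>lborel) \<le> ennreal F"
      "(\<integral>\<^sup>+y. ennreal (weight y * u y powr \<alpha>) \<partial>lborel) \<le> ennreal G"
    let ?B = "(\<integral>\<^sup>+y. \<integral>\<^sup>+z. ennreal (weight y * weight z * (v y * u z * riesz (y - z))) \<partial>lborel \<partial>lborel)"
    \<comment> \<open>Normalising divides by powers of \<open>F\<close> and \<open>G\<close>, which
      may be 0; the bound for \<open>F + e\<close> and \<open>G + e\<close> passes to the limit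
      instead.\<close>
    have "((\<lambda>e. C * (F + e) powr (1 / \<beta>) * (G + e) powr (1 / \<alpha>)) \<longlongrightarrow> C * (F + 0) powr (1 / \<beta>) * (G + 0) powr (1 / \<alpha>)) (at_right 0)"
      using as nn by (intro tendsto_intros) (auto simp: eventually_at_right_less intro!: eventually_mono[OF eventually_at_right_less[of 0]])
    then have "((\<lambda>e. ennreal (C * (F + e) powr (1 / \<beta>) * (G + e) powr (1 / \<alpha>))) \<longlongrightarrow> ennreal (C * (F + 0) powr (1 / \<beta>) * (G + 0) powr (1 / \<alpha>))) (at_right 0)"
      by (rule tendsto_ennrealI)
    moreover have "\<forall>\<^sub>F e in at_right 0. ?B \<le> ennreal (C * (F + e) powr (1 / \<beta>) * (G + e) powr (1 / \<alpha>))"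
      using eventually_at_right_less[of "0::real"]
    proof eventually_elim
      case (elim e)
      show ?case
        using elim as(1-6) by (intro pos order_trans[OF as(7)] order_trans[OF as(8)] ennreal_leI) auto
    qed
    ultimately show "?B \<le> ennreal (C * F powr (1 / \<beta>) * G powr (1 / \<alpha>))"
      using tendsto_lowerbound[of _ _ "at_right (0::real)" ?B] by simp
  qed
qed

text \<open>Young's inequality for \<open>f / A\<close> and \<open>g / B\<close>. Here
  \<open>A\<close> and \<open>B\<close> are upper bounds for the norms, and the case where one of
  them is 0 follows by a limit from \<open>A + e\<close> and \<open>B + e\<close>.\<close>

lemma nn_integral_Hoelder:
  fixes f g :: "'a \<Rightarrow> real"
  assumes [measurable]: "f \<in> borel_measurable M" "g \<in> borel_measurable M"
    and nn: "\<And>x. 0 \<le> f x" "\<And>x. 0 \<le> g x" "0 \<le> A" "0 \<le> B"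
    and p: "1 < p" "1 < p'" "1 / p + 1 / p' = 1"
    and A: "(\<integral>\<^sup>+x. ennreal (f x powr p) \<partial>M) \<le> ennreal (A powr p)"
    and B: "(\<integral>\<^sup>+x. ennreal (g x powr p') \<partial>M) \<le> ennreal (B powr p')"
  shows "(\<integral>\<^sup>+x. ennreal (f x * g x) \<partial>M) \<le> ennreal (A * B)"
proof -
  have pos: "(\<integral>\<^sup>+x. ennreal (f x * g x) \<partial>M) \<le> ennreal (A * B)" if AB: "A > 0" "B > 0"
      and A: "(\<integral>\<^sup>+x. ennreal (f x powr p) \<partial>M) \<le> ennreal (A powr p)"
      and B: "(\<integral>\<^sup>+x. ennreal (g x powr p') \<partial>M) \<le> ennreal (B powr p')" for A B
  proof -
    let ?a = "A * B / (p * A powr p)" and ?b = "A * B / (p' * B powr p')"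
    have ab: "?a \<ge> 0" "?b \<ge> 0" using AB p by auto
    have "(\<integral>\<^sup>+x. ennreal (f x * g x) \<partial>M) \<le> (\<integral>\<^sup>+x. ennreal ?a * ennreal (f x powr p) + ennreal ?b * ennreal (g x powr p') \<partial>M)"
    proof (rule nn_integral_mono)
      fix x
      have "(f x / A) * (g x / B) \<le> (f x / A) powr p / p + (g x / B) powr p' / p'"
        by (rule Youngs_inequality) (use p nn AB in auto)
      then have "A * B * ((f x / A) * (g x / B)) \<le> A * B * ((f x / A) powr p / p + (g x / B) powr p' / p')"
        using AB by (intro mult_left_mono) auto
      then have "f x * g x \<le> ?a * f x powr p + ?b * g x powr p'"
        using AB nn p by (simp add: powr_divide field_simps)
      then have "ennreal (f x * g x) \<le> ennreal (?a * f x powr p + ?b * g x powr p')" by (rule ennreal_leI)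
      also have "\<dots> = ennreal ?a * ennreal (f x powr p) + ennreal ?b * ennreal (g x powr p')"
        using ab by (subst ennreal_plus) (auto simp only: ennreal_mult powr_ge_zero mult_nonneg_nonneg)
      finally show "ennreal (f x * g x) \<le> \<dots>" .
    qed
    also have "\<dots> = ennreal ?a * (\<integral>\<^sup>+x. ennreal (f x powr p) \<partial>M) + ennreal ?b * (\<integral>\<^sup>+x. ennreal (g x powr p') \<partial>M)"
      by (simp add: nn_integral_add nn_integral_cmult)
    also have "\<dots> \<le> ennreal ?a * ennreal (A powr p) + ennreal ?b * ennreal (B powr p')"
      by (intro add_mono mult_left_mono A B) auto
    also have "\<dots> = ennreal (?a * A powr p + ?b * B powr p')"
      using ab by (subst ennreal_plus) (auto simp only: ennreal_mult powr_ge_zero mult_nonneg_nonneg)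
    also have "?a * A powr p + ?b * B powr p' = A * B * (1 / p + 1 / p')"
      using AB p(1,2) by (simp add: field_simps)
    finally show ?thesis using p(3) by simp
  qed
  have "((\<lambda>e. ennreal ((A + e) * (B + e))) \<longlongrightarrow> ennreal ((A + 0) * (B + 0))) (at_right 0)"
    by (intro tendsto_ennrealI tendsto_intros)
  moreover have "\<forall>\<^sub>F e in at_right 0. (\<integral>\<^sup>+x. ennreal (f x * g x) \<partial>M) \<le> ennreal ((A + e) * (B + e))"
    using eventually_at_right_less[of "0::real"]
  proof eventually_elim
    case (elim e)
    show ?case
      using elim nn p by (intro pos order_trans[OF A] order_trans[OF B] ennreal_leI powr_mono2) auto
  qed
  ultimately show ?thesis
    using tendsto_lowerbound[of _ _ "at_right (0::real)" "(\<integral>\<^sup>+x. ennreal (f x * g x) \<partial>M)"] by simp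
qed

section \<open>A regularised fundamental solution\<close>

text \<open>The pointwise counterpart of \<open>vf_apply\<close>, for smooth functions.\<close>

definition vf_deriv :: "complex ^ 'N \<Rightarrow> (real ^ 'N \<Rightarrow> complex) \<Rightarrow> real ^ 'N \<Rightarrow> complex" where
  "vf_deriv a f x = (\<Sum>k\<in>UNIV. a $ k * partial k f x)"

lemma vf_deriv_mult:
  "smooth f \<Longrightarrow> smooth g \<Longrightarrow> vf_deriv a (\<lambda>x. f x * g x) x = vf_deriv a f x * g x + f x * vf_deriv a g x"
  by (simp add: vf_deriv_def partial_mult smooth_differentiable distrib_left sum.distrib sum_distrib_right sum_distrib_left mult_ac)

lemma vf_deriv_affine:
  "smooth f \<Longrightarrow> vf_deriv a (\<lambda>x. f (b + c *\<^sub>R x)) x = of_real c * vf_deriv a f (b + c *\<^sub>R x)"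
  by (simp add: vf_deriv_def partial_affine smooth_differentiable sum_distrib_left mult_ac)

lemma smooth_vf_deriv: "smooth f \<Longrightarrow> smooth (vf_deriv a f)"
  unfolding vf_deriv_def[abs_def] by (intro smooth_sum smooth_mult smooth_const smooth_partial)

lemma test_function_add: "test_function f \<Longrightarrow> test_function g \<Longrightarrow> test_function (\<lambda>x. f x + g x)"
proof -
  assume "test_function f" "test_function g"
  then obtain R S where "\<And>x. f x \<noteq> 0 \<Longrightarrow> norm x \<le> R" "\<And>x. g x \<noteq> 0 \<Longrightarrow> norm x \<le> S" "smooth f" "smooth g"
    by (auto simp: test_function_iff)
  moreover from this have "norm x \<le> max R S" if "f x + g x \<noteq> 0" for x
    using that by (cases "f x = 0") (auto simp: le_max_iff_disj)
  ultimately show ?thesis by (auto simp: test_function_iff smooth_add)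
qed

lemma test_function_sum:
  "(\<And>i. i \<in> I \<Longrightarrow> test_function (f i)) \<Longrightarrow> test_function (\<lambda>x. \<Sum>i\<in>I. f i x)"
proof (induction I rule: infinite_finite_induct)
  case (insert i I)
  then show ?case by (simp add: test_function_add)
qed (auto simp: test_function_iff smooth_const)

lemma test_function_vf_deriv: "test_function f \<Longrightarrow> test_function (vf_deriv a f)"
  unfolding vf_deriv_def[abs_def] by (intro test_function_sum test_function_mult' smooth_const test_function_partial)

section \<open>Linear algebra of the symbol\<close>

locale elliptic =
  fixes m :: "complex ^ 'N ^ 'n"
  assumes ell: "elliptic_system m"
begin

text \<open>The matrix inside \<open>Re\<close> is Hermitian, so its imaginary part is antisymmetric
  and drops out when it is contracted with a symmetric real matrix.\<close>

definition symb :: "real ^ 'N ^ 'N" where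
  "symb = (\<chi> k l. Re (\<Sum>i\<in>UNIV. cnj (m $ i $ k) * m $ i $ l))"

definition inv_symb :: "real ^ 'N ^ 'N" where
  "inv_symb = matrix_inv symb"

text \<open>Exchanging \<open>k\<close> and \<open>l\<close> turns the sum into its conjugate when
  \<open>B\<close> is symmetric, so it is real. Used with \<open>y $ k * y $ l\<close> for
  positivity and with the derivative matrix of the kernel for its divergence.\<close>

lemma symb_contract:
  fixes B :: "'N \<Rightarrow> 'N \<Rightarrow> real"
  assumes "\<And>k l. B k l = B l k"
  shows "(\<Sum>i\<in>UNIV. \<Sum>l\<in>UNIV. m $ i $ l * (\<Sum>k\<in>UNIV. cnj (m $ i $ k) * of_real (B k l))) = of_real (\<Sum>k\<in>UNIV. \<Sum>l\<in>UNIV. symb $ k $ l * B k l)"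
    (is "?S = _")
proof -
  have "?S = (\<Sum>l\<in>UNIV. \<Sum>i\<in>UNIV. \<Sum>k\<in>UNIV. m $ i $ l * (cnj (m $ i $ k) * of_real (B k l)))"
    unfolding sum_distrib_left by (rule sum.swap)
  also have "\<dots> = (\<Sum>l\<in>UNIV. \<Sum>k\<in>UNIV. \<Sum>i\<in>UNIV. m $ i $ l * (cnj (m $ i $ k) * of_real (B k l)))"
    by (intro sum.cong sum.swap refl)
  also have "\<dots> = (\<Sum>k\<in>UNIV. \<Sum>l\<in>UNIV. \<Sum>i\<in>UNIV. m $ i $ l * (cnj (m $ i $ k) * of_real (B k l)))"
    by (rule sum.swap)
  also have "\<dots> = (\<Sum>k\<in>UNIV. \<Sum>l\<in>UNIV. (\<Sum>i\<in>UNIV. cnj (m $ i $ k) * m $ i $ l) * of_real (B k l))"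
    by (simp add: sum_distrib_left mult_ac)
  finally have S: "?S = (\<Sum>k\<in>UNIV. \<Sum>l\<in>UNIV. (\<Sum>i\<in>UNIV. cnj (m $ i $ k) * m $ i $ l) * of_real (B k l))" .
  have "cnj ?S = (\<Sum>k\<in>UNIV. \<Sum>l\<in>UNIV. (\<Sum>i\<in>UNIV. cnj (m $ i $ l) * m $ i $ k) * of_real (B k l))"
    unfolding S by (simp add: mult.commute)
  also have "\<dots> = (\<Sum>k\<in>UNIV. \<Sum>l\<in>UNIV. (\<Sum>i\<in>UNIV. cnj (m $ i $ l) * m $ i $ k) * of_real (B l k))"
    by (intro sum.cong refl) (metis assms)
  also have "\<dots> = ?S"
    unfolding S by (rule sum.swap)
  finally have real: "cnj ?S = ?S" .
  have "z = of_real (Re z)" if "cnj z = z" for z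
    using that by (auto simp: complex_eq_iff)
  from this[OF real] have "?S = of_real (Re ?S)" .
  also have "Re ?S = (\<Sum>k\<in>UNIV. \<Sum>l\<in>UNIV. symb $ k $ l * B k l)"
    unfolding S by (simp add: symb_def)
  finally show ?thesis .
qed

lemma symb_quadratic:
  "of_real (y \<bullet> (symb *v y)) = (\<Sum>i\<in>UNIV. of_real ((cmod (\<Sum>k\<in>UNIV. m $ i $ k * of_real (y $ k)))\<^sup>2) :: complex)"
proof -
  have "y \<bullet> (symb *v y) = (\<Sum>k\<in>UNIV. \<Sum>l\<in>UNIV. symb $ k $ l * (y $ k * y $ l))"
    by (simp add: inner_vec_def matrix_vector_mult_def sum_distrib_left mult_ac)
  then have "of_real (y \<bullet> (symb *v y)) = (\<Sum>i\<in>UNIV. \<Sum>l\<in>UNIV. m $ i $ l * (\<Sum>k\<in>UNIV. cnj (m $ i $ k) * of_real (y $ k * y $ l)))"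
    using symb_contract[of "\<lambda>k l. y $ k * y $ l"] by (simp add: mult.commute)
  also have "\<dots> = (\<Sum>i\<in>UNIV. (\<Sum>l\<in>UNIV. m $ i $ l * of_real (y $ l)) * cnj (\<Sum>k\<in>UNIV. m $ i $ k * of_real (y $ k)))"
    unfolding sum_distrib_right by (intro sum.cong refl) (simp add: sum_distrib_left mult_ac)
  finally show ?thesis by (simp only: complex_norm_square)
qed

text \<open>Ellipticity says that some summand in the sum of squares is non-zero.\<close>

lemma symb_pos: "y \<noteq> 0 \<Longrightarrow> y \<bullet> (symb *v y) > 0"
proof -
  assume y: "y \<noteq> 0"
  have eq: "y \<bullet> (symb *v y) = (\<Sum>i\<in>UNIV. (cmod (\<Sum>k\<in>UNIV. m $ i $ k * of_real (y $ k)))\<^sup>2)"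
    using symb_quadratic[of y] by (simp only: of_real_sum[symmetric] of_real_eq_iff)
  obtain i where "(\<Sum>k\<in>UNIV. m $ i $ k * of_real (y $ k)) \<noteq> 0"
    using ell y unfolding elliptic_system_def by blast
  then show ?thesis unfolding eq by (intro sum_pos2[of _ i]) auto
qed

lemma symb_sym: "transpose symb = symb"
proof -
  have "Re (cnj (m $ i $ l) * m $ i $ k) = Re (cnj (m $ i $ k) * m $ i $ l)" for i k l
    by (simp add: mult.commute)
  then show ?thesis by (simp add: symb_def transpose_def vec_eq_iff del: complex_cnj_mult complex_mult_cnj times_complex.sel)
qed

lemma symb_inv: "symb ** inv_symb = mat 1" "inv_symb ** symb = mat 1"
proof -
  have "\<forall>y. symb *v y = 0 \<longrightarrow> y = 0"
    using symb_pos by (metis inner_zero_right less_irrefl)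
  then have "\<exists>B. B ** symb = mat 1"
    by (simp add: matrix_left_invertible_ker)
  then have inv: "invertible symb"
    using matrix_left_right_inverse by (auto simp: invertible_def)
  show "symb ** inv_symb = mat 1" "inv_symb ** symb = mat 1"
    unfolding inv_symb_def matrix_inv_def using someI_ex[OF inv[unfolded invertible_def]] by auto
qed

lemma inv_symb_sym: "inv_symb $ k $ l = inv_symb $ l $ k"
proof -
  have "transpose inv_symb ** symb = mat 1"
    using arg_cong[OF symb_inv(1), of transpose] by (simp add: matrix_transpose_mul symb_sym transpose_mat)
  then have "transpose inv_symb = inv_symb"
    by (metis matrix_mul_assoc matrix_mul_lid matrix_mul_rid symb_inv(1))
  then have "transpose inv_symb $ k $ l = inv_symb $ k $ l" by simp
  then show ?thesis by (simp add: transpose_def)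
qed

text \<open>In coordinates that turn \<open>symb\<close> into the identity this is the squared
  Euclidean norm, and the second order operator with coefficients \<open>symb\<close> becomes the
  Laplacian.\<close>

definition qform :: "real ^ 'N \<Rightarrow> real" where
  "qform x = x \<bullet> (inv_symb *v x)"

lemma qform_symb: "qform x = (inv_symb *v x) \<bullet> (symb *v (inv_symb *v x))"
  by (simp add: qform_def matrix_vector_mul_assoc symb_inv inner_commute)

lemma qform_scale: "qform (c *\<^sub>R x) = c\<^sup>2 * qform x"
  by (simp add: qform_def matrix_vector_mult_scaleR power2_eq_square)

text \<open>Homogeneity reduces the bound to the unit sphere, where the continuous positive function
  \<open>qform\<close> attains its minimum.\<close>

lemma qform_lower: obtains c where "c > 0" "\<And>x. c * (norm x)\<^sup>2 \<le> qform x"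
proof -
  have pos: "qform x > 0" if "x \<noteq> 0" for x
  proof -
    have "symb *v (inv_symb *v x) = x" by (simp add: matrix_vector_mul_assoc symb_inv)
    then have "inv_symb *v x \<noteq> 0" using that by auto
    then show ?thesis unfolding qform_symb by (rule symb_pos)
  qed
  have "continuous_on (sphere 0 1) qform"
    unfolding qform_def by (intro continuous_intros linear_continuous_on matrix_vector_mul_bounded_linear)
  moreover have "sphere 0 1 \<noteq> ({} :: (real^'N) set)" by simp
  ultimately obtain x0 where x0: "x0 \<in> sphere 0 1" "\<And>x. x \<in> sphere 0 1 \<Longrightarrow> qform x0 \<le> qform x"
    using continuous_attains_inf[OF compact_sphere] by blast
  show thesis
  proof (rule that[of "qform x0"])
    show "qform x0 > 0" using x0(1) by (intro pos) auto
    fix x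
    show "qform x0 * (norm x)\<^sup>2 \<le> qform x"
    proof (cases "x = 0")
      case False
      then have "qform x0 \<le> qform ((1 / norm x) *\<^sub>R x)" by (intro x0) auto
      then show ?thesis using False by (simp add: qform_scale power_divide field_simps)
    qed (simp add: qform_def)
  qed
qed

lemma qform_nonneg: "qform x \<ge> 0"
proof -
  obtain c where "c > 0" "c * (norm x)\<^sup>2 \<le> qform x" using qform_lower by metis
  then show ?thesis by (meson order_trans less_imp_le mult_nonneg_nonneg zero_le_power2)
qed

lemma smooth_lin: "smooth (\<lambda>x. complex_of_real ((inv_symb *v x) $ k))"
proof -
  have eq: "(\<lambda>x. complex_of_real ((inv_symb *v x) $ k)) = (\<lambda>x. \<Sum>j\<in>UNIV. of_real (inv_symb $ k $ j) * complex_of_real (x $ j))"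
    by (simp add: matrix_vector_mult_def)
  show ?thesis
    unfolding eq by (intro smooth_sum smooth_mult smooth_const smooth_coord)
qed

lemma smooth_qform: "smooth (\<lambda>x. complex_of_real (e + qform x))"
  and partial_qform: "partial l (\<lambda>x. complex_of_real (e + qform x)) x = of_real (2 * (inv_symb *v x) $ l)"
proof -
  have q: "qform x = (\<Sum>k\<in>UNIV. x $ k * (inv_symb *v x) $ k)" for x
    by (simp add: qform_def inner_vec_def)
  have "(\<lambda>x. complex_of_real (e + qform x)) = (\<lambda>x. of_real e + (\<Sum>k\<in>UNIV. of_real (x $ k) * of_real ((inv_symb *v x) $ k)))"
    by (simp only: q of_real_add of_real_sum of_real_mult)
  then show "smooth (\<lambda>x. complex_of_real (e + qform x))"
    by (simp only:) (intro smooth_add smooth_sum smooth_mult smooth_const smooth_coord smooth_lin)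
  have D: "((\<lambda>x. complex_of_real (e + qform x)) has_derivative (\<lambda>h. of_real (x \<bullet> (inv_symb *v h) + h \<bullet> (inv_symb *v x)))) (at x)"
    unfolding qform_def
    by (rule derivative_eq_intros bounded_linear.has_derivative[OF matrix_vector_mul_bounded_linear] refl | simp)+
  have "x \<bullet> (inv_symb *v axis l 1) = (inv_symb *v x) $ l"
  proof -
    have "x \<bullet> (inv_symb *v axis l 1) = x \<bullet> column l inv_symb" by (simp add: matrix_vector_mult_basis)
    also have "\<dots> = (inv_symb *v x) $ l"
      by (simp add: column_def inner_vec_def matrix_vector_mult_def inv_symb_sym[of l] mult.commute)
    finally show ?thesis .
  qed
  then show "partial l (\<lambda>x. complex_of_real (e + qform x)) x = of_real (2 * (inv_symb *v x) $ l)"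
    using partial_eqI[OF D, of l] by (simp add: inner_axis')
qed

section \<open>The regularised kernels and their divergence\<close>

text \<open>A regularised gradient of the fundamental solution of \<open>\<Sum>i. L\<^sub>i\<^sup>* L\<^sub>i\<close>, which is
  \<open>qform x powr (1 - N / 2)\<close> up to a constant if \<open>N > 2\<close>.\<close>

definition kern :: "real \<Rightarrow> 'n \<Rightarrow> real ^ 'N \<Rightarrow> complex" where
  "kern e i x = (\<Sum>k\<in>UNIV. cnj (m $ i $ k) * of_real ((inv_symb *v x) $ k)) *
     of_real ((e\<^sup>2 + qform x) powr (- (real CARD('N) / 2)))"

text \<open>The divergence of \<open>kern e\<close>. It is the dilate of \<open>delta 1\<close> by
  \<open>e\<close> and concentrates at 0 as \<open>e\<close> decreases, with a mass that is not
  normalised to 1.\<close>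

definition delta :: "real \<Rightarrow> real ^ 'N \<Rightarrow> real" where
  "delta e x = real CARD('N) * e\<^sup>2 * (e\<^sup>2 + qform x) powr (- (real CARD('N) / 2) - 1)"

lemma qform_pos: "e > 0 \<Longrightarrow> e\<^sup>2 + qform x > 0"
  using qform_nonneg[of x] by (simp add: add_pos_nonneg)

lemma smooth_kern: "e > 0 \<Longrightarrow> smooth (kern e i)"
  unfolding kern_def[abs_def]
  by (intro smooth_mult smooth_sum smooth_const smooth_lin smooth_powr(1) smooth_qform qform_pos)

text \<open>The derivative matrix of the kernel has the two parts seen in \<open>?b\<close>.
  Contracted with \<open>symb\<close>, the first gives \<open>N\<close>, the trace of the identity,
  and the second \<open>- N * qform x / (e\<^sup>2 + qform x)\<close>, both times the power
  \<open>- N / 2\<close> of \<open>e\<^sup>2 + qform x\<close>. They cancel up to the term carrying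
  \<open>e\<^sup>2\<close>.\<close>

lemma kern_divergence:
  assumes e: "e > 0"
  shows "(\<Sum>i\<in>UNIV. vf_deriv (m $ i) (kern e i) x) = of_real (delta e x)"
proof -
  let ?S = "e\<^sup>2 + qform x" and ?h = "real CARD('N) / 2" and ?y = "inv_symb *v x"
  let ?b = "\<lambda>k l. inv_symb $ k $ l * ?S powr (- ?h) + ?y $ k * ?y $ l * (- (real CARD('N)) * ?S powr (- ?h - 1))"
  have lin: "smooth (\<lambda>x. \<Sum>k\<in>UNIV. cnj (m $ i $ k) * of_real ((inv_symb *v x) $ k))" for i
    by (intro smooth_sum smooth_mult smooth_const smooth_lin)
  have pw: "smooth (\<lambda>x. complex_of_real ((e\<^sup>2 + qform x) powr (- ?h)))"
    by (intro smooth_powr smooth_qform qform_pos e)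
  have plin: "partial l (\<lambda>x. \<Sum>k\<in>UNIV. cnj (m $ i $ k) * of_real ((inv_symb *v x) $ k)) x
     = (\<Sum>k\<in>UNIV. cnj (m $ i $ k) * of_real (inv_symb $ k $ l))" for i l
  proof -
    have "((\<lambda>x. \<Sum>k\<in>UNIV. cnj (m $ i $ k) * of_real ((inv_symb *v x) $ k)) has_derivative
        (\<lambda>h. \<Sum>k\<in>UNIV. cnj (m $ i $ k) * of_real ((inv_symb *v h) $ k))) (at x)"
      by (intro has_derivative_sum has_derivative_mult_right has_derivative_of_real
        bounded_linear_imp_has_derivative bounded_linear_compose[OF bounded_linear_vec_nth] matrix_vector_mul_bounded_linear)
    from partial_eqI[OF this, of l] show ?thesis
      by (simp add: matrix_vector_mult_basis column_def)
  qed
  have "partial l (kern e i) x = (\<Sum>k\<in>UNIV. cnj (m $ i $ k) * of_real (?b k l))" for i l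
  proof -
    have ppw: "partial l (\<lambda>x. complex_of_real ((e\<^sup>2 + qform x) powr (- ?h))) x = of_real (?y $ l * (- (real CARD('N)) * ?S powr (- ?h - 1)))"
      by (subst smooth_powr(2)[OF smooth_qform qform_pos[OF e]]) (simp add: partial_qform del: of_real_add)
    have "partial l (kern e i) x = (\<Sum>k\<in>UNIV. cnj (m $ i $ k) * of_real (inv_symb $ k $ l)) * of_real (?S powr (- ?h))
      + (\<Sum>k\<in>UNIV. cnj (m $ i $ k) * of_real (?y $ k)) * of_real (?y $ l * (- (real CARD('N)) * ?S powr (- ?h - 1)))"
      unfolding kern_def[abs_def]
      by (subst partial_mult, (intro smooth_differentiable lin pw)+) (simp only: plin ppw)
    then show ?thesis
      by (simp only: sum_distrib_right sum.distrib[symmetric] of_real_add of_real_mult distrib_left mult.assoc)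
  qed
  then have "(\<Sum>i\<in>UNIV. vf_deriv (m $ i) (kern e i) x)
     = (\<Sum>i\<in>UNIV. \<Sum>l\<in>UNIV. m $ i $ l * (\<Sum>k\<in>UNIV. cnj (m $ i $ k) * of_real (?b k l)))"
    by (simp add: vf_deriv_def)
  also have "\<dots> = of_real (\<Sum>k\<in>UNIV. \<Sum>l\<in>UNIV. symb $ k $ l * ?b k l)"
    by (rule symb_contract) (simp add: inv_symb_sym mult.commute)
  also have "(\<Sum>k\<in>UNIV. \<Sum>l\<in>UNIV. symb $ k $ l * ?b k l)
     = (\<Sum>k\<in>UNIV. \<Sum>l\<in>UNIV. symb $ k $ l * inv_symb $ k $ l) * ?S powr (- ?h)
       + (\<Sum>k\<in>UNIV. \<Sum>l\<in>UNIV. symb $ k $ l * (?y $ k * ?y $ l)) * (- (real CARD('N)) * ?S powr (- ?h - 1))"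
    by (simp only: distrib_left sum.distrib sum_distrib_right mult.assoc)
  also have "(\<Sum>k\<in>UNIV. \<Sum>l\<in>UNIV. symb $ k $ l * inv_symb $ k $ l) = (\<Sum>k\<in>UNIV. (symb ** inv_symb) $ k $ k)"
    by (simp add: matrix_matrix_mult_def inv_symb_sym)
  also have "\<dots> = real CARD('N)" unfolding symb_inv by (simp add: mat_def)
  also have "(\<Sum>k\<in>UNIV. \<Sum>l\<in>UNIV. symb $ k $ l * (?y $ k * ?y $ l)) = qform x"
    unfolding qform_symb by (simp add: inner_vec_def matrix_vector_mult_def[of symb] sum_distrib_left mult_ac)
  also have "real CARD('N) * ?S powr (- ?h) + qform x * (- (real CARD('N)) * ?S powr (- ?h - 1)) = delta e x"
  proof -
    have "?S powr (- ?h) = ?S * ?S powr (- ?h - 1)"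
      using qform_pos[OF e, of x] by (simp add: powr_diff)
    then show ?thesis unfolding delta_def by (simp add: algebra_simps)
  qed
  finally show ?thesis .
qed

text \<open>A linear numerator over the power \<open>N / 2\<close> of \<open>qform\<close> has the
  size of \<open>riesz\<close>. Dropping \<open>e\<^sup>2\<close> only increases the negative power,
  hence a constant uniform in \<open>e\<close>. At 0 both sides vanish.\<close>

lemma kern_bound: obtains C where "C > 0" "\<And>e i x. e > 0 \<Longrightarrow> norm (kern e i x) \<le> C * riesz x"
proof -
  obtain c where c: "c > 0" "\<And>x. c * (norm x)\<^sup>2 \<le> qform x" using qform_lower by blast
  let ?h = "real CARD('N) / 2"
  obtain B where B: "B > 0" "\<And>x. norm (inv_symb *v x) \<le> norm x * B"
    using bounded_linear.pos_bounded[OF matrix_vector_mul_bounded_linear[of inv_symb]] by blast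
  define M where "M = (\<Sum>i\<in>UNIV. \<Sum>k\<in>UNIV. cmod (m $ i $ k)) * B + 1"
  have M: "M > 0" using B by (simp add: M_def add_nonneg_pos sum_nonneg)
  show thesis
  proof (rule that[of "M * c powr (- ?h)"])
    show "M * c powr (- ?h) > 0" using M c by simp
    fix e :: real and i x assume e: "e > 0"
    show "norm (kern e i x) \<le> M * c powr (- ?h) * riesz x"
    proof (cases "x = 0")
      case False
      have "norm (\<Sum>k\<in>UNIV. cnj (m $ i $ k) * of_real ((inv_symb *v x) $ k)) \<le> (\<Sum>k\<in>UNIV. cmod (m $ i $ k) * (norm x * B))"
      proof (rule sum_norm_le)
        fix k
        have "\<bar>(inv_symb *v x) $ k\<bar> \<le> norm x * B"
          using component_le_norm_cart[of "inv_symb *v x" k] B(2)[of x] by linarith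
        then show "norm (cnj (m $ i $ k) * of_real ((inv_symb *v x) $ k)) \<le> cmod (m $ i $ k) * (norm x * B)"
          by (simp add: norm_mult mult_left_mono)
      qed
      also have "\<dots> = (\<Sum>k\<in>UNIV. cmod (m $ i $ k)) * B * norm x"
        by (simp only: mult.assoc sum_distrib_right mult.commute[of B])
      also have "\<dots> \<le> M * norm x"
      proof (rule mult_right_mono)
        have "(\<Sum>k\<in>UNIV. cmod (m $ i $ k)) \<le> (\<Sum>i\<in>UNIV. \<Sum>k\<in>UNIV. cmod (m $ i $ k))"
          by (rule member_le_sum) (auto simp: sum_nonneg)
        then have "(\<Sum>k\<in>UNIV. cmod (m $ i $ k)) * B \<le> (\<Sum>i\<in>UNIV. \<Sum>k\<in>UNIV. cmod (m $ i $ k)) * B"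
          using B by (intro mult_right_mono) auto
        then show "(\<Sum>k\<in>UNIV. cmod (m $ i $ k)) * B \<le> M" unfolding M_def by linarith
      qed simp
      finally have 1: "norm (\<Sum>k\<in>UNIV. cnj (m $ i $ k) * of_real ((inv_symb *v x) $ k)) \<le> M * norm x" .
      have "(e\<^sup>2 + qform x) powr (- ?h) \<le> (c * (norm x)\<^sup>2) powr (- ?h)"
        using c False by (intro powr_mono2') (auto intro: order_trans[OF c(2)])
      also have "\<dots> = c powr (- ?h) * norm x powr (- real CARD('N))"
      proof -
        have "(norm x)\<^sup>2 = norm x powr 2" using False by simp
        then have "((norm x)\<^sup>2) powr (- ?h) = norm x powr (2 * (- ?h))" by (simp only: powr_powr)
        then show ?thesis using c by (simp add: powr_mult)
      qed
      finally have 2: "(e\<^sup>2 + qform x) powr (- ?h) \<le> c powr (- ?h) * norm x powr (- real CARD('N))" .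
      have "norm (kern e i x) \<le> (M * norm x) * (c powr (- ?h) * norm x powr (- real CARD('N)))"
        unfolding kern_def norm_mult by (intro mult_mono 1) (use M 2 in auto)
      also have "\<dots> = M * c powr (- ?h) * riesz x"
        using False by (simp add: riesz_def powr_diff powr_minus field_simps)
      finally show ?thesis .
    qed (simp add: kern_def riesz_def)
  qed
qed

lemma delta_pos: "e > 0 \<Longrightarrow> delta e x > 0"
  unfolding delta_def using qform_pos[of e x] by simp

lemma delta_nonneg: "delta e x \<ge> 0"
  unfolding delta_def by simp

text \<open>By homogeneity \<open>e\<^sup>2\<close> comes out of the sum
  \<open>e\<^sup>2 + qform (e *\<^sub>R x)\<close>; its power \<open>- N / 2 - 1\<close> cancels the
  factors \<open>e ^ N\<close> and \<open>e\<^sup>2\<close>.\<close>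

lemma delta_scale:
  assumes e: "e > 0"
  shows "e ^ CARD('N) * delta e (e *\<^sub>R x) = delta 1 x"
proof -
  let ?h = "real CARD('N) / 2"
  have "e\<^sup>2 + qform (e *\<^sub>R x) = e\<^sup>2 * (1 + qform x)" by (simp add: qform_scale algebra_simps)
  moreover have "(e\<^sup>2 * (1 + qform x)) powr (- ?h - 1) = (e\<^sup>2) powr (- ?h - 1) * (1 + qform x) powr (- ?h - 1)"
    using e qform_nonneg[of x] by (simp add: powr_mult)
  moreover have "(e\<^sup>2) powr (- ?h - 1) = 1 / (e ^ CARD('N) * e\<^sup>2)"
  proof -
    have "e\<^sup>2 = e powr 2" using e by simp
    moreover have "2 * (- ?h - 1) = - real (CARD('N) + 2)" by simp
    ultimately have "(e\<^sup>2) powr (- ?h - 1) = e powr (- real (CARD('N) + 2))" by (simp only: powr_powr)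
    also have "\<dots> = 1 / e ^ (CARD('N) + 2)" using e by (simp only: powr_minus_divide powr_realpow)
    finally show ?thesis by (simp add: power_add power2_eq_square)
  qed
  ultimately show ?thesis using e by (simp add: delta_def)
qed

lemma borel_measurable_qform [measurable]: "qform \<in> borel_measurable borel"
  unfolding qform_def[abs_def]
  by (intro borel_measurable_continuous_onI continuous_intros linear_continuous_on matrix_vector_mul_bounded_linear)

lemma borel_measurable_delta [measurable]: "delta e \<in> borel_measurable borel"
  unfolding delta_def[abs_def] by measurable

text \<open>\<open>delta 1\<close> has the exponent of \<open>weight\<close>, and
  \<open>1 + qform x\<close> dominates a multiple of \<open>1 + (norm x)\<^sup>2\<close>.\<close>

lemma delta_integrable: "integrable lborel (delta 1)"
proof -
  obtain c where c: "c > 0" "\<And>x. c * (norm x)\<^sup>2 \<le> qform x" using qform_lower by blast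
  let ?h = "real CARD('N) / 2"
  define d where "d = min 1 c"
  have d: "d > 0" "d \<le> 1" "d \<le> c" using c by (auto simp: d_def)
  let ?C = "real CARD('N) * d powr (- ?h - 1)"
  have "delta 1 x \<le> ?C * weight x" for x
  proof -
    have "d * (norm x)\<^sup>2 \<le> c * (norm x)\<^sup>2" using d by (intro mult_right_mono) auto
    then have le: "d * (1 + (norm x)\<^sup>2) \<le> 1 + qform x"
      unfolding distrib_left using d c(2)[of x] by linarith
    have "(1 + qform x) powr (- ?h - 1) \<le> (d * (1 + (norm x)\<^sup>2)) powr (- ?h - 1)"
      using d le by (intro powr_mono2') (auto simp: add_pos_nonneg)
    also have "\<dots> = d powr (- ?h - 1) * weight x"
      using d by (simp add: powr_mult weight_def)
    finally show ?thesis unfolding delta_def by (simp add: mult_left_mono mult.assoc)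
  qed
  then have "(\<integral>\<^sup>+x. ennreal (norm (delta 1 x)) \<partial>lborel) \<le> (\<integral>\<^sup>+x. ennreal ?C * ennreal (weight (x :: real ^ 'N)) \<partial>lborel)"
    by (intro nn_integral_mono) (simp add: delta_nonneg ennreal_mult'[symmetric] ennreal_leI)
  also have "\<dots> = ennreal ?C * (\<integral>\<^sup>+x. ennreal (weight (x :: real ^ 'N)) \<partial>lborel)"
    by (rule nn_integral_cmult) measurable
  also have "\<dots> < \<infinity>"
    using le_less_trans[OF nn_integral_weight_le[where 'a = "real ^ 'N"]] by (simp add: ennreal_mult_less_top)
  finally show ?thesis by (intro integrableI_bounded) auto
qed

text \<open>The value of the mass does not matter: the limit of the mollified pairing carries it as
  a factor, and positivity allows division by it.\<close>

lemma delta_integral_pos: "(LINT x|lborel. delta 1 x) > 0"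
proof -
  have "(LINT x|lborel. delta 1 x) \<noteq> 0"
  proof
    assume "(LINT x|lborel. delta 1 x) = 0"
    then have "AE x in lborel. delta 1 x = 0"
      using integral_nonneg_eq_0_iff_AE[OF delta_integrable] by (simp add: delta_nonneg)
    then have "AE x in (lborel :: (real ^ 'N) measure). False"
      by (rule eventually_mono) (metis delta_pos less_irrefl zero_less_one)
    then show False by (simp add: eventually_False ae_filter_eq_bot_iff)
  qed
  then show ?thesis using Bochner_Integration.integral_nonneg[of lborel "delta 1"] delta_nonneg by (simp add: less_le)
qed

end

section \<open>The div-curl identity\<close>

lemma ennreal_norm_integral_le:
  fixes f :: "'a \<Rightarrow> 'b::{banach, second_countable_topology}"
  shows "ennreal (norm (integral\<^sup>L M f)) \<le> (\<integral>\<^sup>+x. ennreal (norm (f x)) \<partial>M)"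
  by (cases "integrable M f") (auto simp: integral_norm_bound_ennreal not_integrable_integral_eq)

text \<open>Local integrability, stated as integrability against every test function, which is the
  form in which weak identities consume it.\<close>

definition loc_int :: "(real ^ 'N \<Rightarrow> complex) \<Rightarrow> bool" where
  "loc_int f \<longleftrightarrow> (\<forall>\<psi>. test_function \<psi> \<longrightarrow> integrable lborel (\<lambda>x. f x * \<psi> x))"

definition comp_int :: "(real ^ 'N \<Rightarrow> complex) \<Rightarrow> bool" where
  "comp_int f \<longleftrightarrow> integrable lborel f \<and> (\<exists>R. \<forall>x. f x \<noteq> 0 \<longrightarrow> norm x \<le> R)"

lemma comp_int_mult:
  assumes "loc_int f" "test_function \<psi>"
  shows "comp_int (\<lambda>x. f x * \<psi> x)"
proof -
  obtain R where "\<And>x. \<psi> x \<noteq> 0 \<Longrightarrow> norm x \<le> R" using assms(2) by (auto simp: test_function_iff)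
  then show ?thesis using assms by (auto simp: comp_int_def loc_int_def)
qed

lemma comp_int_add:
  assumes "comp_int f" "comp_int g"
  shows "comp_int (\<lambda>x. f x + g x)"
proof -
  obtain R S where "\<And>x. f x \<noteq> 0 \<Longrightarrow> norm x \<le> R" "\<And>x. g x \<noteq> 0 \<Longrightarrow> norm x \<le> S"
    using assms by (auto simp: comp_int_def)
  then have "norm x \<le> max R S" if "f x + g x \<noteq> 0" for x
    using that by (cases "f x = 0") (auto simp: le_max_iff_disj)
  then show ?thesis using assms by (auto simp: comp_int_def)
qed

lemma comp_int_uminus: "comp_int f \<Longrightarrow> comp_int (\<lambda>x. - f x)"
  by (auto simp: comp_int_def)

lemma comp_int_diff:
  assumes "comp_int f" "comp_int g"
  shows "comp_int (\<lambda>x. f x - g x)"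
  using comp_int_add[OF assms(1) comp_int_uminus[OF assms(2)]] by simp

text \<open>On the supports of \<open>f\<close> and \<open>g\<close> the difference
  \<open>y - z\<close> stays in a fixed ball, where the smooth \<open>k\<close> is bounded. This is
  the benefit of the regularisation: double integrals with \<open>kern e\<close>, its derivatives or
  \<open>delta e\<close> converge absolutely.\<close>

lemma comp_int_kernel_integrable:
  fixes f g :: "real ^ 'N \<Rightarrow> complex"
  assumes f: "comp_int f" and g: "comp_int g" and k: "smooth k"
  shows "integrable (lborel \<Otimes>\<^sub>M lborel) (\<lambda>(y, z). f y * k (y - z) * g z)"
proof -
  obtain R S where RS: "\<And>x. f x \<noteq> 0 \<Longrightarrow> norm x \<le> R" "\<And>x. g x \<noteq> 0 \<Longrightarrow> norm x \<le> S"
    and int: "integrable lborel f" "integrable lborel g"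
    using assms by (auto simp: comp_int_def)
  have "bounded (k ` cball 0 (R + S))"
    by (intro compact_imp_bounded compact_continuous_image smooth_continuous_on[OF k]) simp
  then obtain B where B: "\<And>x. norm x \<le> R + S \<Longrightarrow> norm (k x) \<le> B" unfolding bounded_iff by fastforce
  have [measurable]: "k \<in> borel_measurable borel" "f \<in> borel_measurable borel" "g \<in> borel_measurable borel"
    using smooth_borel[OF k] int[THEN borel_measurable_integrable] by auto
  have "integrable (lborel \<Otimes>\<^sub>M lborel) (\<lambda>(y, z). of_real B * (f y * g z))"
  proof (rule lborel_pair.Fubini_integrable)
    show "AE y in lborel. integrable lborel (\<lambda>z. case (y, z) of (y, z) \<Rightarrow> of_real B * (f y * g z))"
      using int by simp
    have "(LINT z|lborel. norm (case (y, z) of (y, z) \<Rightarrow> of_real B * (f y * g z))) = (\<bar>B\<bar> * (LINT z|lborel. norm (g z))) * norm (f y)" for y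
      by (simp add: norm_mult mult_ac)
    then show "integrable lborel (\<lambda>y. LINT z|lborel. norm (case (y, z) of (y, z) \<Rightarrow> of_real B * (f y * g z)))"
      using int by simp
  qed measurable
  then show ?thesis
  proof (rule Bochner_Integration.integrable_bound)
    show "AE x in lborel \<Otimes>\<^sub>M lborel. norm (case x of (y, z) \<Rightarrow> f y * k (y - z) * g z)
       \<le> norm (case x of (y, z) \<Rightarrow> of_real B * (f y * g z))"
    proof (rule AE_I2, safe)
      fix y z
      show "norm (f y * k (y - z) * g z) \<le> norm (of_real B * (f y * g z))"
      proof (cases "f y = 0 \<or> g z = 0")
        case False
        then have "norm (y - z) \<le> R + S"
          using RS(1)[of y] RS(2)[of z] norm_triangle_ineq4[of y z] by auto
        then have "norm (k (y - z)) \<le> \<bar>B\<bar>" using B[of "y - z"] by linarith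
        then have "norm (k (y - z)) * norm (f y * g z) \<le> \<bar>B\<bar> * norm (f y * g z)"
          by (rule mult_right_mono) simp
        then show ?thesis by (simp add: norm_mult mult_ac)
      qed auto
    qed
  qed measurable
qed

lemma
  fixes f g :: "real ^ 'N \<Rightarrow> complex"
  assumes "comp_int f" "comp_int g" "smooth k"
  shows comp_int_kernel_integrable_fst: "integrable lborel (\<lambda>y. LINT z|lborel. f y * k (y - z) * g z)"
    and comp_int_kernel_integrable_snd: "integrable lborel (\<lambda>z. LINT y|lborel. f y * k (y - z) * g z)"
    and comp_int_kernel_swap: "(LINT y|lborel. LINT z|lborel. f y * k (y - z) * g z) = (LINT z|lborel. LINT y|lborel. f y * k (y - z) * g z)"
  using lborel_pair.integrable_fst[OF comp_int_kernel_integrable[OF assms]]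
    lborel_pair.integrable_snd[OF comp_int_kernel_integrable[OF assms]]
    lborel_pair.Fubini_integral[OF comp_int_kernel_integrable[OF assms]] by auto

context elliptic begin

definition div_free :: "(real ^ 'N \<Rightarrow> complex ^ 'n) \<Rightarrow> bool" where
  "div_free V \<longleftrightarrow> (\<forall>\<eta>. test_function \<eta> \<longrightarrow> (\<Sum>j\<in>UNIV. LINT y|lborel. V y $ j * vf_deriv (m $ j) \<eta> y) = 0)"

text \<open>The weak form of \<open>m\<^sub>i w\<^sub>j - m\<^sub>j w\<^sub>i =
  g\<^sub>i\<^sub>j\<close>; the minus sign comes from moving the derivatives onto \<eta>.\<close>

definition weak_curl :: "(real ^ 'N \<Rightarrow> complex ^ 'n) \<Rightarrow> (real ^ 'N \<Rightarrow> complex ^ 'n ^ 'n) \<Rightarrow> bool" where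
  "weak_curl w g \<longleftrightarrow> (\<forall>\<eta> i j. test_function \<eta> \<longrightarrow>
     (LINT z|lborel. w z $ j * vf_deriv (m $ i) \<eta> z) - (LINT z|lborel. w z $ i * vf_deriv (m $ j) \<eta> z)
       = - (LINT z|lborel. g z $ i $ j * \<eta> z))"

lemma vf_deriv_kern_left:
  assumes "e > 0" "smooth \<psi>"
  shows "vf_deriv a (\<lambda>z. kern e i (y - z) * \<psi> z) z = - vf_deriv a (kern e i) (y - z) * \<psi> z + kern e i (y - z) * vf_deriv a \<psi> z"
    and "smooth (\<lambda>z. kern e i (y - z))"
proof -
  show sm: "smooth (\<lambda>z. kern e i (y - z))"
    using smooth_affine[OF smooth_kern[OF assms(1), of i], of y "-1"] by simp
  show "vf_deriv a (\<lambda>z. kern e i (y - z) * \<psi> z) z = - vf_deriv a (kern e i) (y - z) * \<psi> z + kern e i (y - z) * vf_deriv a \<psi> z"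
    using vf_deriv_affine[OF smooth_kern[OF assms(1), of i], of a y "-1" z]
    by (simp add: vf_deriv_mult[OF sm assms(2)])
qed

lemma vf_deriv_kern_right:
  assumes "e > 0" "smooth \<psi>"
  shows "vf_deriv a (\<lambda>y. \<psi> y * kern e i (y - z)) y = vf_deriv a \<psi> y * kern e i (y - z) + \<psi> y * vf_deriv a (kern e i) (y - z)"
    and "smooth (\<lambda>y. kern e i (y - z))"
proof -
  show sm: "smooth (\<lambda>y. kern e i (y - z))"
    using smooth_affine[OF smooth_kern[OF assms(1), of i], of "- z" 1] by simp
  show "vf_deriv a (\<lambda>y. \<psi> y * kern e i (y - z)) y = vf_deriv a \<psi> y * kern e i (y - z) + \<psi> y * vf_deriv a (kern e i) (y - z)"
    using vf_deriv_affine[OF smooth_kern[OF assms(1), of i], of a "- z" 1 y]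
    by (simp add: vf_deriv_mult[OF assms(2) sm])
qed

text \<open>The curl of \<open>w\<close> converts \<open>\<Sum>i. L\<^sub>i k\<^sub>i * (\<psi> w\<^sub>j)\<close>, which approximates \<open>\<psi> w\<^sub>j\<close>, into a gradient
  \<open>L\<^sub>j (\<Sum>i. k\<^sub>i * (\<psi> w\<^sub>i))\<close> and terms in which no derivative falls on the kernel.\<close>

lemma mollified_decomposition:
  assumes e: "e > 0" and \<psi>: "test_function \<psi>" and w: "\<And>j. loc_int (\<lambda>x. w x $ j)" and g: "\<And>i j. loc_int (\<lambda>x. g x $ i $ j)"
    and curl: "weak_curl w g"
  shows "(LINT z|lborel. of_real (delta e (y - z)) * (w z $ j * \<psi> z)) =
    (\<Sum>i\<in>UNIV. (LINT z|lborel. kern e i (y - z) * (w z $ j * vf_deriv (m $ i) \<psi> z - w z $ i * vf_deriv (m $ j) \<psi> z + g z $ i $ j * \<psi> z))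
      + (LINT z|lborel. vf_deriv (m $ j) (kern e i) (y - z) * (w z $ i * \<psi> z)))"
proof -
  note sm = smooth_kern[OF e] vf_deriv_kern_left(2)[OF e test_function_smooth[OF \<psi>]]
  have smD: "smooth (\<lambda>z. vf_deriv a (kern e i) (y - z))" for a i
    using smooth_affine[OF smooth_vf_deriv[OF sm(1)[of i], of a], of y "-1"] by simp
  have int: "integrable lborel (\<lambda>z. k z * (f z * h z))" if "smooth k" "loc_int f" "test_function h" for k f h
  proof -
    have "integrable lborel (\<lambda>z. f z * (k z * h z))"
      using that test_function_mult'[OF that(1,3)] unfolding loc_int_def by blast
    then show ?thesis by (simp add: mult_ac)
  qed
  have int1: "integrable lborel (\<lambda>z. kern e i (y - z) * (w z $ l * vf_deriv a \<psi> z))"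
    and int2: "integrable lborel (\<lambda>z. vf_deriv a (kern e i) (y - z) * (w z $ l * \<psi> z))"
    and int3: "integrable lborel (\<lambda>z. kern e i (y - z) * (g z $ i $ j * \<psi> z))" for i l a
    by (intro int sm smD w g \<psi> test_function_vf_deriv)+
  have swap: "(LINT z|lborel. w z $ l * vf_deriv a (\<lambda>z. kern e i (y - z) * \<psi> z) z)
     = (LINT z|lborel. kern e i (y - z) * (w z $ l * vf_deriv a \<psi> z)) - (LINT z|lborel. vf_deriv a (kern e i) (y - z) * (w z $ l * \<psi> z))" for i l a
    by (subst Bochner_Integration.integral_diff[symmetric, OF int1 int2], rule Bochner_Integration.integral_cong, rule refl,
        simp only: vf_deriv_kern_left(1)[OF e test_function_smooth[OF \<psi>]]) (simp add: algebra_simps)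
  \<comment> \<open>The weak curl is tested with \<open>kern e i (y - z) * \<psi> z\<close> as a
    function of \<open>z\<close>. This exchanges \<open>i\<close> and \<open>j\<close> between the
    derivative and the field, at the cost of terms with an undifferentiated kernel.\<close>
  have each: "(LINT z|lborel. vf_deriv (m $ i) (kern e i) (y - z) * (w z $ j * \<psi> z)) =
     (LINT z|lborel. kern e i (y - z) * (w z $ j * vf_deriv (m $ i) \<psi> z - w z $ i * vf_deriv (m $ j) \<psi> z + g z $ i $ j * \<psi> z))
      + (LINT z|lborel. vf_deriv (m $ j) (kern e i) (y - z) * (w z $ i * \<psi> z))" for i
  proof -
    have "test_function (\<lambda>z. kern e i (y - z) * \<psi> z)"
      by (intro test_function_mult' sm \<psi>)
    then have c1: "(LINT z|lborel. w z $ j * vf_deriv (m $ i) (\<lambda>z. kern e i (y - z) * \<psi> z) z)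
       - (LINT z|lborel. w z $ i * vf_deriv (m $ j) (\<lambda>z. kern e i (y - z) * \<psi> z) z)
       = - (LINT z|lborel. g z $ i $ j * (kern e i (y - z) * \<psi> z))"
      using curl unfolding weak_curl_def by blast
    have c2: "(LINT z|lborel. g z $ i $ j * (kern e i (y - z) * \<psi> z)) = (LINT z|lborel. kern e i (y - z) * (g z $ i $ j * \<psi> z))"
      by (simp add: mult_ac)
    have c3: "(LINT z|lborel. kern e i (y - z) * (w z $ j * vf_deriv (m $ i) \<psi> z - w z $ i * vf_deriv (m $ j) \<psi> z + g z $ i $ j * \<psi> z))
      = (LINT z|lborel. kern e i (y - z) * (w z $ j * vf_deriv (m $ i) \<psi> z)) - (LINT z|lborel. kern e i (y - z) * (w z $ i * vf_deriv (m $ j) \<psi> z))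
        + (LINT z|lborel. kern e i (y - z) * (g z $ i $ j * \<psi> z))"
      unfolding distrib_left right_diff_distrib
      by (simp add: int1 int3)
    have "T1 = X + T2" if "(S1 - T1) - (S2 - T2) = - G" "G = G'" "X = S1 - S2 + G'" for S1 T1 S2 T2 G G' X :: complex
      using that by algebra
    from this[OF c1[unfolded swap] c2 c3] show ?thesis .
  qed
  have "(LINT z|lborel. of_real (delta e (y - z)) * (w z $ j * \<psi> z))
     = (LINT z|lborel. (\<Sum>i\<in>UNIV. vf_deriv (m $ i) (kern e i) (y - z) * (w z $ j * \<psi> z)))"
    by (simp add: kern_divergence[OF e, symmetric] sum_distrib_right)
  also have "\<dots> = (\<Sum>i\<in>UNIV. LINT z|lborel. vf_deriv (m $ i) (kern e i) (y - z) * (w z $ j * \<psi> z))"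
    by (rule Bochner_Integration.integral_sum) (rule int2)
  finally show ?thesis unfolding each .
qed

text \<open>The decomposition of \<psi>2 \<open>w\<close> is paired with \<psi>1 \<open>V\<close>.
  In the gradient part the derivative of the kernel is read as one in \<open>y\<close>; after
  summation over \<open>j\<close> it moves to \<psi>1 because \<open>V\<close> is divergence free.
  No kernel is differentiated on the right side.\<close>

lemma mollified_pairing:
  assumes e: "e > 0" and \<psi>: "test_function \<psi>1" "test_function \<psi>2"
    and V: "\<And>j. loc_int (\<lambda>x. V x $ j)" and w: "\<And>j. loc_int (\<lambda>x. w x $ j)" and g: "\<And>i j. loc_int (\<lambda>x. g x $ i $ j)"
    and curl: "weak_curl w g" and div: "div_free V"
  shows "(\<Sum>j\<in>UNIV. LINT y|lborel. LINT z|lborel. (V y $ j * \<psi>1 y) * of_real (delta e (y - z)) * (w z $ j * \<psi>2 z)) =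
    (\<Sum>j\<in>UNIV. \<Sum>i\<in>UNIV. LINT y|lborel. LINT z|lborel. (V y $ j * \<psi>1 y) * kern e i (y - z) *
       (w z $ j * vf_deriv (m $ i) \<psi>2 z - w z $ i * vf_deriv (m $ j) \<psi>2 z + g z $ i $ j * \<psi>2 z))
    - (\<Sum>i\<in>UNIV. LINT z|lborel. (\<Sum>j\<in>UNIV. LINT y|lborel. (V y $ j * vf_deriv (m $ j) \<psi>1 y) * kern e i (y - z) * (w z $ i * \<psi>2 z)))"
proof -
  let ?f = "\<lambda>j y. V y $ j * \<psi>1 y" and ?h = "\<lambda>i z. w z $ i * \<psi>2 z"
  let ?X = "\<lambda>i j z. w z $ j * vf_deriv (m $ i) \<psi>2 z - w z $ i * vf_deriv (m $ j) \<psi>2 z + g z $ i $ j * \<psi>2 z"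
  note sm = smooth_kern[OF e]
  have f: "comp_int (?f j)" and h: "comp_int (?h i)" and X: "comp_int (?X i j)" for i j
    by (intro comp_int_mult comp_int_add comp_int_diff V w g \<psi> test_function_vf_deriv)+
  have f': "comp_int (\<lambda>y. V y $ j * vf_deriv a \<psi>1 y)" for j a
    by (intro comp_int_mult V test_function_vf_deriv \<psi>)
  have step: "(LINT y|lborel. LINT z|lborel. ?f j y * of_real (delta e (y - z)) * ?h j z)
     = (\<Sum>i\<in>UNIV. (LINT y|lborel. LINT z|lborel. ?f j y * kern e i (y - z) * ?X i j z) +
         (LINT y|lborel. LINT z|lborel. ?f j y * vf_deriv (m $ j) (kern e i) (y - z) * ?h i z))" for j
  proof -
    have "(LINT z|lborel. ?f j y * of_real (delta e (y - z)) * ?h j z)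
      = (\<Sum>i\<in>UNIV. (LINT z|lborel. ?f j y * kern e i (y - z) * ?X i j z) +
         (LINT z|lborel. ?f j y * vf_deriv (m $ j) (kern e i) (y - z) * ?h i z))" for y
      unfolding mult.assoc[of "?f j y"] integral_mult_right_zero
      by (subst mollified_decomposition[OF e \<psi>(2) w g curl]) (simp only: sum_distrib_left distrib_left)
    then have "(LINT y|lborel. LINT z|lborel. ?f j y * of_real (delta e (y - z)) * ?h j z)
      = (LINT y|lborel. (\<Sum>i\<in>UNIV. (LINT z|lborel. ?f j y * kern e i (y - z) * ?X i j z) +
         (LINT z|lborel. ?f j y * vf_deriv (m $ j) (kern e i) (y - z) * ?h i z)))" by (simp only:)
    also have "\<dots> = (\<Sum>i\<in>UNIV. LINT y|lborel. (LINT z|lborel. ?f j y * kern e i (y - z) * ?X i j z) +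
         (LINT z|lborel. ?f j y * vf_deriv (m $ j) (kern e i) (y - z) * ?h i z))"
      by (intro Bochner_Integration.integral_sum Bochner_Integration.integrable_add
        comp_int_kernel_integrable_fst f h X sm smooth_vf_deriv)
    also have "\<dots> = (\<Sum>i\<in>UNIV. (LINT y|lborel. LINT z|lborel. ?f j y * kern e i (y - z) * ?X i j z) +
         (LINT y|lborel. LINT z|lborel. ?f j y * vf_deriv (m $ j) (kern e i) (y - z) * ?h i z))"
      by (intro sum.cong refl Bochner_Integration.integral_add
        comp_int_kernel_integrable_fst f h X sm smooth_vf_deriv)
    finally show ?thesis .
  qed
  have second: "(\<Sum>j\<in>UNIV. LINT y|lborel. LINT z|lborel. ?f j y * vf_deriv (m $ j) (kern e i) (y - z) * ?h i z)
    = - (LINT z|lborel. (\<Sum>j\<in>UNIV. LINT y|lborel. (V y $ j * vf_deriv (m $ j) \<psi>1 y) * kern e i (y - z) * ?h i z))" for i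
  proof -
    have "(\<Sum>j\<in>UNIV. LINT y|lborel. LINT z|lborel. ?f j y * vf_deriv (m $ j) (kern e i) (y - z) * ?h i z)
      = (\<Sum>j\<in>UNIV. LINT z|lborel. LINT y|lborel. ?f j y * vf_deriv (m $ j) (kern e i) (y - z) * ?h i z)"
      by (intro sum.cong refl comp_int_kernel_swap f h smooth_vf_deriv sm)
    also have "\<dots> = (LINT z|lborel. (\<Sum>j\<in>UNIV. LINT y|lborel. ?f j y * vf_deriv (m $ j) (kern e i) (y - z) * ?h i z))"
      by (intro Bochner_Integration.integral_sum[symmetric] comp_int_kernel_integrable_snd f h smooth_vf_deriv sm)
    also have "\<dots> = (LINT z|lborel. - (\<Sum>j\<in>UNIV. LINT y|lborel. (V y $ j * vf_deriv (m $ j) \<psi>1 y) * kern e i (y - z) * ?h i z))"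
    proof (rule Bochner_Integration.integral_cong[OF refl])
      fix z
      have smz: "smooth (\<lambda>y. kern e i (y - z))" "smooth (\<lambda>y. vf_deriv a (kern e i) (y - z))" for a
        using smooth_affine[OF sm[of i], of "- z" 1] smooth_affine[OF smooth_vf_deriv[OF sm[of i], of a], of "- z" 1] by simp_all
      have int: "integrable lborel (\<lambda>y. f y * h y * k y)" if "smooth k" "loc_int f" "test_function h" for k f h
      proof -
        have "integrable lborel (\<lambda>y. f y * (k y * h y))"
          using that test_function_mult'[OF that(1,3)] unfolding loc_int_def by blast
        then show ?thesis by (simp add: mult_ac)
      qed
      \<comment> \<open>The divergence condition is tested with the kernel times \<psi>1, for fixed
        \<open>z\<close>; the product rule then trades the two derivatives.\<close>
      have "test_function (\<lambda>y. \<psi>1 y * kern e i (y - z))"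
        by (intro test_function_mult \<psi> smz)
      then have "0 = (\<Sum>j\<in>UNIV. LINT y|lborel. V y $ j * vf_deriv (m $ j) (\<lambda>y. \<psi>1 y * kern e i (y - z)) y)"
        using div unfolding div_free_def by simp
      also have "\<dots> = (\<Sum>j\<in>UNIV. LINT y|lborel. V y $ j * vf_deriv (m $ j) \<psi>1 y * kern e i (y - z) + ?f j y * vf_deriv (m $ j) (kern e i) (y - z))"
        by (simp add: vf_deriv_kern_right(1)[OF e test_function_smooth[OF \<psi>(1)]] algebra_simps)
      also have "\<dots> = (\<Sum>j\<in>UNIV. (LINT y|lborel. V y $ j * vf_deriv (m $ j) \<psi>1 y * kern e i (y - z))
          + (LINT y|lborel. ?f j y * vf_deriv (m $ j) (kern e i) (y - z)))"
        by (intro sum.cong refl Bochner_Integration.integral_add int smz V \<psi> test_function_vf_deriv)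
      finally have "(\<Sum>j\<in>UNIV. LINT y|lborel. ?f j y * vf_deriv (m $ j) (kern e i) (y - z))
          = - (\<Sum>j\<in>UNIV. LINT y|lborel. V y $ j * vf_deriv (m $ j) \<psi>1 y * kern e i (y - z))"
        by (simp add: sum.distrib eq_neg_iff_add_eq_0 add.commute)
      from arg_cong[OF this, of "\<lambda>s. s * ?h i z"]
      show "(\<Sum>j\<in>UNIV. LINT y|lborel. ?f j y * vf_deriv (m $ j) (kern e i) (y - z) * ?h i z)
         = - (\<Sum>j\<in>UNIV. LINT y|lborel. (V y $ j * vf_deriv (m $ j) \<psi>1 y) * kern e i (y - z) * ?h i z)"
        by (simp only: integral_mult_left_zero sum_distrib_right[symmetric] mult_minus_left)
    qed
    finally show ?thesis by simp
  qed
  have "(\<Sum>j\<in>UNIV. LINT y|lborel. LINT z|lborel. ?f j y * of_real (delta e (y - z)) * ?h j z)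
    = (\<Sum>j\<in>UNIV. \<Sum>i\<in>UNIV. LINT y|lborel. LINT z|lborel. ?f j y * kern e i (y - z) * ?X i j z)
      + (\<Sum>i\<in>UNIV. \<Sum>j\<in>UNIV. LINT y|lborel. LINT z|lborel. ?f j y * vf_deriv (m $ j) (kern e i) (y - z) * ?h i z)"
    unfolding step sum.distrib by (subst (3) sum.swap) (rule refl)
  then show ?thesis by (simp only: second sum_negf) simp
qed

text \<open>Every term of the preceding identity is estimated in absolute value, with the kernel
  bounded by \<open>K * riesz\<close>; the constant is therefore the same for all \<open>e\<close>
  and survives the limit.\<close>

lemma mollified_pairing_bound:
  obtains C where "C > 0" "\<And>e \<psi>1 \<psi>2 V w g B. e > 0 \<Longrightarrow> test_function \<psi>1 \<Longrightarrow> test_function \<psi>2 \<Longrightarrow>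
    V \<in> borel_measurable borel \<Longrightarrow> w \<in> borel_measurable borel \<Longrightarrow> g \<in> borel_measurable borel \<Longrightarrow>
    (\<And>j. loc_int (\<lambda>x. V x $ j)) \<Longrightarrow> (\<And>j. loc_int (\<lambda>x. w x $ j)) \<Longrightarrow> (\<And>i j. loc_int (\<lambda>x. g x $ i $ j)) \<Longrightarrow>
    weak_curl w g \<Longrightarrow> div_free V \<Longrightarrow> B \<ge> 0 \<Longrightarrow>
    (\<And>x. norm (\<psi>1 x) \<le> B * weight x) \<Longrightarrow> (\<And>x. norm (\<psi>2 x) \<le> B * weight x) \<Longrightarrow>
    (\<And>x j. norm (vf_deriv (m $ j) \<psi>1 x) \<le> B * weight x) \<Longrightarrow> (\<And>x j. norm (vf_deriv (m $ j) \<psi>2 x) \<le> B * weight x) \<Longrightarrow>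
    ennreal (norm (\<Sum>j\<in>UNIV. LINT y|lborel. LINT z|lborel. (V y $ j * \<psi>1 y) * of_real (delta e (y - z)) * (w z $ j * \<psi>2 z)))
     \<le> ennreal (C * B\<^sup>2) * (\<integral>\<^sup>+y. \<integral>\<^sup>+z. ennreal (weight y * weight z * (norm (V y) * (norm (w z) + norm (g z)) * riesz (y - z))) \<partial>lborel \<partial>lborel)"
proof -
  obtain K where K: "K > 0" "\<And>e i x. e > 0 \<Longrightarrow> norm (kern e i x) \<le> K * riesz x"
    using kern_bound by blast
  let ?n = "real CARD('n)"
  \<comment> \<open>A share \<open>2 * ?n\<^sup>2 * K\<close> comes from the terms that contain
    \<psi>2, its derivatives and \<open>g\<close> next to an undifferentiated \<psi>1, and
    \<open>?n\<^sup>2 * K\<close> from those with \<psi>1 differentiated.\<close>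
  define C where "C = 3 * ?n\<^sup>2 * K"
  have C: "C > 0" using K(1) by (simp add: C_def)
  show thesis
  proof (rule that[OF C])
    fix e B :: real and \<psi>1 \<psi>2 V w g
    assume e: "e > 0" and \<psi>: "test_function \<psi>1" "test_function \<psi>2"
      and [measurable]: "V \<in> borel_measurable borel" "w \<in> borel_measurable borel" "g \<in> borel_measurable borel"
      and V: "\<And>j. loc_int (\<lambda>x. V x $ j)" and w: "\<And>j. loc_int (\<lambda>x. w x $ j)" and g: "\<And>i j. loc_int (\<lambda>x. g x $ i $ j)"
      and curl: "weak_curl w g" and div: "div_free V" and B: "B \<ge> 0"
      and \<psi>B: "\<And>x. norm (\<psi>1 x) \<le> B * weight x" "\<And>x. norm (\<psi>2 x) \<le> B * weight x"
        "\<And>x j. norm (vf_deriv (m $ j) \<psi>1 x) \<le> B * weight x" "\<And>x j. norm (vf_deriv (m $ j) \<psi>2 x) \<le> B * weight x"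
    let ?b = "\<lambda>y z. weight y * weight z * (norm (V y) * (norm (w z) + norm (g z)) * riesz (y - z))"
    let ?I = "(\<integral>\<^sup>+y. \<integral>\<^sup>+z. ennreal (?b y z) \<partial>lborel \<partial>lborel)"
    have nn: "?b y z \<ge> 0" for y z
      using weight_pos[of y] weight_pos[of z] riesz_nonneg[of "y - z"] by simp
    have tbound: "norm (a * kern e i (y - z) * b) \<le> c * B\<^sup>2 * K * ?b y z"
      if a: "norm a \<le> norm (V y) * (B * weight y)" and b: "norm b \<le> c * (B * weight z) * (norm (w z) + norm (g z))" and c: "c \<ge> 0" for a b c i y z
    proof -
      have "norm (a * kern e i (y - z) * b) \<le> (norm (V y) * (B * weight y)) * (K * riesz (y - z)) * (c * (B * weight z) * (norm (w z) + norm (g z)))"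
        unfolding norm_mult using a b c B K(1) weight_pos[of y] riesz_nonneg[of "y - z"]
        by (intro mult_mono K(2) e) auto
      then show ?thesis by (simp add: power2_eq_square mult_ac)
    qed
    have comp: "cmod (V y $ j) \<le> norm (V y)" "cmod (w y $ j) \<le> norm (w y)" "cmod (g y $ i $ j) \<le> norm (g y)" for y i j
      by (rule Finite_Cartesian_Product.norm_nth_le Finite_Cartesian_Product.norm_nth_le[THEN order_trans])+
    have 1: "ennreal (norm (LINT y|lborel. LINT z|lborel. (V y $ j * \<psi>1 y) * kern e i (y - z) *
       (w z $ j * vf_deriv (m $ i) \<psi>2 z - w z $ i * vf_deriv (m $ j) \<psi>2 z + g z $ i $ j * \<psi>2 z))) \<le> ennreal (2 * B\<^sup>2 * K) * ?I" for i j
    proof -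
      have "ennreal (norm (LINT y|lborel. LINT z|lborel. (V y $ j * \<psi>1 y) * kern e i (y - z) *
           (w z $ j * vf_deriv (m $ i) \<psi>2 z - w z $ i * vf_deriv (m $ j) \<psi>2 z + g z $ i $ j * \<psi>2 z)))
        \<le> (\<integral>\<^sup>+y. \<integral>\<^sup>+z. ennreal (norm ((V y $ j * \<psi>1 y) * kern e i (y - z) *
           (w z $ j * vf_deriv (m $ i) \<psi>2 z - w z $ i * vf_deriv (m $ j) \<psi>2 z + g z $ i $ j * \<psi>2 z))) \<partial>lborel \<partial>lborel)"
        by (rule order_trans[OF ennreal_norm_integral_le nn_integral_mono]) (rule ennreal_norm_integral_le)
      also have "\<dots> \<le> (\<integral>\<^sup>+y. \<integral>\<^sup>+z. ennreal (2 * B\<^sup>2 * K) * ennreal (?b y z) \<partial>lborel \<partial>lborel)"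
      proof (intro nn_integral_mono)
        fix y z
        have "norm (w z $ j * vf_deriv (m $ i) \<psi>2 z - w z $ i * vf_deriv (m $ j) \<psi>2 z + g z $ i $ j * \<psi>2 z)
          \<le> norm (w z $ j * vf_deriv (m $ i) \<psi>2 z) + norm (w z $ i * vf_deriv (m $ j) \<psi>2 z) + norm (g z $ i $ j * \<psi>2 z)"
          by (meson add_right_mono norm_triangle_ineq norm_triangle_ineq4 order_trans)
        also have "\<dots> \<le> norm (w z) * (B * weight z) + norm (w z) * (B * weight z) + norm (g z) * (B * weight z)"
          unfolding norm_mult by (intro add_mono mult_mono comp \<psi>B) auto
        also have "\<dots> \<le> 2 * (B * weight z) * (norm (w z) + norm (g z))"
          using B weight_pos[of z] by (simp add: algebra_simps)
        finally have "norm ((V y $ j * \<psi>1 y) * kern e i (y - z) *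
           (w z $ j * vf_deriv (m $ i) \<psi>2 z - w z $ i * vf_deriv (m $ j) \<psi>2 z + g z $ i $ j * \<psi>2 z)) \<le> 2 * B\<^sup>2 * K * ?b y z"
          by (intro tbound) (auto simp: norm_mult intro!: mult_mono comp \<psi>B)
        then show "ennreal (norm ((V y $ j * \<psi>1 y) * kern e i (y - z) *
           (w z $ j * vf_deriv (m $ i) \<psi>2 z - w z $ i * vf_deriv (m $ j) \<psi>2 z + g z $ i $ j * \<psi>2 z)))
           \<le> ennreal (2 * B\<^sup>2 * K) * ennreal (?b y z)"
          using nn[of y z] by (simp add: ennreal_mult''[symmetric] ennreal_leI)
      qed
      also have "\<dots> = ennreal (2 * B\<^sup>2 * K) * ?I"
        by (simp add: nn_integral_cmult)
      finally show ?thesis .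
    qed
    have 2: "ennreal (norm (LINT z|lborel. (\<Sum>j\<in>UNIV. LINT y|lborel. (V y $ j * vf_deriv (m $ j) \<psi>1 y) * kern e i (y - z) * (w z $ i * \<psi>2 z))))
       \<le> ennreal (?n * (B\<^sup>2 * K)) * ?I" for i
    proof -
      have "ennreal (norm (LINT z|lborel. (\<Sum>j\<in>UNIV. LINT y|lborel. (V y $ j * vf_deriv (m $ j) \<psi>1 y) * kern e i (y - z) * (w z $ i * \<psi>2 z))))
        \<le> (\<integral>\<^sup>+z. ennreal (norm (\<Sum>j\<in>UNIV. LINT y|lborel. (V y $ j * vf_deriv (m $ j) \<psi>1 y) * kern e i (y - z) * (w z $ i * \<psi>2 z))) \<partial>lborel)"
        by (rule ennreal_norm_integral_le)
      also have "\<dots> \<le> (\<integral>\<^sup>+z. (\<Sum>j\<in>(UNIV :: 'n set). \<integral>\<^sup>+y. ennreal (B\<^sup>2 * K) * ennreal (?b y z) \<partial>lborel) \<partial>lborel)"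
      proof (rule nn_integral_mono)
        fix z
        have "ennreal (norm (\<Sum>j\<in>UNIV. LINT y|lborel. (V y $ j * vf_deriv (m $ j) \<psi>1 y) * kern e i (y - z) * (w z $ i * \<psi>2 z)))
          \<le> (\<Sum>j\<in>UNIV. ennreal (norm (LINT y|lborel. (V y $ j * vf_deriv (m $ j) \<psi>1 y) * kern e i (y - z) * (w z $ i * \<psi>2 z))))"
          by (subst sum_ennreal) (auto intro!: ennreal_leI norm_sum)
        also have "\<dots> \<le> (\<Sum>j\<in>(UNIV :: 'n set). \<integral>\<^sup>+y. ennreal (B\<^sup>2 * K) * ennreal (?b y z) \<partial>lborel)"
        proof (intro sum_mono order_trans[OF ennreal_norm_integral_le nn_integral_mono])
          fix j y
          have "norm (w z $ i * \<psi>2 z) \<le> norm (w z) * (B * weight z)"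
            unfolding norm_mult by (intro mult_mono comp \<psi>B) auto
          also have "\<dots> \<le> 1 * (B * weight z) * (norm (w z) + norm (g z))"
            using B weight_pos[of z] by (simp add: algebra_simps)
          finally have "norm ((V y $ j * vf_deriv (m $ j) \<psi>1 y) * kern e i (y - z) * (w z $ i * \<psi>2 z)) \<le> 1 * B\<^sup>2 * K * ?b y z"
            by (intro tbound) (auto simp: norm_mult intro!: mult_mono comp \<psi>B)
          then show "ennreal (norm ((V y $ j * vf_deriv (m $ j) \<psi>1 y) * kern e i (y - z) * (w z $ i * \<psi>2 z))) \<le> ennreal (B\<^sup>2 * K) * ennreal (?b y z)"
            using nn[of y z] by (simp add: ennreal_mult''[symmetric] ennreal_leI)
        qed
        finally show "ennreal (norm (\<Sum>j\<in>UNIV. LINT y|lborel. (V y $ j * vf_deriv (m $ j) \<psi>1 y) * kern e i (y - z) * (w z $ i * \<psi>2 z)))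
          \<le> (\<Sum>j\<in>(UNIV :: 'n set). \<integral>\<^sup>+y. ennreal (B\<^sup>2 * K) * ennreal (?b y z) \<partial>lborel)" .
      qed
      also have "\<dots> = ennreal ?n * (ennreal (B\<^sup>2 * K) * (\<integral>\<^sup>+z. \<integral>\<^sup>+y. ennreal (?b y z) \<partial>lborel \<partial>lborel))"
        by (simp add: nn_integral_cmult ennreal_of_nat_eq_real_of_nat)
      also have "(\<integral>\<^sup>+z. \<integral>\<^sup>+y. ennreal (?b y z) \<partial>lborel \<partial>lborel) = ?I"
        by (rule lborel_pair.Fubini') (unfold split_beta', measurable)
      finally show ?thesis using K(1) by (simp add: ennreal_mult mult.assoc)
    qed
    have "ennreal (norm (\<Sum>j\<in>UNIV. LINT y|lborel. LINT z|lborel. (V y $ j * \<psi>1 y) * of_real (delta e (y - z)) * (w z $ j * \<psi>2 z)))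
      \<le> (\<Sum>j\<in>UNIV. \<Sum>i\<in>UNIV. ennreal (norm (LINT y|lborel. LINT z|lborel. (V y $ j * \<psi>1 y) * kern e i (y - z) *
       (w z $ j * vf_deriv (m $ i) \<psi>2 z - w z $ i * vf_deriv (m $ j) \<psi>2 z + g z $ i $ j * \<psi>2 z))))
    + (\<Sum>i\<in>UNIV. ennreal (norm (LINT z|lborel. (\<Sum>j\<in>UNIV. LINT y|lborel. (V y $ j * vf_deriv (m $ j) \<psi>1 y) * kern e i (y - z) * (w z $ i * \<psi>2 z)))))"
      unfolding mollified_pairing[OF e \<psi> V w g curl div]
      by (simp add: sum_ennreal sum_nonneg ennreal_plus[symmetric] del: ennreal_plus)
         (intro ennreal_leI order_trans[OF norm_triangle_ineq4] add_mono sum_norm_le order_trans[OF norm_sum] sum_mono order_refl)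
    also have "\<dots> \<le> (\<Sum>j\<in>(UNIV::'n set). \<Sum>i\<in>(UNIV::'n set). ennreal (2 * B\<^sup>2 * K) * ?I) + (\<Sum>i\<in>(UNIV::'n set). ennreal (?n * (B\<^sup>2 * K)) * ?I)"
      by (intro add_mono sum_mono 1 2)
    also have "\<dots> = ennreal (?n\<^sup>2 * (2 * B\<^sup>2 * K)) * ?I + ennreal (?n\<^sup>2 * (B\<^sup>2 * K)) * ?I"
    proof -
      have comb: "ennreal a * (ennreal b * ?I) = ennreal (a * b) * ?I" if "a \<ge> 0" "b \<ge> 0" for a b
        using that by (simp add: ennreal_mult mult.assoc)
      have const: "(\<Sum>i\<in>(UNIV :: 'n set). X) = ennreal ?n * X" for X :: ennreal
        by (simp add: ennreal_of_nat_eq_real_of_nat)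
      show ?thesis
        unfolding const using K(1) by (subst comb; simp?)+ (simp add: power2_eq_square mult.assoc)
    qed
    also have "\<dots> = ennreal (C * B\<^sup>2) * ?I"
      using K(1) unfolding distrib_right[symmetric] by (subst ennreal_plus[symmetric]) (auto simp: C_def algebra_simps)
    finally show "ennreal (norm (\<Sum>j\<in>UNIV. LINT y|lborel. LINT z|lborel. (V y $ j * \<psi>1 y) * of_real (delta e (y - z)) * (w z $ j * \<psi>2 z)))
     \<le> ennreal (C * B\<^sup>2) * ?I" .
  qed
qed

end

section \<open>Approximate identities\<close>

lemma powr_add_le:
  fixes a b q :: real
  assumes "a \<ge> 0" "b \<ge> 0" "q > 0"
  shows "(a + b) powr q \<le> 2 powr q * (a powr q + b powr q)"
proof -
  have "(a + b) powr q \<le> (2 * max a b) powr q" by (rule powr_mono2) (use assms in auto)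
  also have "\<dots> = 2 powr q * max a b powr q" using assms by (simp add: powr_mult)
  also have "max a b powr q \<le> a powr q + b powr q" by (simp add: max_def)
  finally show ?thesis by (simp add: mult_left_mono)
qed

lemma nn_integral_powr_add_le:
  fixes f g :: "'a \<Rightarrow> real"
  assumes [measurable]: "f \<in> borel_measurable M" "g \<in> borel_measurable M"
    and "\<And>x. f x \<ge> 0" "\<And>x. g x \<ge> 0" "q > 0"
  shows "(\<integral>\<^sup>+x. ennreal ((f x + g x) powr q) \<partial>M)
    \<le> ennreal (2 powr q) * ((\<integral>\<^sup>+x. ennreal (f x powr q) \<partial>M) + (\<integral>\<^sup>+x. ennreal (g x powr q) \<partial>M))"
proof -
  have "(\<integral>\<^sup>+x. ennreal ((f x + g x) powr q) \<partial>M) \<le> (\<integral>\<^sup>+x. ennreal (2 powr q) * (ennreal (f x powr q) + ennreal (g x powr q)) \<partial>M)"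
  proof (rule nn_integral_mono)
    fix x
    show "ennreal ((f x + g x) powr q) \<le> ennreal (2 powr q) * (ennreal (f x powr q) + ennreal (g x powr q))"
      using ennreal_leI[OF powr_add_le[of "f x" "g x" q]] assms
      by (simp add: ennreal_mult'[symmetric] ennreal_plus[symmetric] del: ennreal_plus)
  qed
  then show ?thesis by (simp add: nn_integral_cmult nn_integral_add)
qed

text \<open>A measurable function is a limit almost everywhere of continuous ones. Clipping their
  values to the disc of radius \<open>n\<close> and multiplying by a continuous cutoff leaves the
  limit unchanged and supplies a dominating function.\<close>

lemma Lp_approx_continuous_bounded:
  fixes H :: "'a::euclidean_space \<Rightarrow> complex"
  assumes [measurable]: "H \<in> borel_measurable borel" and supp: "\<And>x. H x \<noteq> 0 \<Longrightarrow> norm x \<le> R"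
    and bd: "\<And>x. norm (H x) \<le> n" and q: "q > 0" and s: "s > 0"
  shows "\<exists>G B. continuous_on UNIV G \<and> (\<forall>x. norm (G x) \<le> B) \<and> (\<integral>\<^sup>+x. ennreal (norm (H x - G x) powr q) \<partial>lborel) < s"
proof -
  have n: "n \<ge> 0" using bd[of 0] norm_ge_zero order_trans by blast
  have "H measurable_on UNIV"
    by (rule lebesgue_measurable_imp_measurable_on) (auto intro: measurable_completion)
  then obtain N g where N: "negligible N" and g: "\<And>k. continuous_on UNIV (g k)" "\<And>x. x \<notin> N \<Longrightarrow> (\<lambda>k. g k x) \<longlonglongrightarrow> H x"
    unfolding measurable_on_def by auto
  \<comment> \<open>\<open>?\<tau>\<close> is the continuous projection onto the disc and fixes the
    values of \<open>H\<close>; \<open>?c\<close> is 1 on the ball of radius \<open>R\<close> and 0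
    outside that of radius \<open>R + 1\<close>.\<close>
  let ?\<tau> = "closest_point (cball (0::complex) n)"
  let ?c = "\<lambda>x :: 'a. max 0 (min 1 (R + 1 - norm x))"
  define G where "G k x = of_real (?c x) * ?\<tau> (g k x)" for k x
  have \<tau>: "continuous_on UNIV ?\<tau>" using n by (intro continuous_on_closest_point) auto
  have \<tau>n: "norm (?\<tau> z) \<le> n" for z
    using closest_point_in_set[of "cball (0::complex) n" z] n by simp
  have cont: "continuous_on UNIV (G k)" for k
    unfolding G_def by (intro continuous_intros continuous_on_compose2[OF \<tau> g(1)]) auto
  have [measurable]: "G k \<in> borel_measurable borel" for k
    by (rule borel_measurable_continuous_onI[OF cont])
  have Gn: "norm (G k x) \<le> n" for k x
  proof -
    have "norm (G k x) = ?c x * norm (?\<tau> (g k x))" by (simp add: G_def norm_mult)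
    also have "\<dots> \<le> 1 * n" by (intro mult_mono \<tau>n) auto
    finally show ?thesis by simp
  qed
  have lim: "(\<lambda>k. ennreal (norm (H x - G k x) powr q)) \<longlonglongrightarrow> ennreal 0" if "x \<notin> N" for x
  proof -
    have "(\<lambda>k. ?\<tau> (g k x)) \<longlonglongrightarrow> ?\<tau> (H x)"
      using continuous_on_tendsto_compose[OF \<tau> g(2)[OF that]] by simp
    also have "?\<tau> (H x) = H x" by (rule closest_point_self) (use bd in auto)
    finally have "(\<lambda>k. of_real (?c x) * ?\<tau> (g k x)) \<longlonglongrightarrow> of_real (?c x) * H x"
      by (intro tendsto_mult tendsto_const)
    also have "of_real (?c x) * H x = H x" using supp[of x] by (cases "H x = 0") auto
    finally have "(\<lambda>k. G k x) \<longlonglongrightarrow> H x" by (simp add: G_def)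
    then have "(\<lambda>k. norm (H x - G k x)) \<longlonglongrightarrow> 0"
      using tendsto_norm[OF tendsto_diff[OF tendsto_const[of "H x"]]] by fastforce
    then have "(\<lambda>k. norm (H x - G k x) powr q) \<longlonglongrightarrow> 0"
      using q tendsto_zero_powrI[of "\<lambda>k. norm (H x - G k x)" sequentially "\<lambda>_. q" q] by auto
    then show ?thesis by (rule tendsto_ennrealI)
  qed
  have AE_N: "AE x in lborel. x \<notin> N"
    using N AE_not_in[of N lebesgue] by (simp add: negligible_iff_null_sets AE_completion_iff)
  have "(\<lambda>k. \<integral>\<^sup>+x. ennreal (norm (H x - G k x) powr q) \<partial>lborel) \<longlonglongrightarrow> (\<integral>\<^sup>+x. ennreal 0 \<partial>(lborel :: 'a measure))"
  proof (rule nn_integral_dominated_convergence[where w = "\<lambda>x. ennreal ((2 * n) powr q) * indicator (ball 0 (R + 2)) x"])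
    show "AE x in lborel. ennreal (norm (H x - G j x) powr q) \<le> ennreal ((2 * n) powr q) * indicator (ball 0 (R + 2)) x" for j
    proof (rule AE_I2)
      fix x
      show "ennreal (norm (H x - G j x) powr q) \<le> ennreal ((2 * n) powr q) * indicator (ball 0 (R + 2)) x"
      proof (cases "norm x \<le> R + 1")
        case True
        have "norm (H x - G j x) \<le> 2 * n" using norm_triangle_ineq4[of "H x" "G j x"] bd[of x] Gn[of j x] by linarith
        then show ?thesis using True q by (simp add: ennreal_leI powr_mono2)
      next
        case False
        then have "H x = 0" "G j x = 0" using supp[of x] by (auto simp: G_def)
        then show ?thesis by simp
      qed
    qed
    show "(\<integral>\<^sup>+x. ennreal ((2 * n) powr q) * indicator (ball 0 (R + 2)) (x::'a) \<partial>lborel) < \<infinity>"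
      by (subst nn_integral_cmult_indicator) (use emeasure_lborel_ball_finite in \<open>auto simp: ennreal_mult_less_top\<close>)
    show "AE x in lborel. (\<lambda>k. ennreal (norm (H x - G k x) powr q)) \<longlonglongrightarrow> ennreal 0"
      using AE_N by eventually_elim (rule lim)
  qed measurable
  then have "\<forall>\<^sub>F k in sequentially. (\<integral>\<^sup>+x. ennreal (norm (H x - G k x) powr q) \<partial>lborel) < s"
    using s by (intro order_tendstoD(2)) auto
  then obtain k where "(\<integral>\<^sup>+x. ennreal (norm (H x - G k x) powr q) \<partial>lborel) < s"
    by (auto simp: eventually_sequentially)
  then show ?thesis using cont Gn by blast
qed

text \<open>Truncation at height \<open>n\<close> reduces to bounded functions; the discarded part
  tends to 0 by dominated convergence.\<close>

lemma Lp_approx_continuous: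
  fixes H :: "'a::euclidean_space \<Rightarrow> complex"
  assumes [measurable]: "H \<in> borel_measurable borel" and supp: "\<And>x. H x \<noteq> 0 \<Longrightarrow> norm x \<le> R"
    and int: "(\<integral>\<^sup>+x. ennreal (norm (H x) powr q) \<partial>lborel) < top" and q: "q > 0" and s: "s > 0"
  obtains G B where "continuous_on UNIV G" "\<And>x. norm (G x) \<le> B" "(\<integral>\<^sup>+x. ennreal (norm (H x - G x) powr q) \<partial>lborel) < ennreal s"
proof -
  \<comment> \<open>Two errors of size \<open>t\<close>, times the constant \<open>2 powr q\<close>
    of \<open>powr_add_le\<close>, add up to \<open>s\<close>.\<close>
  define t where "t = s / 2 / 2 powr q"
  have t: "t > 0" using s by (simp add: t_def)
  define T where "T n x = (if norm (H x) \<le> real n then H x else 0)" for n :: nat and x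
  have [measurable]: "T n \<in> borel_measurable borel" for n unfolding T_def[abs_def] by measurable
  have "(\<lambda>n. \<integral>\<^sup>+x. ennreal (norm (H x - T n x) powr q) \<partial>lborel) \<longlonglongrightarrow> (\<integral>\<^sup>+x. ennreal 0 \<partial>(lborel :: 'a measure))"
  proof (rule nn_integral_dominated_convergence[where w = "\<lambda>x. ennreal (norm (H x) powr q)"])
    show "AE x in lborel. ennreal (norm (H x - T j x) powr q) \<le> ennreal (norm (H x) powr q)" for j
      by (auto simp: T_def)
    show "AE x in lborel. (\<lambda>n. ennreal (norm (H x - T n x) powr q)) \<longlonglongrightarrow> ennreal 0"
    proof (rule AE_I2)
      fix x
      obtain n0 :: nat where n0: "norm (H x) \<le> n0" using real_arch_simple by blast
      have "norm (H x - T n x) powr q = 0" if "n \<ge> n0" for n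
        using that n0 by (simp add: T_def)
      then have "\<forall>\<^sub>F n in sequentially. ennreal (norm (H x - T n x) powr q) = ennreal 0"
        by (metis (mono_tags) eventually_at_top_linorderI)
      then show "(\<lambda>n. ennreal (norm (H x - T n x) powr q)) \<longlonglongrightarrow> ennreal 0"
        by (rule tendsto_eventually)
    qed
    show "(\<integral>\<^sup>+x. ennreal (norm (H x) powr q) \<partial>lborel) < \<infinity>" using int by simp
  qed measurable
  then have "\<forall>\<^sub>F n in sequentially. (\<integral>\<^sup>+x. ennreal (norm (H x - T n x) powr q) \<partial>lborel) < ennreal t"
    using t by (intro order_tendstoD(2)) auto
  then obtain n where n: "(\<integral>\<^sup>+x. ennreal (norm (H x - T n x) powr q) \<partial>lborel) < ennreal t"
    by (auto simp: eventually_sequentially)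
  obtain G B where G: "continuous_on UNIV G" "\<And>x. norm (G x) \<le> B" "(\<integral>\<^sup>+x. ennreal (norm (T n x - G x) powr q) \<partial>lborel) < ennreal t"
  proof -
    have "\<exists>G B. continuous_on UNIV G \<and> (\<forall>x. norm (G x) \<le> B) \<and> (\<integral>\<^sup>+x. ennreal (norm (T n x - G x) powr q) \<partial>lborel) < ennreal t"
    proof (rule Lp_approx_continuous_bounded)
      show "norm x \<le> R" if "T n x \<noteq> 0" for x using that supp[of x] by (auto simp: T_def split: if_splits)
      show "norm (T n x) \<le> real n" for x by (simp add: T_def)
    qed (use t q in auto)
    then show thesis using that by blast
  qed
  have [measurable]: "G \<in> borel_measurable borel" by (rule borel_measurable_continuous_onI[OF G(1)])
  have "(\<integral>\<^sup>+x. ennreal (norm (H x - G x) powr q) \<partial>lborel)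
    \<le> (\<integral>\<^sup>+x. ennreal ((norm (H x - T n x) + norm (T n x - G x)) powr q) \<partial>lborel)"
  proof (intro nn_integral_mono ennreal_leI powr_mono2)
    fix x show "norm (H x - G x) \<le> norm (H x - T n x) + norm (T n x - G x)"
      using norm_triangle_ineq[of "H x - T n x" "T n x - G x"] by simp
  qed (use q in auto)
  also have "\<dots> \<le> ennreal (2 powr q) * ((\<integral>\<^sup>+x. ennreal (norm (H x - T n x) powr q) \<partial>lborel) + (\<integral>\<^sup>+x. ennreal (norm (T n x - G x) powr q) \<partial>lborel))"
    by (rule nn_integral_powr_add_le) (use q in auto)
  also have "\<dots> < ennreal (2 powr q) * (ennreal t + ennreal t)"
    by (intro ennreal_mult_strict_left_mono add_strict_mono n G(3)) auto
  also have "\<dots> = ennreal s"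
    using t by (simp add: ennreal_plus[symmetric] ennreal_mult'[symmetric] t_def del: ennreal_plus)
  finally show thesis using that G by blast
qed

text \<open>Continuity of translations, tested against \<open>F\<close>. Replacing \<open>H\<close>
  by a bounded continuous \<open>G\<close> costs an error that Hoelder controls uniformly in the
  shift; for \<open>G\<close> itself dominated convergence applies because \<open>F\<close> is
  integrable.\<close>

lemma nn_integral_translate_tendsto_0:
  fixes F H :: "'a::euclidean_space \<Rightarrow> complex"
  assumes F: "integrable lborel F" and [measurable]: "H \<in> borel_measurable borel" and supp: "\<And>x. H x \<noteq> 0 \<Longrightarrow> norm x \<le> R"
    and p: "1 < p" "1 < p'" "1 / p + 1 / p' = 1"
    and Fp: "(\<integral>\<^sup>+x. ennreal (norm (F x) powr p) \<partial>lborel) < top" and Hp: "(\<integral>\<^sup>+x. ennreal (norm (H x) powr p') \<partial>lborel) < top"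
    and h: "h \<longlonglongrightarrow> 0"
  shows "(\<lambda>n. \<integral>\<^sup>+y. ennreal (norm (F y) * norm (H (y - h n) - H y)) \<partial>lborel) \<longlonglongrightarrow> 0"
proof -
  have [measurable]: "F \<in> borel_measurable borel" using F[THEN borel_measurable_integrable] by simp
  obtain A0 where A0: "A0 \<ge> 0" "(\<integral>\<^sup>+x. ennreal (norm (F x) powr p) \<partial>lborel) = ennreal A0"
    using Fp by (cases "(\<integral>\<^sup>+x. ennreal (norm (F x) powr p) \<partial>lborel)") auto
  \<comment> \<open>The summand 1 keeps \<open>A\<close> positive, since \<open>s\<close> is
    obtained below by dividing by it.\<close>
  define A where "A = A0 powr (1 / p) + 1"
  have A: "A > 0" "(\<integral>\<^sup>+x. ennreal (norm (F x) powr p) \<partial>lborel) \<le> ennreal (A powr p)"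
  proof -
    show "A > 0" by (simp add: A_def add_nonneg_pos)
    have "A0 = (A0 powr (1 / p)) powr p" using A0(1) p by (simp add: powr_powr)
    also have "\<dots> \<le> A powr p" by (rule powr_mono2) (use p in \<open>auto simp: A_def\<close>)
    finally show "(\<integral>\<^sup>+x. ennreal (norm (F x) powr p) \<partial>lborel) \<le> ennreal (A powr p)" unfolding A0 by (rule ennreal_leI)
  qed
  show ?thesis
  proof (rule order_tendstoI)
    fix a :: ennreal assume a: "0 < a"
    obtain a' where a': "a' > 0" "ennreal a' < a"
    proof (cases a)
      case (real r)
      then show ?thesis using a that[of "r / 2"] by (auto simp: ennreal_lessI)
    next
      case top
      then show ?thesis using that[of 1] by simp
    qed
    \<comment> \<open>A third of \<open>a'\<close> for each error: from \<open>H - G\<close>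
      translated, from \<open>H - G\<close> in place, and from the translation of
      \<open>G\<close>.\<close>
    define s where "s = a' / (3 * A)"
    have s: "s > 0" using a' A by (simp add: s_def)
    obtain G B where G: "continuous_on UNIV G" "\<And>x. norm (G x) \<le> B" "(\<integral>\<^sup>+x. ennreal (norm (H x - G x) powr p') \<partial>lborel) < ennreal (s powr p')"
      using Lp_approx_continuous[OF _ supp Hp, of "s powr p'"] s p by auto
    have [measurable]: "G \<in> borel_measurable borel" by (rule borel_measurable_continuous_onI[OF G(1)])
    have B: "B \<ge> 0" using G(2)[of 0] norm_ge_zero order_trans by blast
    have 1: "(\<integral>\<^sup>+y. ennreal (norm (F y) * norm (H y - G y)) \<partial>lborel) \<le> ennreal (A * s)"
      by (rule nn_integral_Hoelder[where p = p and p' = p']) (use A s p G(3) in auto)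
    have 2: "(\<integral>\<^sup>+y. ennreal (norm (F y) * norm (H (y - v) - G (y - v))) \<partial>lborel) \<le> ennreal (A * s)" for v
    proof (rule nn_integral_Hoelder[where p = p and p' = p'])
      have "(\<integral>\<^sup>+x. ennreal (norm (H (x - v) - G (x - v)) powr p') \<partial>lborel) = (\<integral>\<^sup>+x. ennreal (norm (H x - G x) powr p') \<partial>lborel)"
        using nn_integral_lborel_affine[of "\<lambda>x. ennreal (norm (H x - G x) powr p')" 1 "- v"] by simp
      then show "(\<integral>\<^sup>+x. ennreal (norm (H (x - v) - G (x - v)) powr p') \<partial>lborel) \<le> ennreal (s powr p')"
        using G(3) by simp
    qed (use A s p in auto)
    have "(\<lambda>n. \<integral>\<^sup>+y. ennreal (norm (F y) * norm (G (y - h n) - G y)) \<partial>lborel) \<longlonglongrightarrow> (\<integral>\<^sup>+y. ennreal 0 \<partial>(lborel :: 'a measure))"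
    proof (rule nn_integral_dominated_convergence[where w = "\<lambda>y. ennreal (2 * B * norm (F y))"])
      show "AE y in lborel. ennreal (norm (F y) * norm (G (y - h j) - G y)) \<le> ennreal (2 * B * norm (F y))" for j
      proof (intro AE_I2 ennreal_leI)
        fix y
        have "norm (G (y - h j) - G y) \<le> 2 * B"
          using norm_triangle_ineq4[of "G (y - h j)" "G y"] G(2)[of y] G(2)[of "y - h j"] by linarith
        then show "norm (F y) * norm (G (y - h j) - G y) \<le> 2 * B * norm (F y)"
          using mult_left_mono[of "norm (G (y - h j) - G y)" "2 * B" "norm (F y)"] by (simp add: mult_ac)
      qed
      show "(\<integral>\<^sup>+y. ennreal (2 * B * norm (F y)) \<partial>lborel) < \<infinity>"
        using F B by (auto simp: integrable_iff_bounded ennreal_mult' nn_integral_cmult ennreal_mult_less_top)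
      show "AE y in lborel. (\<lambda>n. ennreal (norm (F y) * norm (G (y - h n) - G y))) \<longlonglongrightarrow> ennreal 0"
      proof (rule AE_I2)
        fix y
        have "(\<lambda>n. y - h n) \<longlonglongrightarrow> y - 0" by (intro tendsto_intros h)
        then have "(\<lambda>n. G (y - h n)) \<longlonglongrightarrow> G y"
          using continuous_on_tendsto_compose[OF G(1)] by auto
        then have "(\<lambda>n. norm (F y) * norm (G (y - h n) - G y)) \<longlonglongrightarrow> norm (F y) * norm (G y - G y)"
          by (intro tendsto_intros)
        then show "(\<lambda>n. ennreal (norm (F y) * norm (G (y - h n) - G y))) \<longlonglongrightarrow> ennreal 0"
          by (intro tendsto_ennrealI) simp
      qed
    qed measurable
    then have "\<forall>\<^sub>F n in sequentially. (\<integral>\<^sup>+y. ennreal (norm (F y) * norm (G (y - h n) - G y)) \<partial>lborel) < ennreal (A * s)"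
      using A s by (intro order_tendstoD(2)) auto
    then show "\<forall>\<^sub>F n in sequentially. (\<integral>\<^sup>+y. ennreal (norm (F y) * norm (H (y - h n) - H y)) \<partial>lborel) < a"
    proof eventually_elim
      case (elim n)
      have "(\<integral>\<^sup>+y. ennreal (norm (F y) * norm (H (y - h n) - H y)) \<partial>lborel)
        \<le> (\<integral>\<^sup>+y. ennreal (norm (F y) * norm (H (y - h n) - G (y - h n))) + ennreal (norm (F y) * norm (G (y - h n) - G y)) + ennreal (norm (F y) * norm (H y - G y)) \<partial>lborel)"
      proof (rule nn_integral_mono)
        fix y
        have "norm (H (y - h n) - H y) \<le> norm (H (y - h n) - G (y - h n)) + norm (G (y - h n) - G y) + norm (H y - G y)"
          by norm
        then have "norm (F y) * norm (H (y - h n) - H y) \<le> norm (F y) * (norm (H (y - h n) - G (y - h n)) + norm (G (y - h n) - G y) + norm (H y - G y))"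
          by (rule mult_left_mono) simp
        then show "ennreal (norm (F y) * norm (H (y - h n) - H y)) \<le> ennreal (norm (F y) * norm (H (y - h n) - G (y - h n))) + ennreal (norm (F y) * norm (G (y - h n) - G y)) + ennreal (norm (F y) * norm (H y - G y))"
          by (simp add: ennreal_plus[symmetric] distrib_left ennreal_leI del: ennreal_plus)
      qed
      also have "\<dots> = (\<integral>\<^sup>+y. ennreal (norm (F y) * norm (H (y - h n) - G (y - h n))) \<partial>lborel) + (\<integral>\<^sup>+y. ennreal (norm (F y) * norm (G (y - h n) - G y)) \<partial>lborel)
         + (\<integral>\<^sup>+y. ennreal (norm (F y) * norm (H y - G y)) \<partial>lborel)"
        by (simp add: nn_integral_add)
      also have "\<dots> \<le> ennreal (A * s) + ennreal (A * s) + ennreal (A * s)"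
        by (intro add_mono 1 2 less_imp_le elim)
      also have "\<dots> = ennreal a'"
 
      proof -
        have "A * s + A * s + A * s = a'" using A by (simp add: s_def)
        then show ?thesis using A s by (simp add: ennreal_plus[symmetric] del: ennreal_plus)
      qed
      also have "\<dots> < a" by fact
      finally show ?case .
    qed
  qed simp
qed

lemma nn_integral_translate_bounded:
  fixes F H :: "'a::euclidean_space \<Rightarrow> complex"
  assumes [measurable]: "F \<in> borel_measurable borel" "H \<in> borel_measurable borel"
    and p: "1 < p" "1 < p'" "1 / p + 1 / p' = 1"
    and Fp: "(\<integral>\<^sup>+x. ennreal (norm (F x) powr p) \<partial>lborel) < top" and Hp: "(\<integral>\<^sup>+x. ennreal (norm (H x) powr p') \<partial>lborel) < top"
  obtains K where "K \<ge> 0" "\<And>v. (\<integral>\<^sup>+y. ennreal (norm (F y) * norm (H (y - v))) \<partial>lborel) \<le> ennreal K"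
proof -
  have fin: "\<exists>A\<ge>0. I = ennreal (A powr q)" if "I < top" "q > 0" for I :: ennreal and q :: real
    using that by (cases I) (auto intro!: exI[of _ "enn2real I powr (1 / q)"] simp: powr_powr)
  obtain A where A: "A \<ge> 0" "(\<integral>\<^sup>+x. ennreal (norm (F x) powr p) \<partial>lborel) = ennreal (A powr p)"
    using fin[OF Fp, of p] p by auto
  obtain B where B: "B \<ge> 0" "(\<integral>\<^sup>+x. ennreal (norm (H x) powr p') \<partial>lborel) = ennreal (B powr p')"
    using fin[OF Hp, of p'] p by auto
  have "(\<integral>\<^sup>+y. ennreal (norm (F y) * norm (H (y - v))) \<partial>lborel) \<le> ennreal (A * B)" for v
  proof (rule nn_integral_Hoelder[where p = p and p' = p'])
    show "(\<integral>\<^sup>+x. ennreal (norm (H (x - v)) powr p') \<partial>lborel) \<le> ennreal (B powr p')"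
      using nn_integral_lborel_affine[of "\<lambda>x. ennreal (norm (H x) powr p')" 1 "- v"] B by simp
  qed (use A B p in auto)
  then show thesis using that[of "A * B"] A B by auto
qed

lemma
  fixes f :: "'a::euclidean_space \<Rightarrow> 'b::{banach, second_countable_topology}"
  assumes c: "c \<noteq> 0"
  shows integral_lborel_affine:
      "f \<in> borel_measurable borel \<Longrightarrow> (LINT y|lborel. f y) = \<bar>c\<bar> ^ DIM('a) *\<^sub>R (LINT y|lborel. f (a + c *\<^sub>R y))"
    and integrable_lborel_affine: "integrable lborel f \<Longrightarrow> integrable lborel (\<lambda>y. f (a + c *\<^sub>R y))"
proof -
  assume [measurable]: "f \<in> borel_measurable borel"
  show "(LINT y|lborel. f y) = \<bar>c\<bar> ^ DIM('a) *\<^sub>R (LINT y|lborel. f (a + c *\<^sub>R y))"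
    by (subst lborel_affine[OF c, of a]) (simp add: integral_density integral_distr)
next
  assume f: "integrable lborel f"
  then have [measurable]: "f \<in> borel_measurable borel" using borel_measurable_integrable by force
  have "(\<integral>\<^sup>+y. ennreal (norm (f y)) \<partial>lborel) = ennreal (\<bar>c\<bar> ^ DIM('a)) * (\<integral>\<^sup>+y. ennreal (norm (f (a + c *\<^sub>R y))) \<partial>lborel)"
    by (rule nn_integral_lborel_affine[OF _ c]) measurable
  then show "integrable lborel (\<lambda>y. f (a + c *\<^sub>R y))"
    using f c by (auto simp: integrable_iff_bounded ennreal_mult_less_top)
qed

context elliptic begin

lemma smooth_delta: "e > 0 \<Longrightarrow> smooth (\<lambda>x. of_real (delta e x))"
  unfolding delta_def[abs_def] of_real_mult
  by (intro smooth_mult smooth_const smooth_powr(1) smooth_qform qform_pos)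

lemma delta_1_le: "delta 1 x \<le> real CARD('N)"
proof -
  have "(1 + qform x) powr (- (real CARD('N) / 2) - 1) \<le> 1"
    using qform_nonneg[of x] by (intro powr_nonpos_le_1) auto
  then show ?thesis by (simp add: delta_def mult_left_le)
qed

text \<open>The substitution \<open>z = y - e u\<close> turns \<open>delta e\<close> into the fixed
  density \<open>delta 1 u\<close>, so the distance to the limit is at most an average over
  \<open>u\<close> of translation errors by \<open>e u\<close>. These tend to 0 for each
  \<open>u\<close> and are bounded by \<open>2 * K\<close>.\<close>

lemma delta_pairing_tendsto:
  fixes F H :: "real ^ 'N \<Rightarrow> complex"
  assumes F: "comp_int F" and H: "comp_int H"
    and p: "1 < p" "1 < p'" "1 / p + 1 / p' = 1"
    and Fp: "(\<integral>\<^sup>+x. ennreal (norm (F x) powr p) \<partial>lborel) < top" and Hp: "(\<integral>\<^sup>+x. ennreal (norm (H x) powr p') \<partial>lborel) < top"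
  shows "(\<lambda>n. LINT y|lborel. LINT z|lborel. F y * of_real (delta (1 / real (Suc n)) (y - z)) * H z)
    \<longlonglongrightarrow> of_real (LINT x|lborel. delta 1 x) * (LINT y|lborel. F y * H y)"
proof -
  let ?c = "LINT x|lborel. delta 1 x"
  define e where "e n = 1 / real (Suc n)" for n
  have e: "e n > 0" for n by (simp add: e_def)
  have e0: "e \<longlonglongrightarrow> 0" unfolding e_def using LIMSEQ_inverse_real_of_nat by (simp add: inverse_eq_divide)
  have Fi: "integrable lborel F" and Hi: "integrable lborel H" using F H by (auto simp: comp_int_def)
  have [measurable]: "F \<in> borel_measurable borel" "H \<in> borel_measurable borel"
    using Fi[THEN borel_measurable_integrable] Hi[THEN borel_measurable_integrable] by auto
  obtain R where R: "\<And>x. H x \<noteq> 0 \<Longrightarrow> norm x \<le> R" using H by (auto simp: comp_int_def)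
  obtain K where K: "K \<ge> 0" "\<And>v. (\<integral>\<^sup>+y. ennreal (norm (F y) * norm (H (y - v))) \<partial>lborel) \<le> ennreal K"
    using nn_integral_translate_bounded[OF _ _ p Fp Hp] by auto
  have FH: "integrable lborel (\<lambda>y. F y * H y)"
    using K(2)[of 0] by (intro integrableI_bounded) (auto simp: norm_mult intro: le_less_trans)
  let ?\<Phi> = "\<lambda>n u. ennreal (delta 1 u) * (\<integral>\<^sup>+y. ennreal (norm (F y) * norm (H (y - e n *\<^sub>R u) - H y)) \<partial>lborel)"
  have le: "ennreal (norm ((LINT y|lborel. LINT z|lborel. F y * of_real (delta (e n) (y - z)) * H z) - of_real ?c * (LINT y|lborel. F y * H y)))
     \<le> (\<integral>\<^sup>+u. ?\<Phi> n u \<partial>lborel)" for n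
  proof -
    have inner: "(LINT z|lborel. F y * of_real (delta (e n) (y - z)) * H z) - of_real ?c * (F y * H y)
      = (LINT u|lborel. F y * (of_real (delta 1 u) * (H (y - e n *\<^sub>R u) - H y)))" for y
    proof -
      have cv: "(LINT z|lborel. of_real (delta (e n) (y - z)) * H z) = (LINT u|lborel. of_real (delta 1 u) * H (y - e n *\<^sub>R u))"
      proof -
        have "(LINT z|lborel. of_real (delta (e n) (y - z)) * H z)
          = \<bar>- e n\<bar> ^ CARD('N) *\<^sub>R (LINT u|lborel. of_real (delta (e n) (y - (y + (- e n) *\<^sub>R u))) * H (y + (- e n) *\<^sub>R u))"
          using integral_lborel_affine[of "- e n" "\<lambda>z. of_real (delta (e n) (y - z)) * H z" y] e[of n] by simp
        also have "\<dots> = (LINT u|lborel. of_real (e n ^ CARD('N) * delta (e n) (e n *\<^sub>R u)) * H (y - e n *\<^sub>R u))"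
          using e[of n] by (simp add: scaleR_conv_of_real mult.assoc)
        finally show ?thesis unfolding delta_scale[OF e] .
      qed
      have i1: "integrable lborel (\<lambda>u. of_real (delta 1 u) * H (y - e n *\<^sub>R u))"
      proof (rule Bochner_Integration.integrable_bound)
        show "integrable lborel (\<lambda>u. of_nat CARD('N) * H (y + (- e n) *\<^sub>R u))"
          using integrable_lborel_affine[OF _ Hi, of "- e n" y] e[of n] by simp
        show "AE u in lborel. norm (of_real (delta 1 u) * H (y - e n *\<^sub>R u)) \<le> norm (of_nat CARD('N) * H (y + (- e n) *\<^sub>R u))"
          using delta_1_le delta_nonneg by (intro AE_I2) (simp add: norm_mult mult_right_mono)
      qed measurable
      have i2: "integrable lborel (\<lambda>u. of_real (delta 1 u) * H y)"
        using delta_integrable by simp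
      have diff: "(LINT u|lborel. of_real (delta 1 u) * (H (y - e n *\<^sub>R u) - H y)) = (LINT u|lborel. of_real (delta 1 u) * H (y - e n *\<^sub>R u)) - of_real ?c * H y"
        unfolding right_diff_distrib by (subst Bochner_Integration.integral_diff[OF i1 i2]) simp
      show ?thesis
        by (simp only: mult.assoc integral_mult_right_zero cv diff) (simp add: right_diff_distrib mult.left_commute)
    qed
    have i3: "integrable lborel (\<lambda>y. LINT z|lborel. F y * of_real (delta (e n) (y - z)) * H z)"
      by (rule comp_int_kernel_integrable_fst[OF F H smooth_delta[OF e]])
    have i4: "integrable lborel (\<lambda>y. of_real ?c * (F y * H y))" using FH by simp
    have "(LINT y|lborel. LINT z|lborel. F y * of_real (delta (e n) (y - z)) * H z) - of_real ?c * (LINT y|lborel. F y * H y)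
      = (LINT y|lborel. (LINT z|lborel. F y * of_real (delta (e n) (y - z)) * H z) - of_real ?c * (F y * H y))"
      by (subst Bochner_Integration.integral_diff[OF i3 i4]) simp
    also have "\<dots> = (LINT y|lborel. LINT u|lborel. F y * (of_real (delta 1 u) * (H (y - e n *\<^sub>R u) - H y)))"
      by (simp only: inner)
    finally have "ennreal (norm ((LINT y|lborel. LINT z|lborel. F y * of_real (delta (e n) (y - z)) * H z) - of_real ?c * (LINT y|lborel. F y * H y)))
      \<le> (\<integral>\<^sup>+y. \<integral>\<^sup>+u. ennreal (norm (F y * (of_real (delta 1 u) * (H (y - e n *\<^sub>R u) - H y)))) \<partial>lborel \<partial>lborel)"
      using order_trans[OF ennreal_norm_integral_le nn_integral_mono[OF ennreal_norm_integral_le]] by (simp only:)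
    also have "\<dots> = (\<integral>\<^sup>+y. \<integral>\<^sup>+u. ennreal (delta 1 u) * ennreal (norm (F y) * norm (H (y - e n *\<^sub>R u) - H y)) \<partial>lborel \<partial>lborel)"
      by (intro nn_integral_cong) (simp add: norm_mult delta_nonneg ennreal_mult'[symmetric] mult_ac)
    also have "\<dots> = (\<integral>\<^sup>+u. \<integral>\<^sup>+y. ennreal (delta 1 u) * ennreal (norm (F y) * norm (H (y - e n *\<^sub>R u) - H y)) \<partial>lborel \<partial>lborel)"
      by (rule lborel_pair.Fubini') (unfold split_beta', measurable)
    also have "\<dots> = (\<integral>\<^sup>+u. ?\<Phi> n u \<partial>lborel)"
      by (simp add: nn_integral_cmult)
    finally show ?thesis .
  qed
  have "(\<lambda>n. \<integral>\<^sup>+u. ?\<Phi> n u \<partial>lborel) \<longlonglongrightarrow> (\<integral>\<^sup>+u. 0 \<partial>(lborel :: (real ^ 'N) measure))"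
  proof (rule nn_integral_dominated_convergence[where w = "\<lambda>u. ennreal (delta 1 u) * ennreal (2 * K)"])
    show "AE u in lborel. ?\<Phi> n u \<le> ennreal (delta 1 u) * ennreal (2 * K)" for n
    proof (intro AE_I2 mult_left_mono)
      fix u
      have "(\<integral>\<^sup>+y. ennreal (norm (F y) * norm (H (y - e n *\<^sub>R u) - H y)) \<partial>lborel)
        \<le> (\<integral>\<^sup>+y. ennreal (norm (F y) * norm (H (y - e n *\<^sub>R u))) + ennreal (norm (F y) * norm (H (y - 0))) \<partial>lborel)"
        by (intro nn_integral_mono)
           (simp add: ennreal_plus[symmetric] distrib_left[symmetric] ennreal_leI mult_left_mono norm_triangle_ineq4 del: ennreal_plus)
      also have "\<dots> = (\<integral>\<^sup>+y. ennreal (norm (F y) * norm (H (y - e n *\<^sub>R u))) \<partial>lborel) + (\<integral>\<^sup>+y. ennreal (norm (F y) * norm (H (y - 0))) \<partial>lborel)"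
        by (rule nn_integral_add) measurable
      also have "\<dots> \<le> ennreal K + ennreal K" by (intro add_mono K)
      also have "\<dots> = ennreal (2 * K)" using K(1) by (simp add: ennreal_plus[symmetric] del: ennreal_plus)
      finally show "(\<integral>\<^sup>+y. ennreal (norm (F y) * norm (H (y - e n *\<^sub>R u) - H y)) \<partial>lborel) \<le> ennreal (2 * K)" .
    qed simp
    have "(\<integral>\<^sup>+u. ennreal (delta 1 u) \<partial>lborel) < top"
      using delta_integrable by (auto simp: integrable_iff_bounded delta_nonneg)
    then show "(\<integral>\<^sup>+u. ennreal (delta 1 u) * ennreal (2 * K) \<partial>lborel) < \<infinity>"
      by (simp add: nn_integral_multc ennreal_mult_less_top)
    show "AE u in lborel. (\<lambda>n. ?\<Phi> n u) \<longlonglongrightarrow> 0"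
    proof (rule AE_I2)
      fix u :: "real ^ 'N"
      have "(\<lambda>n. e n *\<^sub>R u) \<longlonglongrightarrow> 0 *\<^sub>R u" by (intro tendsto_intros e0)
      then have "(\<lambda>n. \<integral>\<^sup>+y. ennreal (norm (F y) * norm (H (y - e n *\<^sub>R u) - H y)) \<partial>lborel) \<longlonglongrightarrow> 0"
        by (intro nn_integral_translate_tendsto_0[OF Fi _ R p Fp Hp]) auto
      then have "(\<lambda>n. ?\<Phi> n u) \<longlonglongrightarrow> ennreal (delta 1 u) * 0"
        by (intro ennreal_tendsto_cmult) auto
      then show "(\<lambda>n. ?\<Phi> n u) \<longlonglongrightarrow> 0" by simp
    qed
  qed measurable
  then have \<Phi>0: "(\<lambda>n. \<integral>\<^sup>+u. ?\<Phi> n u \<partial>lborel) \<longlonglongrightarrow> 0" by simp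
  have "(\<lambda>n. ennreal (norm ((LINT y|lborel. LINT z|lborel. F y * of_real (delta (e n) (y - z)) * H z) - of_real ?c * (LINT y|lborel. F y * H y)))) \<longlonglongrightarrow> ennreal 0"
    unfolding ennreal_0 by (rule tendsto_sandwich[OF _ _ tendsto_const \<Phi>0]) (use le in \<open>auto intro!: always_eventually\<close>)
  then have "(\<lambda>n. norm ((LINT y|lborel. LINT z|lborel. F y * of_real (delta (e n) (y - z)) * H z) - of_real ?c * (LINT y|lborel. F y * H y))) \<longlonglongrightarrow> 0"
    by (subst (asm) tendsto_ennreal_iff) auto
  then show ?thesis unfolding e_def by (simp only: tendsto_norm_zero_iff LIM_zero_iff)
qed

end

section \<open>Test functions dominated by the weight\<close>

lemma borel_measurable_vec_nth [measurable]:
  fixes f :: "'a \<Rightarrow> 'b::euclidean_space ^ 'n"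
  assumes "f \<in> borel_measurable M"
  shows "(\<lambda>x. f x $ i) \<in> borel_measurable M"
  by (rule measurable_compose[OF assms borel_measurable_continuous_onI])
     (intro linear_continuous_on bounded_linear_vec_nth)

text \<open>\<open>norm (f x) \<le> 1 + norm (f x) powr p\<close>, where the 1 is integrated over a
  ball containing the support of the test function.\<close>

lemma loc_int_Lp:
  assumes [measurable]: "f \<in> borel_measurable borel" and p: "p > 1"
    and fin: "(\<integral>\<^sup>+x. ennreal (norm (f x) powr p) \<partial>lborel) < top"
  shows "loc_int f"
  unfolding loc_int_def
proof (intro allI impI integrableI_bounded)
  fix \<psi> :: "real ^ 'a \<Rightarrow> complex" assume \<psi>: "test_function \<psi>"
  have [measurable]: "\<psi> \<in> borel_measurable borel" by (rule smooth_borel[OF test_function_smooth[OF \<psi>]])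
  show "(\<lambda>x. f x * \<psi> x) \<in> borel_measurable lborel" by measurable
  obtain B where B: "B \<ge> 0" "\<And>x. norm (\<psi> x) \<le> B" using test_function_bounded[OF \<psi>] by blast
  obtain R where R: "\<And>x. \<psi> x \<noteq> 0 \<Longrightarrow> norm x \<le> R" using \<psi> by (auto simp: test_function_iff)
  have "(\<integral>\<^sup>+x. ennreal (norm (f x * \<psi> x)) \<partial>lborel)
    \<le> (\<integral>\<^sup>+x. ennreal B * (indicator (ball 0 (R + 1)) x + ennreal (norm (f x) powr p)) \<partial>lborel)"
  proof (rule nn_integral_mono)
    fix x
    show "ennreal (norm (f x * \<psi> x)) \<le> ennreal B * (indicator (ball 0 (R + 1)) x + ennreal (norm (f x) powr p))"
    proof (cases "\<psi> x = 0")
      case False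
      have "norm (f x) \<le> 1 + norm (f x) powr p"
      proof (cases "norm (f x) \<le> 1")
        case False
        then have "norm (f x) powr 1 \<le> norm (f x) powr p" using p by (intro powr_mono) auto
        then show ?thesis by simp
      qed (simp add: add_increasing2)
      then have "norm (f x * \<psi> x) \<le> (1 + norm (f x) powr p) * B"
        unfolding norm_mult by (intro mult_mono B) auto
      then have "ennreal (norm (f x * \<psi> x)) \<le> ennreal (B * (1 + norm (f x) powr p))"
        by (intro ennreal_leI) (simp add: mult.commute)
      also have "\<dots> = ennreal B * (indicator (ball 0 (R + 1)) x + ennreal (norm (f x) powr p))"
        using R[OF False] B(1) by (simp add: ennreal_mult)
      finally show ?thesis .
    qed simp
  qed
  also have "\<dots> = ennreal B * (emeasure lborel (ball (0 :: real ^ 'a) (R + 1)) + (\<integral>\<^sup>+x. ennreal (norm (f x) powr p) \<partial>lborel))"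
    by (simp add: nn_integral_cmult nn_integral_add)
  also have "\<dots> < \<infinity>"
    using fin emeasure_lborel_ball_finite[of "0 :: real ^ 'a" "R + 1"] by (simp add: ennreal_mult_less_top)
  finally show "(\<integral>\<^sup>+x. ennreal (norm (f x * \<psi> x)) \<partial>lborel) < \<infinity>" .
qed

lemma nn_integral_powr_le_finite:
  assumes "(\<integral>\<^sup>+x. ennreal (norm (f x) powr p) \<partial>M) < top" "\<And>x. norm (g x) \<le> B * norm (f x)" "B \<ge> 0" "p > 0"
    and [measurable]: "f \<in> borel_measurable M"
  shows "(\<integral>\<^sup>+x. ennreal (norm (g x) powr p) \<partial>M) < top"
proof -
  have "(\<integral>\<^sup>+x. ennreal (norm (g x) powr p) \<partial>M) \<le> (\<integral>\<^sup>+x. ennreal (B powr p) * ennreal (norm (f x) powr p) \<partial>M)"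
    using assms by (intro nn_integral_mono) (simp add: ennreal_mult'[symmetric] powr_mult[symmetric] ennreal_leI powr_mono2)
  also have "\<dots> = ennreal (B powr p) * (\<integral>\<^sup>+x. ennreal (norm (f x) powr p) \<partial>M)"
    by (rule nn_integral_cmult) measurable
  also have "\<dots> < top" using assms(1) by (simp add: ennreal_mult_less_top)
  finally show ?thesis .
qed

text \<open>First derivatives suffice because the div-curl identity differentiates each cutoff at
  most once.\<close>

definition weight_bounded :: "(real ^ 'N \<Rightarrow> complex) \<Rightarrow> real \<Rightarrow> bool" where
  "weight_bounded f B \<longleftrightarrow> smooth f \<and> (\<forall>x. norm (f x) \<le> B * weight x) \<and> (\<forall>x k. norm (partial k f x) \<le> B * weight x)"

text \<open>Differentiation lowers the exponent by 1 and brings in \<open>2 * x $ k\<close>, which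
  \<open>1 + (norm x)\<^sup>2\<close> absorbs. The exponent is general because both the weight and
  its reciprocal are of this form.\<close>

lemma partial_powr_norm_sq_bound:
  fixes x :: "real ^ 'N"
  defines "P \<equiv> \<lambda>s (x :: real ^ 'N). complex_of_real ((1 + 1 * (norm x)\<^sup>2) powr s)"
  shows "smooth (P s)" and "norm (partial k (P s) x) \<le> \<bar>s\<bar> * (1 + (norm x)\<^sup>2) powr s"
proof -
  have pos: "1 + 1 * (norm x)\<^sup>2 > 0" for x :: "real ^ 'N" by (simp add: add_pos_nonneg)
  show "smooth (P s)" unfolding P_def by (rule smooth_powr(1)[OF smooth_norm_sq pos])
  have "partial k (P s) x = of_real (s * (1 + 1 * (norm x)\<^sup>2) powr (s - 1)) * of_real (2 * 1 * x $ k)"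
    unfolding P_def smooth_powr(2)[OF smooth_norm_sq pos] partial_norm_sq ..
  then have "norm (partial k (P s) x) = \<bar>s\<bar> * (1 + (norm x)\<^sup>2) powr (s - 1) * (2 * \<bar>x $ k\<bar>)"
    by (simp add: norm_mult abs_mult)
  also have "\<dots> \<le> \<bar>s\<bar> * (1 + (norm x)\<^sup>2) powr (s - 1) * (1 + (norm x)\<^sup>2)"
  proof (rule mult_left_mono)
    have "2 * \<bar>x $ k\<bar> \<le> 2 * norm x" by (simp add: component_le_norm_cart)
    also have "\<dots> \<le> 1 + (norm x)\<^sup>2" using zero_le_power2[of "norm x - 1"] by (simp add: power2_diff)
    finally show "2 * \<bar>x $ k\<bar> \<le> 1 + (norm x)\<^sup>2" .
  qed simp
  also have "\<dots> = \<bar>s\<bar> * (1 + (norm x)\<^sup>2) powr s"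
    using pos[of x] by (simp add: powr_diff)
  finally show "norm (partial k (P s) x) \<le> \<bar>s\<bar> * (1 + (norm x)\<^sup>2) powr s" .
qed

lemma weight_bounded_weight:
  "weight_bounded (\<lambda>x :: real ^ 'N. complex_of_real (weight x)) (real CARD('N) / 2 + 1)"
proof -
  let ?s = "- (real CARD('N) / 2 + 1)"
  have "norm (complex_of_real (weight x)) \<le> (real CARD('N) / 2 + 1) * weight x" for x :: "real ^ 'N"
    using weight_pos[of x] by (simp add: algebra_simps)
  then show ?thesis
    using partial_powr_norm_sq_bound[where 'N = 'N and s = ?s]
    by (simp add: weight_bounded_def weight_def add.commute)
qed

lemma inverse_weight: "1 / weight x = (1 + (norm x)\<^sup>2) powr (real DIM('a) / 2 + 1)" for x :: "'a::euclidean_space"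
  unfolding weight_def powr_minus_divide by simp

text \<open>\<phi> and its first partials decay at least like the square of the weight, so after
  division by the weight one factor of it is left.\<close>

lemma weight_bounded_schwartz:
  fixes \<phi> :: "real ^ 'N \<Rightarrow> complex"
  assumes "schwartz \<phi>"
  obtains B where "B \<ge> 0" "weight_bounded (\<lambda>x. \<phi> x * complex_of_real (1 / weight x)) B"
proof -
  \<comment> \<open>\<open>(1 + norm x) ^ ?m\<close> dominates
    \<open>(1 + (norm x)\<^sup>2) ^ (CARD('N) + 2)\<close>, which is the square of
    \<open>1 / weight x\<close>.\<close>
  let ?s = "real CARD('N) / 2 + 1" and ?m = "2 * CARD('N) + 4"
  define iw where "iw = (\<lambda>x :: real ^ 'N. complex_of_real ((1 + 1 * (norm x)\<^sup>2) powr ?s))"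
  have iw: "iw x = complex_of_real (1 / weight x)" for x
    unfolding iw_def inverse_weight by simp
  have sm: "smooth \<phi>" "smooth iw"
    using assms partial_powr_norm_sq_bound(1) by (auto simp: schwartz_def iw_def)
  have ex: "\<exists>B. \<forall>x. (1 + norm x) ^ ?m * norm (iter_partial ks \<phi> x) \<le> B" for ks
    using assms unfolding schwartz_def by blast
  obtain b where b: "\<And>x. (1 + norm x) ^ ?m * norm (\<phi> x) \<le> b"
    using ex[of "[]"] by (auto simp: iter_partial_def)
  have "\<exists>b. \<forall>k x. (1 + norm x) ^ ?m * norm (partial k \<phi> x) \<le> b k"
    using ex[of "[k]" for k] by (intro choice) (simp add: iter_partial_def)
  then obtain b' where b': "\<And>k x. (1 + norm x) ^ ?m * norm (partial k \<phi> x) \<le> b' k" by blast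
  define c where "c = \<bar>b\<bar> + (\<Sum>k\<in>UNIV. \<bar>b' k\<bar>)"
  have c: "c \<ge> 0" by (simp add: c_def sum_nonneg)
  have dec: "norm z * (1 / weight x) \<le> c * weight x" if "(1 + norm x) ^ ?m * norm z \<le> c" for z :: complex and x :: "real ^ 'N"
  proof -
    have "1 + (norm x)\<^sup>2 \<le> (1 + norm x)\<^sup>2" by (simp add: power2_sum)
    then have "(1 + (norm x)\<^sup>2) ^ (CARD('N) + 2) \<le> ((1 + norm x)\<^sup>2) ^ (CARD('N) + 2)"
      by (rule power_mono) simp
    also have "\<dots> = (1 + norm x) ^ ?m" 
    proof -
      have "2 * (CARD('N) + 2) = ?m" by simp
      then show ?thesis by (simp only: power_mult[symmetric])
    qed
    finally have le: "(1 + (norm x)\<^sup>2) ^ (CARD('N) + 2) * norm z \<le> c"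
      using that by (meson mult_right_mono norm_ge_zero order_trans)
    have "(1 / weight x) * (1 / weight x) = (1 + (norm x)\<^sup>2) powr (?s + ?s)"
      unfolding inverse_weight powr_add by simp
    also have "?s + ?s = real (CARD('N) + 2)" by simp
    also have "(1 + (norm x)\<^sup>2) powr real (CARD('N) + 2) = (1 + (norm x)\<^sup>2) ^ (CARD('N) + 2)"
      by (rule powr_realpow) (simp add: add_pos_nonneg)
    finally have "(1 / weight x) * (1 / weight x) * norm z \<le> c" using le by (simp only:)
    then show ?thesis using weight_pos[of x] by (simp add: field_simps)
  qed
  have d0: "norm (\<phi> x) * (1 / weight x) \<le> c * weight x" for x
  proof (rule dec, rule order_trans[OF b])
    show "b \<le> c" unfolding c_def by (simp add: add_increasing2 sum_nonneg)
  qed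
  have d1: "norm (partial k \<phi> x) * (1 / weight x) \<le> c * weight x" for k x
  proof (rule dec, rule order_trans[OF b'])
    have "\<bar>b' k\<bar> \<le> (\<Sum>k\<in>UNIV. \<bar>b' k\<bar>)" by (rule member_le_sum) auto
    then show "b' k \<le> c" unfolding c_def by linarith
  qed
  have niw: "norm (iw x) = 1 / weight x" for x using weight_pos[of x] unfolding iw norm_of_real by simp
  have piw: "norm (partial k iw x) \<le> ?s * (1 / weight x)" for k x
    using partial_powr_norm_sq_bound(2)[of k ?s x] unfolding iw_def inverse_weight by simp
  have "weight_bounded (\<lambda>x. \<phi> x * iw x) (c * (1 + ?s))"
    unfolding weight_bounded_def
  proof (intro conjI allI)
    show "smooth (\<lambda>x. \<phi> x * iw x)" by (intro smooth_mult sm)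
    fix x :: "real ^ 'N"
    have cs: "c * weight x \<le> c * (1 + ?s) * weight x"
      using c weight_pos[of x] by (intro mult_right_mono) (auto simp: algebra_simps)
    show "norm (\<phi> x * iw x) \<le> c * (1 + ?s) * weight x"
      using d0[of x] cs by (simp add: norm_mult niw del: times_divide_eq_right)
    fix k
    have "norm (partial k (\<lambda>x. \<phi> x * iw x) x) \<le> norm (partial k \<phi> x) * norm (iw x) + norm (\<phi> x) * norm (partial k iw x)"
      by (simp add: partial_mult smooth_differentiable sm norm_mult[symmetric] norm_triangle_ineq)
    also have "\<dots> \<le> norm (partial k \<phi> x) * (1 / weight x) + norm (\<phi> x) * (?s * (1 / weight x))"
      unfolding niw by (intro add_mono mult_left_mono piw) auto
    also have "\<dots> = norm (partial k \<phi> x) * (1 / weight x) + ?s * (norm (\<phi> x) * (1 / weight x))"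
      by (simp only: mult_ac)
    also have "\<dots> \<le> c * weight x + ?s * (c * weight x)"
      by (intro add_mono mult_left_mono d0 d1) auto
    finally show "norm (partial k (\<lambda>x. \<phi> x * iw x) x) \<le> c * (1 + ?s) * weight x"
      by (simp add: algebra_simps)
  qed
  then show thesis
    by (intro that[of "c * (1 + ?s)"]) (use c in \<open>auto simp: iw\<close>)
qed

text \<open>Dilations with \<open>c \<le> 1\<close> do not increase the derivatives of the cutoff,
  so the constant stays uniform while the dilated cutoffs tend to 1.\<close>

lemma weight_bounded_cutoff:
  obtains B where "B \<ge> 1" "\<And>f b c. weight_bounded (f :: real ^ 'N \<Rightarrow> complex) b \<Longrightarrow> 0 \<le> b \<Longrightarrow> 0 < c \<Longrightarrow> c \<le> 1 \<Longrightarrow>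
      weight_bounded (\<lambda>x. f x * cutoff (c *\<^sub>R x)) (b * B)" "\<And>x :: real ^ 'N. norm (cutoff x) \<le> B"
proof -
  have t: "test_function (cutoff :: real ^ 'N \<Rightarrow> complex)" by (rule test_function_cutoff)
  obtain B0 where B0: "B0 \<ge> 0" "\<And>x :: real ^ 'N. norm (cutoff x) \<le> B0" using test_function_bounded[OF t] by blast
  have "\<forall>k. \<exists>B. \<forall>x :: real ^ 'N. norm (partial k cutoff x) \<le> B"
    using test_function_bounded[OF test_function_partial[OF t]] by metis
  then obtain B1 where B1: "\<And>k (x :: real ^ 'N). norm (partial k cutoff x) \<le> B1 k" by metis
  define B where "B = 1 + B0 + (\<Sum>k\<in>UNIV. \<bar>B1 k\<bar>)"
  have B: "B \<ge> 1" "B0 \<le> B" using B0(1) by (auto simp: B_def sum_nonneg add_increasing2)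
  have B1': "B0 + B1 k \<le> B" for k
  proof -
    have "\<bar>B1 k\<bar> \<le> (\<Sum>k\<in>UNIV. \<bar>B1 k\<bar>)" by (rule member_le_sum) auto
    then show ?thesis unfolding B_def by linarith
  qed
  show thesis
  proof (rule that[OF B(1)])
    fix f :: "real ^ 'N \<Rightarrow> complex" and b c :: real
    assume f: "weight_bounded f b" and b: "0 \<le> b" and c: "0 < c" "c \<le> 1"
    have smc: "smooth (\<lambda>x :: real ^ 'N. cutoff (c *\<^sub>R x))"
      using smooth_affine[OF test_function_smooth[OF t], of 0 c] by simp
    have sm: "smooth f" using f by (simp add: weight_bounded_def)
    show "weight_bounded (\<lambda>x. f x * cutoff (c *\<^sub>R x)) (b * B)"
      unfolding weight_bounded_def
    proof (intro conjI allI)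
      show "smooth (\<lambda>x. f x * cutoff (c *\<^sub>R x))" by (intro smooth_mult sm smc)
      fix x
      have fx: "norm (f x) \<le> b * weight x" "norm (partial k f x) \<le> b * weight x" for k
        using f by (auto simp: weight_bounded_def)
      have bw: "b * weight x \<ge> 0" using b weight_pos[of x] by simp
      have "norm (f x * cutoff (c *\<^sub>R x)) \<le> (b * weight x) * B"
        unfolding norm_mult using bw by (intro mult_mono fx order_trans[OF B0(2) B(2)]) auto
      then show "norm (f x * cutoff (c *\<^sub>R x)) \<le> b * B * weight x" by (simp add: mult_ac)
      fix k
      have "norm (partial k (\<lambda>x. f x * cutoff (c *\<^sub>R x)) x) \<le> norm (partial k f x) * norm (cutoff (c *\<^sub>R x)) + norm (f x) * (c * norm (partial k cutoff (c *\<^sub>R x)))"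
        using partial_affine[OF smooth_differentiable[OF test_function_smooth[OF t]], of k 0 c x] c(1)
        by (subst partial_mult) (auto intro!: smooth_differentiable sm smc order_trans[OF norm_triangle_ineq] simp: norm_mult)
      also have "\<dots> \<le> (b * weight x) * B0 + (b * weight x) * (1 * B1 k)"
        using bw c by (intro add_mono mult_mono fx B0 B1) auto
      also have "\<dots> = (b * weight x) * (B0 + B1 k)" by (simp add: algebra_simps)
      also have "\<dots> \<le> (b * weight x) * B" by (intro mult_left_mono B1' bw)
      finally show "norm (partial k (\<lambda>x. f x * cutoff (c *\<^sub>R x)) x) \<le> b * B * weight x" by (simp add: mult_ac)
    qed
  qed (rule order_trans[OF B0(2) B(2)])
qed

context elliptic begin

lemma vf_deriv_weight_bounded:
  obtains M where "M \<ge> 1" "\<And>f b j x. weight_bounded f b \<Longrightarrow> 0 \<le> b \<Longrightarrow> norm (vf_deriv (m $ j) f x) \<le> M * b * weight x"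
proof -
  define M where "M = 1 + (\<Sum>j\<in>UNIV. \<Sum>k\<in>UNIV. norm (m $ j $ k))"
  have "norm (vf_deriv (m $ j) f x) \<le> M * b * weight x" if "weight_bounded f b" "0 \<le> b" for f b j x
  proof -
    have bw: "b * weight x \<ge> 0" using that weight_pos[of x] by simp
    have "norm (vf_deriv (m $ j) f x) \<le> (\<Sum>k\<in>UNIV. norm (m $ j $ k) * (b * weight x))"
      unfolding vf_deriv_def using that
      by (intro sum_norm_le) (auto simp: norm_mult weight_bounded_def intro!: mult_left_mono)
    also have "\<dots> = (\<Sum>k\<in>UNIV. norm (m $ j $ k)) * (b * weight x)" by (simp add: sum_distrib_right)
    also have "\<dots> \<le> M * (b * weight x)"
    proof (rule mult_right_mono[OF _ bw])
      have "(\<Sum>k\<in>UNIV. norm (m $ j $ k)) \<le> (\<Sum>j\<in>UNIV. \<Sum>k\<in>UNIV. norm (m $ j $ k))"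
        by (rule member_le_sum) (auto simp: sum_nonneg)
      then show "(\<Sum>k\<in>UNIV. norm (m $ j $ k)) \<le> M" by (simp add: M_def)
    qed
    finally show ?thesis by (simp add: mult_ac)
  qed
  moreover have "M \<ge> 1" by (simp add: M_def sum_nonneg)
  ultimately show thesis using that by blast
qed

definition riesz_form :: "(real ^ 'N \<Rightarrow> real) \<Rightarrow> (real ^ 'N \<Rightarrow> real) \<Rightarrow> ennreal" where
  "riesz_form v u = (\<integral>\<^sup>+y. \<integral>\<^sup>+z. ennreal (weight y * weight z * (v y * u z * riesz (y - z))) \<partial>lborel \<partial>lborel)"

text \<open>The mollified bound along \<open>e = 1 / real (Suc n)\<close>: the right side is the
  same for all \<open>n\<close>, while the pairing on the left tends to the mass of
  \<open>delta 1\<close> times the plain pairing. The mass is divided out in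
  \<open>C\<close>.\<close>

lemma pairing_bound:
  assumes p: "1 < p" "1 < p'" "1 / p + 1 / p' = 1"
  obtains C where "C > 0" "\<And>\<psi>1 \<psi>2 V w g B. test_function \<psi>1 \<Longrightarrow> test_function \<psi>2 \<Longrightarrow>
    V \<in> borel_measurable borel \<Longrightarrow> w \<in> borel_measurable borel \<Longrightarrow> g \<in> borel_measurable borel \<Longrightarrow>
    (\<integral>\<^sup>+x. ennreal (norm (V x) powr p) \<partial>lborel) < top \<Longrightarrow> (\<integral>\<^sup>+x. ennreal (norm (w x) powr p') \<partial>lborel) < top \<Longrightarrow>
    (\<integral>\<^sup>+x. ennreal (norm (g x) powr p') \<partial>lborel) < top \<Longrightarrow>
    weak_curl w g \<Longrightarrow> div_free V \<Longrightarrow> B \<ge> 0 \<Longrightarrow> weight_bounded \<psi>1 B \<Longrightarrow> weight_bounded \<psi>2 B \<Longrightarrow>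
    ennreal (norm (\<Sum>j\<in>UNIV. LINT y|lborel. (V y $ j * \<psi>1 y) * (w y $ j * \<psi>2 y)))
     \<le> ennreal (C * B\<^sup>2) * riesz_form (\<lambda>y. norm (V y)) (\<lambda>z. norm (w z) + norm (g z))"
proof (rule mollified_pairing_bound[folded riesz_form_def], goal_cases)
  case (1 C0)
  note C0 = this(2,3)
  obtain M where M: "M \<ge> 1" "\<And>f b j x. weight_bounded f b \<Longrightarrow> 0 \<le> b \<Longrightarrow> norm (vf_deriv (m $ j) f x) \<le> M * b * weight x"
    using vf_deriv_weight_bounded by blast
  define c where "c = (LINT x|lborel. delta 1 x)"
  have c: "c > 0" unfolding c_def by (rule delta_integral_pos)
  define C where "C = C0 * M\<^sup>2 / c"
  have C: "C > 0" using C0(1) M(1) c by (simp add: C_def)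
  show ?case
  proof (rule that[OF C])
    fix \<psi>1 \<psi>2 :: "real ^ 'N \<Rightarrow> complex" and V w :: "real ^ 'N \<Rightarrow> complex ^ 'n"
      and g :: "real ^ 'N \<Rightarrow> complex ^ 'n ^ 'n" and B :: real
    assume \<psi>: "test_function \<psi>1" "test_function \<psi>2"
      and [measurable]: "V \<in> borel_measurable borel" "w \<in> borel_measurable borel" "g \<in> borel_measurable borel"
      and fin: "(\<integral>\<^sup>+x. ennreal (norm (V x) powr p) \<partial>lborel) < top" "(\<integral>\<^sup>+x. ennreal (norm (w x) powr p') \<partial>lborel) < top"
        "(\<integral>\<^sup>+x. ennreal (norm (g x) powr p') \<partial>lborel) < top"
      and weak: "weak_curl w g" "div_free V" and B: "B \<ge> 0" and wb: "weight_bounded \<psi>1 B" "weight_bounded \<psi>2 B"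
    let ?I = "riesz_form (\<lambda>y. norm (V y)) (\<lambda>z. norm (w z) + norm (g z))"
    have comp: "cmod (V y $ j) \<le> 1 * norm (V y)" "cmod (w y $ j) \<le> 1 * norm (w y)" "cmod (g y $ i $ j) \<le> 1 * norm (g y)" for y i j
      unfolding mult_1 by (rule Finite_Cartesian_Product.norm_nth_le Finite_Cartesian_Product.norm_nth_le[THEN order_trans])+
    have Vf: "(\<integral>\<^sup>+x. ennreal (norm (V x $ j) powr p) \<partial>lborel) < top" for j
      by (rule nn_integral_powr_le_finite[OF fin(1) comp(1)]) (use p in simp_all)
    have wf: "(\<integral>\<^sup>+x. ennreal (norm (w x $ j) powr p') \<partial>lborel) < top" for j
      by (rule nn_integral_powr_le_finite[OF fin(2) comp(2)]) (use p in simp_all)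
    have gf: "(\<integral>\<^sup>+x. ennreal (norm (g x $ i $ j) powr p') \<partial>lborel) < top" for i j
      by (rule nn_integral_powr_le_finite[OF fin(3) comp(3)]) (use p in simp_all)
    have loc: "loc_int (\<lambda>x. V x $ j)" "loc_int (\<lambda>x. w x $ j)" "loc_int (\<lambda>x. g x $ i $ j)" for i j
      by (rule loc_int_Lp[OF _ p(1) Vf] loc_int_Lp[OF _ p(2) wf] loc_int_Lp[OF _ p(2) gf], measurable)+
    let ?J = "\<lambda>n. \<Sum>j\<in>UNIV. LINT y|lborel. LINT z|lborel. (V y $ j * \<psi>1 y) * of_real (delta (1 / real (Suc n)) (y - z)) * (w z $ j * \<psi>2 z)"
    let ?S = "\<Sum>j\<in>UNIV. LINT y|lborel. (V y $ j * \<psi>1 y) * (w y $ j * \<psi>2 y)"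
    have BM: "B \<le> M * B" using M(1) B by (simp add: mult_le_cancel_right1)
    have J: "ennreal (norm (?J n)) \<le> ennreal (C0 * (M * B)\<^sup>2) * ?I" for n
    proof (rule C0(2))
      show "norm (\<psi>1 x) \<le> M * B * weight x" "norm (\<psi>2 x) \<le> M * B * weight x" for x
        using wb BM weight_pos[of x] unfolding weight_bounded_def by (meson less_imp_le mult_right_mono order_trans)+
      show "norm (vf_deriv (m $ j) \<psi>1 x) \<le> M * B * weight x" "norm (vf_deriv (m $ j) \<psi>2 x) \<le> M * B * weight x" for j x
        using M(2) wb B by blast+
    qed (use \<psi> loc weak B M in auto)
    have lim: "?J \<longlonglongrightarrow> (\<Sum>j\<in>UNIV. of_real c * (LINT y|lborel. (V y $ j * \<psi>1 y) * (w y $ j * \<psi>2 y)))"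
      unfolding c_def
    proof (intro tendsto_sum delta_pairing_tendsto[OF _ _ p] comp_int_mult loc \<psi>)
      fix j
      obtain B1 B2 where B12: "B1 \<ge> 0" "\<And>x. norm (\<psi>1 x) \<le> B1" "B2 \<ge> 0" "\<And>x. norm (\<psi>2 x) \<le> B2"
        using test_function_bounded[OF \<psi>(1)] test_function_bounded[OF \<psi>(2)] by metis
      have "norm (V x $ j * \<psi>1 x) \<le> B1 * norm (V x $ j)" "norm (w x $ j * \<psi>2 x) \<le> B2 * norm (w x $ j)" for x
        using B12 by (auto simp: norm_mult mult.commute[of "cmod (V x $ j)"] mult.commute[of "cmod (w x $ j)"] intro!: mult_right_mono)
      then show "(\<integral>\<^sup>+x. ennreal (norm (V x $ j * \<psi>1 x) powr p) \<partial>lborel) < top" "(\<integral>\<^sup>+x. ennreal (norm (w x $ j * \<psi>2 x) powr p') \<partial>lborel) < top"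
        using p B12 by (auto intro!: nn_integral_powr_le_finite[OF Vf] nn_integral_powr_le_finite[OF wf])
    qed
    then have "(\<lambda>n. ennreal (norm (?J n))) \<longlonglongrightarrow> ennreal (norm (of_real c * ?S))"
      by (intro tendsto_ennrealI tendsto_norm) (simp add: sum_distrib_left)
    then have "ennreal (norm (of_real c * ?S)) \<le> ennreal (C0 * (M * B)\<^sup>2) * ?I"
      by (rule tendsto_upperbound) (use J in auto)
    then have "ennreal (1 / c) * ennreal (norm (of_real c * ?S)) \<le> ennreal (1 / c) * (ennreal (C0 * (M * B)\<^sup>2) * ?I)"
      by (rule mult_left_mono) simp
    moreover have "ennreal (1 / c) * ennreal (norm (of_real c * ?S)) = ennreal (norm ?S)"
      using c by (simp add: ennreal_mult'[symmetric] norm_mult)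
    moreover have "ennreal (1 / c) * (ennreal (C0 * (M * B)\<^sup>2) * ?I) = ennreal (C * B\<^sup>2) * ?I"
    proof -
      have "1 / c * (C0 * (M * B)\<^sup>2) = C * B\<^sup>2" by (simp add: C_def power_mult_distrib)
      then show ?thesis using c C0(1) by (simp only: mult.assoc[symmetric]) (simp add: ennreal_mult'[symmetric])
    qed
    ultimately show "ennreal (norm ?S) \<le> ennreal (C * B\<^sup>2) * ?I" by simp
  qed
qed

text \<open>\<phi> is the pointwise limit of products of two test functions whose weight bounds do
  not depend on \<open>n\<close>; dominated convergence carries the estimate over.\<close>

lemma schwartz_pairing_bound:
  assumes p: "1 < p" "1 < p'" "1 / p + 1 / p' = 1" and \<phi>: "schwartz \<phi>"
  obtains C where "C > 0" "\<And>V w g.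
    V \<in> borel_measurable borel \<Longrightarrow> w \<in> borel_measurable borel \<Longrightarrow> g \<in> borel_measurable borel \<Longrightarrow>
    (\<integral>\<^sup>+x. ennreal (norm (V x) powr p) \<partial>lborel) < top \<Longrightarrow> (\<integral>\<^sup>+x. ennreal (norm (w x) powr p') \<partial>lborel) < top \<Longrightarrow>
    (\<integral>\<^sup>+x. ennreal (norm (g x) powr p') \<partial>lborel) < top \<Longrightarrow> weak_curl w g \<Longrightarrow> div_free V \<Longrightarrow>
    ennreal (norm (LINT y|lborel. (\<Sum>j\<in>UNIV. V y $ j * w y $ j) * \<phi> y))
     \<le> ennreal C * riesz_form (\<lambda>y. norm (V y)) (\<lambda>z. norm (w z) + norm (g z))"
proof (rule pairing_bound[OF p], goal_cases)
  case (1 C0)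
  note C0 = this(2,3)
  obtain b where b: "b \<ge> 0" "weight_bounded (\<lambda>x. \<phi> x * complex_of_real (1 / weight x)) b"
    using weight_bounded_schwartz[OF \<phi>] by blast
  obtain K where K: "K \<ge> 1" "\<And>f b c. weight_bounded (f :: real ^ 'N \<Rightarrow> complex) b \<Longrightarrow> 0 \<le> b \<Longrightarrow> 0 < c \<Longrightarrow> c \<le> 1 \<Longrightarrow>
      weight_bounded (\<lambda>x. f x * cutoff (c *\<^sub>R x)) (b * K)" "\<And>x :: real ^ 'N. norm (cutoff x) \<le> K"
    using weight_bounded_cutoff by blast
  let ?s = "real CARD('N) / 2 + 1"
  \<comment> \<open>A common bound for both families: \<open>b\<close> belongs to \<phi> divided by
    the weight, \<open>?s\<close> to the weight itself.\<close>
  define B where "B = b * K + ?s * K + 1"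
  have B: "B > 0" "b * K \<le> B" "?s * K \<le> B" using b K(1) by (auto simp: B_def add_nonneg_pos add_increasing add_increasing2)
  have mono: "weight_bounded f b'" if "weight_bounded f b" "b \<le> b'" for f :: "real ^ 'N \<Rightarrow> complex" and b b'
    using that unfolding weight_bounded_def
    by (meson less_imp_le mult_right_mono order_trans weight_pos)
  \<comment> \<open>The weight cancels in the product with \<psi>2, leaving \<phi> times the square
    of a cutoff that tends to 1.\<close>
  define \<psi>1 where "\<psi>1 n x = \<phi> x * complex_of_real (1 / weight x) * cutoff ((1 / real (Suc n)) *\<^sub>R x)" for n x
  define \<psi>2 where "\<psi>2 n x = complex_of_real (weight x) * cutoff ((1 / real (Suc n)) *\<^sub>R x)" for n and x :: "real ^ 'N"
  have wb: "weight_bounded (\<psi>1 n) B" "weight_bounded (\<psi>2 n) B" for n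
    unfolding \<psi>1_def \<psi>2_def
    by (rule mono[OF K(2)[OF b(2,1)] B(2)] mono[OF K(2)[OF weight_bounded_weight] B(3)]; simp)+
  have tc: "test_function (\<lambda>x :: real ^ 'N. cutoff ((1 / real (Suc n)) *\<^sub>R x))" for n
    using test_function_affine[OF test_function_cutoff, of "1 / real (Suc n)" 0] by simp
  have t: "test_function (\<psi>1 n)" "test_function (\<psi>2 n)" for n
    unfolding \<psi>1_def \<psi>2_def
    by (rule test_function_mult'[OF conjunct1[OF b(2)[unfolded weight_bounded_def]] tc]
          test_function_mult'[OF conjunct1[OF weight_bounded_weight[unfolded weight_bounded_def]] tc])+
  have prod: "\<psi>1 n x * \<psi>2 n x = \<phi> x * (cutoff ((1 / real (Suc n)) *\<^sub>R x))\<^sup>2" for n x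
    using weight_pos[of x] by (simp add: \<psi>1_def \<psi>2_def power2_eq_square)
  have [measurable]: "\<phi> \<in> borel_measurable borel" using \<phi> smooth_borel by (auto simp: schwartz_def)
  have [measurable]: "(\<lambda>x :: real ^ 'N. cutoff ((1 / real (Suc n)) *\<^sub>R x)) \<in> borel_measurable borel" for n
    by (rule smooth_borel[OF test_function_smooth[OF tc]])
  obtain b0 where b0: "\<And>x. norm (\<phi> x) \<le> b0"
    using \<phi>[unfolded schwartz_def, THEN conjunct2, rule_format, of 0 "[]"] by (auto simp: iter_partial_def)
  have b0': "b0 \<ge> 0" using b0[of 0] norm_ge_zero order_trans by blast
  show ?case
  proof (rule that[of "C0 * B\<^sup>2"])
    show "C0 * B\<^sup>2 > 0" using C0 B by simp
    fix V w :: "real ^ 'N \<Rightarrow> complex ^ 'n" and g :: "real ^ 'N \<Rightarrow> complex ^ 'n ^ 'n"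
    assume [measurable]: "V \<in> borel_measurable borel" "w \<in> borel_measurable borel" "g \<in> borel_measurable borel"
      and fin: "(\<integral>\<^sup>+x. ennreal (norm (V x) powr p) \<partial>lborel) < top" "(\<integral>\<^sup>+x. ennreal (norm (w x) powr p') \<partial>lborel) < top"
        "(\<integral>\<^sup>+x. ennreal (norm (g x) powr p') \<partial>lborel) < top"
      and weak: "weak_curl w g" "div_free V"
    let ?I = "riesz_form (\<lambda>y. norm (V y)) (\<lambda>z. norm (w z) + norm (g z))"
    have comp: "cmod (V y $ j) \<le> 1 * norm (V y)" "cmod (w y $ j) \<le> 1 * norm (w y)" for y j
      unfolding mult_1 by (rule Finite_Cartesian_Product.norm_nth_le)+
    have Vf: "(\<integral>\<^sup>+x. ennreal (norm (V x $ j) powr p) \<partial>lborel) < top" for j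
      by (rule nn_integral_powr_le_finite[OF fin(1) comp(1)]) (use p in simp_all)
    have wf: "(\<integral>\<^sup>+x. ennreal (norm (w x $ j) powr p') \<partial>lborel) < top" for j
      by (rule nn_integral_powr_le_finite[OF fin(2) comp(2)]) (use p in simp_all)
    have int: "integrable lborel (\<lambda>y. V y $ j * w y $ j)" for j
    proof (rule integrableI_bounded)
      obtain A where "A \<ge> 0" "\<And>v. (\<integral>\<^sup>+y. ennreal (norm (V y $ j) * norm (w (y - v) $ j)) \<partial>lborel) \<le> ennreal A"
        using nn_integral_translate_bounded[OF _ _ p Vf[of j] wf[of j]] by auto
      from this(2)[of 0] show "(\<integral>\<^sup>+y. ennreal (norm (V y $ j * w y $ j)) \<partial>lborel) < \<infinity>"
        by (auto simp: norm_mult intro: le_less_trans)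
    qed measurable
    have int\<phi>: "integrable lborel (\<lambda>y. V y $ j * w y $ j * \<phi> y)" for j
    proof (rule Bochner_Integration.integrable_bound)
      show "integrable lborel (\<lambda>y. of_real b0 * (V y $ j * w y $ j))" using int by simp
      show "AE y in lborel. norm (V y $ j * w y $ j * \<phi> y) \<le> norm (of_real b0 * (V y $ j * w y $ j))"
      proof (rule AE_I2)
        fix y
        show "norm (V y $ j * w y $ j * \<phi> y) \<le> norm (of_real b0 * (V y $ j * w y $ j))"
          using mult_right_mono[OF b0[of y], of "cmod (V y $ j) * cmod (w y $ j)"] b0' by (simp add: norm_mult mult_ac)
      qed
    qed measurable
    let ?S = "\<lambda>n. \<Sum>j\<in>UNIV. LINT y|lborel. (V y $ j * \<psi>1 n y) * (w y $ j * \<psi>2 n y)"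
    have S: "ennreal (norm (?S n)) \<le> ennreal (C0 * B\<^sup>2) * ?I" for n
      by (rule C0(2)) (use t wb fin weak B in auto)
    have "?S \<longlonglongrightarrow> (\<Sum>j\<in>UNIV. LINT y|lborel. V y $ j * w y $ j * \<phi> y)"
    proof (rule tendsto_sum)
      fix j
      have eq: "(V y $ j * \<psi>1 n y) * (w y $ j * \<psi>2 n y) = V y $ j * w y $ j * \<phi> y * (cutoff ((1 / real (Suc n)) *\<^sub>R y))\<^sup>2" for n y
        using prod[of n y] by (simp add: mult_ac)
      show "(\<lambda>n. LINT y|lborel. (V y $ j * \<psi>1 n y) * (w y $ j * \<psi>2 n y)) \<longlonglongrightarrow> (LINT y|lborel. V y $ j * w y $ j * \<phi> y)"
        unfolding eq
      proof (rule integral_dominated_convergence[where w = "\<lambda>y. K\<^sup>2 * norm (V y $ j * w y $ j * \<phi> y)"])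
        show "integrable lborel (\<lambda>y. K\<^sup>2 * norm (V y $ j * w y $ j * \<phi> y))" using int\<phi> by simp
        show "AE y in lborel. (\<lambda>n. V y $ j * w y $ j * \<phi> y * (cutoff ((1 / real (Suc n)) *\<^sub>R y))\<^sup>2) \<longlonglongrightarrow> V y $ j * w y $ j * \<phi> y"
        proof (rule AE_I2)
          fix y :: "real ^ 'N"
          have "(\<lambda>n. (1 / real (Suc n)) *\<^sub>R y) \<longlonglongrightarrow> 0 *\<^sub>R y"
            by (intro tendsto_intros) (use LIMSEQ_inverse_real_of_nat in \<open>simp add: inverse_eq_divide\<close>)
          then have "(\<lambda>n. cutoff ((1 / real (Suc n)) *\<^sub>R y)) \<longlonglongrightarrow> cutoff (0 :: real ^ 'N)"
            using continuous_on_tendsto_compose[OF smooth_continuous_on[OF test_function_smooth[OF test_function_cutoff], of UNIV]] by auto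
          then have "(\<lambda>n. V y $ j * w y $ j * \<phi> y * (cutoff ((1 / real (Suc n)) *\<^sub>R y))\<^sup>2) \<longlonglongrightarrow> V y $ j * w y $ j * \<phi> y * (cutoff (0 :: real ^ 'N))\<^sup>2"
            by (intro tendsto_intros)
          then show "(\<lambda>n. V y $ j * w y $ j * \<phi> y * (cutoff ((1 / real (Suc n)) *\<^sub>R y))\<^sup>2) \<longlonglongrightarrow> V y $ j * w y $ j * \<phi> y"
            by (simp add: cutoff_0)
        qed
        show "AE y in lborel. norm (V y $ j * w y $ j * \<phi> y * (cutoff ((1 / real (Suc n)) *\<^sub>R y))\<^sup>2) \<le> K\<^sup>2 * norm (V y $ j * w y $ j * \<phi> y)" for n
        proof (rule AE_I2)
          fix y :: "real ^ 'N"
          have "norm ((cutoff ((1 / real (Suc n)) *\<^sub>R y))\<^sup>2) \<le> K\<^sup>2"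
            unfolding norm_power by (intro power_mono K) simp
          then show "norm (V y $ j * w y $ j * \<phi> y * (cutoff ((1 / real (Suc n)) *\<^sub>R y))\<^sup>2) \<le> K\<^sup>2 * norm (V y $ j * w y $ j * \<phi> y)"
            unfolding norm_mult[of _ "(cutoff _)\<^sup>2"] mult.commute[of _ "norm ((cutoff _)\<^sup>2)"] by (intro mult_right_mono) auto
        qed
      qed measurable
    qed
    then have "(\<lambda>n. ennreal (norm (?S n))) \<longlonglongrightarrow> ennreal (norm (\<Sum>j\<in>UNIV. LINT y|lborel. V y $ j * w y $ j * \<phi> y))"
      by (intro tendsto_ennrealI tendsto_norm)
    then have "ennreal (norm (\<Sum>j\<in>UNIV. LINT y|lborel. V y $ j * w y $ j * \<phi> y)) \<le> ennreal (C0 * B\<^sup>2) * ?I"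
      by (rule tendsto_upperbound) (use S in auto)
    also have "(\<Sum>j\<in>UNIV. LINT y|lborel. V y $ j * w y $ j * \<phi> y) = (LINT y|lborel. (\<Sum>j\<in>UNIV. V y $ j * w y $ j) * \<phi> y)"
      unfolding sum_distrib_right by (rule Bochner_Integration.integral_sum[symmetric]) (rule int\<phi>)
    finally show "ennreal (norm (LINT y|lborel. (\<Sum>j\<in>UNIV. V y $ j * w y $ j) * \<phi> y)) \<le> ennreal (C0 * B\<^sup>2) * ?I" .
  qed
qed

end

section \<open>The maximal function of the product\<close>

text \<open>The test function is transported by the inverse of the map
  \<open>\<lambda>y. x + s *\<^sub>R y\<close>. Relative to the plain pairing, a derivative
  contributes the extra factor \<open>s\<close>.\<close>

lemma weak_affine:
  fixes f :: "real ^ 'N \<Rightarrow> complex" and x :: "real ^ 'N"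
  assumes s: "s \<noteq> 0" and \<eta>: "test_function \<eta>" and [measurable]: "f \<in> borel_measurable borel"
  defines "\<eta>' \<equiv> \<lambda>z. \<eta> ((- 1 / s) *\<^sub>R x + (1 / s) *\<^sub>R z)"
  shows "test_function \<eta>'"
    and "(LINT y|lborel. f (x + s *\<^sub>R y) * \<eta> y) = of_real (1 / \<bar>s\<bar> ^ CARD('N)) * (LINT z|lborel. f z * \<eta>' z)"
    and "(LINT y|lborel. f (x + s *\<^sub>R y) * vf_deriv a \<eta> y) = of_real (s / \<bar>s\<bar> ^ CARD('N)) * (LINT z|lborel. f z * vf_deriv a \<eta>' z)"
proof -
  show t: "test_function \<eta>'"
    unfolding \<eta>'_def by (rule test_function_affine[OF \<eta>]) (use s in simp)
  have inv: "(- 1 / s) *\<^sub>R x + (1 / s) *\<^sub>R (x + s *\<^sub>R y) = y" for y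
    using s by (simp add: scaleR_add_right)
  have cv: "(LINT z|lborel. f z * h z) = of_real (\<bar>s\<bar> ^ CARD('N)) * (LINT y|lborel. f (x + s *\<^sub>R y) * h (x + s *\<^sub>R y))"
    if [measurable]: "h \<in> borel_measurable borel" for h
    using integral_lborel_affine[OF s, of "\<lambda>z. f z * h z" x] by (simp add: scaleR_conv_of_real)
  have pw: "\<bar>s\<bar> ^ CARD('N) \<noteq> 0" using s by simp
  have "(LINT z|lborel. f z * \<eta>' z) = of_real (\<bar>s\<bar> ^ CARD('N)) * (LINT y|lborel. f (x + s *\<^sub>R y) * \<eta> y)"
    using cv[OF smooth_borel[OF test_function_smooth[OF t]]] by (simp only: \<eta>'_def inv)
  then show "(LINT y|lborel. f (x + s *\<^sub>R y) * \<eta> y) = of_real (1 / \<bar>s\<bar> ^ CARD('N)) * (LINT z|lborel. f z * \<eta>' z)"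
    using pw by simp
  have vf: "vf_deriv a \<eta>' z = of_real (1 / s) * vf_deriv a \<eta> ((- 1 / s) *\<^sub>R x + (1 / s) *\<^sub>R z)" for z
    unfolding \<eta>'_def by (rule vf_deriv_affine[OF test_function_smooth[OF \<eta>]])
  have vfa: "vf_deriv a \<eta>' (x + s *\<^sub>R y) = of_real (1 / s) * vf_deriv a \<eta> y" for y
    by (simp only: vf inv)
  have "(LINT z|lborel. f z * vf_deriv a \<eta>' z) = of_real (\<bar>s\<bar> ^ CARD('N)) * (LINT y|lborel. f (x + s *\<^sub>R y) * (of_real (1 / s) * vf_deriv a \<eta> y))"
    using cv[OF smooth_borel[OF smooth_vf_deriv[OF test_function_smooth[OF t]]]] by (simp only: vfa)
  also have "(LINT y|lborel. f (x + s *\<^sub>R y) * (of_real (1 / s) * vf_deriv a \<eta> y)) = of_real (1 / s) * (LINT y|lborel. f (x + s *\<^sub>R y) * vf_deriv a \<eta> y)"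
    by (simp only: mult.left_commute[of _ "of_real (1 / s)"] integral_mult_right_zero)
  finally show "(LINT y|lborel. f (x + s *\<^sub>R y) * vf_deriv a \<eta> y) = of_real (s / \<bar>s\<bar> ^ CARD('N)) * (LINT z|lborel. f z * vf_deriv a \<eta>' z)"
    using pw s by simp
qed

lemma nn_integral_affine_finite:
  fixes f :: "'a::euclidean_space \<Rightarrow> ennreal"
  assumes [measurable]: "f \<in> borel_measurable borel" and "s \<noteq> 0" "(\<integral>\<^sup>+y. f y \<partial>lborel) < top"
  shows "(\<integral>\<^sup>+y. f (x + s *\<^sub>R y) \<partial>lborel) < top"
  using assms(3) nn_integral_lborel_affine[OF assms(1,2), of x] assms(2)
  by (auto simp: ennreal_mult_less_top)

context elliptic begin

lemma div_free_affine:
  assumes "div_free V" "s \<noteq> 0" and [measurable]: "V \<in> borel_measurable borel"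
  shows "div_free (\<lambda>y. V (x + s *\<^sub>R y))"
  unfolding div_free_def
proof (intro allI impI)
  fix \<eta> :: "real ^ 'N \<Rightarrow> complex" assume \<eta>: "test_function \<eta>"
  let ?\<eta> = "\<lambda>z. \<eta> ((- 1 / s) *\<^sub>R x + (1 / s) *\<^sub>R z)"
  have "test_function ?\<eta>" by (rule weak_affine(1)[OF assms(2) \<eta> borel_measurable_const])
  then have z: "(\<Sum>j\<in>UNIV. LINT z|lborel. V z $ j * vf_deriv (m $ j) ?\<eta> z) = 0"
    using assms(1) unfolding div_free_def by blast
  have "(LINT y|lborel. V (x + s *\<^sub>R y) $ j * vf_deriv (m $ j) \<eta> y)
      = of_real (s / \<bar>s\<bar> ^ CARD('N)) * (LINT z|lborel. V z $ j * vf_deriv (m $ j) ?\<eta> z)" for j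
    by (rule weak_affine(3)[OF assms(2) \<eta>]) measurable
  then show "(\<Sum>j\<in>UNIV. LINT y|lborel. V (x + s *\<^sub>R y) $ j * vf_deriv (m $ j) \<eta> y) = 0"
    by (simp only: sum_distrib_left[symmetric] z mult_zero_right)
qed

text \<open>The curl contains one derivative and therefore acquires one factor \<open>s\<close>. For
  \<open>\<bar>s\<bar> \<le> 1\<close> the rescaled curl is controlled by the original one, which is
  why the estimate concerns the local maximal function.\<close>

lemma weak_curl_affine:
  assumes "weak_curl w g" "s \<noteq> 0" and [measurable]: "w \<in> borel_measurable borel" "g \<in> borel_measurable borel"
  shows "weak_curl (\<lambda>y. w (x + s *\<^sub>R y)) (\<lambda>y. s *\<^sub>R g (x + s *\<^sub>R y))"
  unfolding weak_curl_def
proof (intro allI impI)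
  fix \<eta> :: "real ^ 'N \<Rightarrow> complex" and i j assume \<eta>: "test_function \<eta>"
  note wa = weak_affine[OF assms(2) \<eta>, where x = x]
  let ?\<eta> = "\<lambda>z. \<eta> ((- 1 / s) *\<^sub>R x + (1 / s) *\<^sub>R z)"
  let ?c = "complex_of_real (s / \<bar>s\<bar> ^ CARD('N))"
  have "test_function ?\<eta>" by (rule weak_affine(1)[OF assms(2) \<eta> borel_measurable_const])
  then have c0: "(LINT z|lborel. w z $ j * vf_deriv (m $ i) ?\<eta> z) - (LINT z|lborel. w z $ i * vf_deriv (m $ j) ?\<eta> z)
      = - (LINT z|lborel. g z $ i $ j * ?\<eta> z)"
    using assms(1) unfolding weak_curl_def by blast
  have "(LINT y|lborel. w (x + s *\<^sub>R y) $ j * vf_deriv (m $ i) \<eta> y) - (LINT y|lborel. w (x + s *\<^sub>R y) $ i * vf_deriv (m $ j) \<eta> y)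
     = ?c * ((LINT z|lborel. w z $ j * vf_deriv (m $ i) ?\<eta> z) - (LINT z|lborel. w z $ i * vf_deriv (m $ j) ?\<eta> z))"
    using wa(3)[of "\<lambda>z. w z $ j" "m $ i"] wa(3)[of "\<lambda>z. w z $ i" "m $ j"] by (simp add: right_diff_distrib)
  also have "\<dots> = ?c * (- (LINT z|lborel. g z $ i $ j * ?\<eta> z))"
    by (simp only: c0)
  also have "\<dots> = - (of_real s * (LINT y|lborel. g (x + s *\<^sub>R y) $ i $ j * \<eta> y))"
    using wa(2)[of "\<lambda>z. g z $ i $ j"] by simp
  also have "of_real s * (LINT y|lborel. g (x + s *\<^sub>R y) $ i $ j * \<eta> y) = (LINT y|lborel. (s *\<^sub>R g (x + s *\<^sub>R y)) $ i $ j * \<eta> y)"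
  proof -
    have "(s *\<^sub>R g (x + s *\<^sub>R y)) $ i $ j * \<eta> y = of_real s * (g (x + s *\<^sub>R y) $ i $ j * \<eta> y)" for y
      by (simp add: scaleR_conv_of_real[where 'a = complex])
    then show ?thesis by (simp only: integral_mult_right_zero)
  qed
  finally show "(LINT y|lborel. w (x + s *\<^sub>R y) $ j * vf_deriv (m $ i) \<eta> y) - (LINT y|lborel. w (x + s *\<^sub>R y) $ i * vf_deriv (m $ j) \<eta> y)
     = - (LINT y|lborel. (s *\<^sub>R g (x + s *\<^sub>R y)) $ i $ j * \<eta> y)" .
qed

text \<open>Rescaling about \<open>x\<close> reduces to scale 1, where the Schwartz pairing bound
  and the bilinear Riesz bound apply to the rescaled fields. The weighted integrals of the powers
  \<open>p / q\<close> and \<open>p' / q\<close> are then bounded by maximal functions at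
  \<open>x\<close>, uniformly in \<open>t\<close>.\<close>

lemma local_maximal_bound:
  assumes p: "1 < p" "1 < p'" "1 / p + 1 / p' = 1" and \<phi>: "schwartz \<phi>"
    and q: "1 < q" "q \<le> p" "q \<le> p'" "real CARD('N) * (q - 1) < 1"
  obtains C where "C > 0" "\<And>V w g x t.
    V \<in> borel_measurable borel \<Longrightarrow> w \<in> borel_measurable borel \<Longrightarrow> g \<in> borel_measurable borel \<Longrightarrow>
    (\<integral>\<^sup>+x. ennreal (norm (V x) powr p) \<partial>lborel) < top \<Longrightarrow> (\<integral>\<^sup>+x. ennreal (norm (w x) powr p') \<partial>lborel) < top \<Longrightarrow>
    (\<integral>\<^sup>+x. ennreal (norm (g x) powr p') \<partial>lborel) < top \<Longrightarrow> weak_curl w g \<Longrightarrow> div_free V \<Longrightarrow>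
    0 < t \<Longrightarrow> t < 1 \<Longrightarrow>
    maximal_fun (\<lambda>y. ennreal (norm (V y) powr (p / q))) x < top \<Longrightarrow>
    maximal_fun (\<lambda>y. ennreal ((norm (w y) + norm (g y)) powr (p' / q))) x < top \<Longrightarrow>
    norm (LINT y|lborel. (\<Sum>j\<in>UNIV. V y $ j * w y $ j) * dilate t \<phi> (x - y))
     \<le> C * enn2real (maximal_fun (\<lambda>y. ennreal (norm (V y) powr (p / q))) x) powr (q / p)
         * enn2real (maximal_fun (\<lambda>y. ennreal ((norm (w y) + norm (g y)) powr (p' / q))) x) powr (q / p')"
proof (rule schwartz_pairing_bound[OF p \<phi>], goal_cases)
  case (1 C1)
  note C1 = this(2,3)
  let ?N = "real CARD('N)"
  \<comment> \<open>The weights of the bilinear bound: \<open>d + a = q / p\<close> and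
    \<open>d + b = q / p'\<close> produce the exponents \<open>p / q\<close> and
    \<open>p' / q\<close>, while \<open>q \<le> p'\<close> and \<open>q \<le> p\<close> make
    \<open>a\<close> and \<open>b\<close> non-negative.\<close>
  define d where "d = q - 1"
  define a where "a = 1 - q / p'"
  define b where "b = 1 - q / p"
  define r where "r = 1 / (1 - d)"
  have N: "?N \<ge> 1" by (simp add: Suc_leI)
  have d: "d > 0" "?N * d < 1" using q by (auto simp: d_def)
  have d1: "d < 1"
  proof -
    have "1 * d \<le> ?N * d" using N d(1) by (intro mult_right_mono) auto
    then show ?thesis using d(2) by linarith
  qed
  have qq: "q / p + q / p' = q" using arg_cong[OF p(3), of "\<lambda>z. q * z"] by (simp add: distrib_left)
  have e1: "a \<ge> 0" "b \<ge> 0" "d \<ge> 0" "r \<ge> 0" "p' / q > 0" "p / q > 0"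
    using q p d d1 by (auto simp: a_def b_def r_def)
  have e2: "d + a + b = 1" using qq by (simp add: d_def a_def b_def)
  have "d + a = q / p" "d + b = q / p'" using qq by (auto simp: d_def a_def b_def)
  then have e3: "p / q * (d + a) = 1" "p' / q * (d + b) = 1" using p q by simp_all
  have "a + b = 1 - d" using e2 by simp
  then have e4: "r * (a + b) = 1" using d1 by (simp add: r_def)
  \<comment> \<open>Cleared of denominators, this is \<open>?N * d < 1\<close>.\<close>
  have e5: "r * (real DIM(real ^ 'N) - 1) < DIM(real ^ 'N)"
    using d1 d(2) by (simp add: r_def field_simps)
  obtain C2 where C2: "C2 > 0" "\<And>(v :: real ^ 'N \<Rightarrow> real) u F G.
    v \<in> borel_measurable borel \<Longrightarrow> u \<in> borel_measurable borel \<Longrightarrow> (\<And>y. 0 \<le> v y) \<Longrightarrow> (\<And>y. 0 \<le> u y) \<Longrightarrow>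
    0 \<le> F \<Longrightarrow> 0 \<le> G \<Longrightarrow>
    (\<integral>\<^sup>+y. ennreal (weight y * v y powr (p / q)) \<partial>lborel) \<le> ennreal F \<Longrightarrow>
    (\<integral>\<^sup>+y. ennreal (weight y * u y powr (p' / q)) \<partial>lborel) \<le> ennreal G \<Longrightarrow>
    riesz_form v u \<le> ennreal (C2 * F powr (q / p) * G powr (q / p'))"
    unfolding riesz_form_def by (rule riesz_bilinear_bound[OF e1 e2 e3 e4 e5]) simp
  let ?cn = "2 ^ CARD('N) * 8 :: real"
  define C where "C = C1 * (C2 * ?cn powr (q / p) * ?cn powr (q / p'))"
  have C: "C > 0" unfolding C_def using C1(1) C2(1) by simp
  show ?case
  proof (rule "1"(1)[OF C])
    fix V w :: "real ^ 'N \<Rightarrow> complex ^ 'n" and g :: "real ^ 'N \<Rightarrow> complex ^ 'n ^ 'n" and x :: "real ^ 'N" and t :: real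
    assume [measurable]: "V \<in> borel_measurable borel" "w \<in> borel_measurable borel" "g \<in> borel_measurable borel"
      and fin: "(\<integral>\<^sup>+x. ennreal (norm (V x) powr p) \<partial>lborel) < top" "(\<integral>\<^sup>+x. ennreal (norm (w x) powr p') \<partial>lborel) < top"
        "(\<integral>\<^sup>+x. ennreal (norm (g x) powr p') \<partial>lborel) < top"
      and weak: "weak_curl w g" "div_free V" and t: "0 < t" "t < 1"
      and M: "maximal_fun (\<lambda>y. ennreal (norm (V y) powr (p / q))) x < top"
        "maximal_fun (\<lambda>y. ennreal ((norm (w y) + norm (g y)) powr (p' / q))) x < top"
    let ?u = "\<lambda>y. norm (w y) + norm (g y)"
    let ?MV = "maximal_fun (\<lambda>y. ennreal (norm (V y) powr (p / q))) x"
    let ?MU = "maximal_fun (\<lambda>y. ennreal (?u y powr (p' / q))) x"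
    \<comment> \<open>With \<open>y\<close> replaced by \<open>x - t y\<close>, the argument
      \<open>x - y\<close> of the dilate becomes \<open>t y\<close>, so the dilate turns into
      \<phi>, up to the Jacobian.\<close>
    define s where "s = - t"
    have s: "s \<noteq> 0" "\<bar>s\<bar> \<le> 1" using t by (auto simp: s_def)
    let ?V = "\<lambda>y. V (x + s *\<^sub>R y)" and ?w = "\<lambda>y. w (x + s *\<^sub>R y)" and ?g = "\<lambda>y. s *\<^sub>R g (x + s *\<^sub>R y)"
    have \<phi>m[measurable]: "\<phi> \<in> borel_measurable borel" using \<phi> smooth_borel by (auto simp: schwartz_def)
    have [measurable]: "dilate t \<phi> \<in> borel_measurable borel" unfolding dilate_def by measurable
    have "(LINT y|lborel. (\<Sum>j\<in>UNIV. V y $ j * w y $ j) * dilate t \<phi> (x - y))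
      = \<bar>s\<bar> ^ CARD('N) *\<^sub>R (LINT y|lborel. (\<Sum>j\<in>UNIV. ?V y $ j * ?w y $ j) * dilate t \<phi> (x - (x + s *\<^sub>R y)))"
      using integral_lborel_affine[OF s(1), of "\<lambda>y. (\<Sum>j\<in>UNIV. V y $ j * w y $ j) * dilate t \<phi> (x - y)" x] by simp
    also have "\<dots> = (LINT y|lborel. \<bar>s\<bar> ^ CARD('N) *\<^sub>R ((\<Sum>j\<in>UNIV. ?V y $ j * ?w y $ j) * dilate t \<phi> (x - (x + s *\<^sub>R y))))"
      by simp
    also have "\<dots> = (LINT y|lborel. (\<Sum>j\<in>UNIV. ?V y $ j * ?w y $ j) * \<phi> y)"
      using t by (intro Bochner_Integration.integral_cong refl) (simp add: dilate_def s_def)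
    finally have cv: "(LINT y|lborel. (\<Sum>j\<in>UNIV. V y $ j * w y $ j) * dilate t \<phi> (x - y)) = (LINT y|lborel. (\<Sum>j\<in>UNIV. ?V y $ j * ?w y $ j) * \<phi> y)" .
    have fing: "(\<integral>\<^sup>+x. ennreal (norm (s *\<^sub>R g x) powr p') \<partial>lborel) < top"
      using p by (intro nn_integral_powr_le_finite[OF fin(3), of _ "\<bar>s\<bar>"]) auto
    have "ennreal (norm (LINT y|lborel. (\<Sum>j\<in>UNIV. ?V y $ j * ?w y $ j) * \<phi> y))
      \<le> ennreal C1 * riesz_form (\<lambda>y. norm (?V y)) (\<lambda>z. norm (?w z) + norm (?g z))"
    proof (rule C1(2))
      show "weak_curl ?w ?g" "div_free ?V" using weak s(1) by (auto intro!: weak_curl_affine div_free_affine)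
      show "(\<integral>\<^sup>+y. ennreal (norm (?V y) powr p) \<partial>lborel) < top"
        using nn_integral_affine_finite[OF _ s(1) fin(1), of x] by simp
      show "(\<integral>\<^sup>+y. ennreal (norm (?w y) powr p') \<partial>lborel) < top"
        using nn_integral_affine_finite[OF _ s(1) fin(2), of x] by simp
      show "(\<integral>\<^sup>+y. ennreal (norm (?g y) powr p') \<partial>lborel) < top"
        using nn_integral_affine_finite[OF _ s(1) fing, of x] by simp
    qed measurable
    also have "riesz_form (\<lambda>y. norm (?V y)) (\<lambda>z. norm (?w z) + norm (?g z)) \<le> riesz_form (\<lambda>y. norm (?V y)) (\<lambda>z. ?u (x + s *\<^sub>R z))"
      unfolding riesz_form_def
    proof (intro nn_integral_mono ennreal_leI mult_left_mono mult_right_mono add_left_mono)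
      show "norm (?g z) \<le> norm (g (x + s *\<^sub>R z))" for z
        using s(2) by (simp add: mult_left_le_one_le)
    qed (auto simp: riesz_nonneg less_imp_le[OF weight_pos])
    also have "\<dots> \<le> ennreal (C2 * (?cn * enn2real ?MV) powr (q / p) * (?cn * enn2real ?MU) powr (q / p'))"
    proof (rule C2(2))
      have "(\<integral>\<^sup>+y. ennreal (weight y * norm (?V y) powr (p / q)) \<partial>lborel) \<le> ennreal ?cn * ?MV"
        using nn_integral_weight_le_maximal_fun[of "\<lambda>y. ennreal (norm (V y) powr (p / q))" s x] s(1)
        by (simp add: ennreal_mult'' less_imp_le[OF weight_pos])
      also have "\<dots> = ennreal (?cn * enn2real ?MV)" using M(1) by (simp add: ennreal_mult')
      finally show "(\<integral>\<^sup>+y. ennreal (weight y * norm (?V y) powr (p / q)) \<partial>lborel) \<le> ennreal (?cn * enn2real ?MV)" .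
      have "(\<integral>\<^sup>+y. ennreal (weight y * ?u (x + s *\<^sub>R y) powr (p' / q)) \<partial>lborel) \<le> ennreal ?cn * ?MU"
        using nn_integral_weight_le_maximal_fun[of "\<lambda>y. ennreal (?u y powr (p' / q))" s x] s(1)
        by (simp add: ennreal_mult'' less_imp_le[OF weight_pos])
      also have "\<dots> = ennreal (?cn * enn2real ?MU)" using M(2) by (simp add: ennreal_mult')
      finally show "(\<integral>\<^sup>+y. ennreal (weight y * ?u (x + s *\<^sub>R y) powr (p' / q)) \<partial>lborel) \<le> ennreal (?cn * enn2real ?MU)" .
    qed auto
    finally have "ennreal (norm (LINT y|lborel. (\<Sum>j\<in>UNIV. V y $ j * w y $ j) * dilate t \<phi> (x - y)))
       \<le> ennreal C1 * ennreal (C2 * (?cn * enn2real ?MV) powr (q / p) * (?cn * enn2real ?MU) powr (q / p'))"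
      unfolding cv by (simp add: mult_left_mono)
    also have "\<dots> = ennreal (C1 * (C2 * (?cn * enn2real ?MV) powr (q / p) * (?cn * enn2real ?MU) powr (q / p')))"
      using C1(1) by (simp add: ennreal_mult')
    also have "C1 * (C2 * (?cn * enn2real ?MV) powr (q / p) * (?cn * enn2real ?MU) powr (q / p'))
      = C * enn2real ?MV powr (q / p) * enn2real ?MU powr (q / p')"
      unfolding C_def by (subst (1 2) powr_mult) (auto simp only: mult_ac enn2real_nonneg)
    finally show "norm (LINT y|lborel. (\<Sum>j\<in>UNIV. V y $ j * w y $ j) * dilate t \<phi> (x - y))
       \<le> C * enn2real ?MV powr (q / p) * enn2real ?MU powr (q / p')"
      using C by (subst (asm) ennreal_le_iff) auto
  qed
qed

text \<open>The pointwise bound contains maximal functions of \<open>L^q\<close> functions to the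
  powers \<open>q / p\<close> and \<open>q / p'\<close>. Raised to \<open>p\<close> and
  \<open>p'\<close>, both become \<open>q\<close>-th powers of maximal functions, so Hoelder and the
  strong type bound lead back to the norms of \<open>V\<close>, \<open>w\<close> and
  \<open>g\<close>.\<close>

lemma maximal_integral_bound:
  assumes p: "1 < p" "1 < p'" "1 / p + 1 / p' = 1" and \<phi>: "schwartz \<phi>"
  obtains C where "C > 0" "\<And>V w g A B D.
    V \<in> borel_measurable borel \<Longrightarrow> w \<in> borel_measurable borel \<Longrightarrow> g \<in> borel_measurable borel \<Longrightarrow>
    0 \<le> A \<Longrightarrow> 0 \<le> B \<Longrightarrow> 0 \<le> D \<Longrightarrow>
    (\<integral>\<^sup>+x. ennreal (norm (V x) powr p) \<partial>lborel) \<le> ennreal (A powr p) \<Longrightarrow>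
    (\<integral>\<^sup>+x. ennreal (norm (w x) powr p') \<partial>lborel) \<le> ennreal (B powr p') \<Longrightarrow>
    (\<integral>\<^sup>+x. ennreal (norm (g x) powr p') \<partial>lborel) \<le> ennreal (D powr p') \<Longrightarrow> weak_curl w g \<Longrightarrow> div_free V \<Longrightarrow>
    (\<integral>\<^sup>+x. (SUP t\<in>{0<..<1}. ennreal (norm (LINT y|lborel. (\<Sum>j\<in>UNIV. V y $ j * w y $ j) * dilate t \<phi> (x - y)))) \<partial>lborel)
     \<le> ennreal (C * A * (B + D))"
proof -
  let ?N = "real CARD('N)"
  \<comment> \<open>The third entry gives \<open>?N * (q - 1) \<le> 1 / 2\<close>; the others keep
    \<open>q\<close> at most \<open>p\<close> and \<open>p'\<close>.\<close>
  define q where "q = Min {p, p', 1 + 1 / (2 * ?N)}"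
  have q: "1 < q" "q \<le> p" "q \<le> p'" "?N * (q - 1) < 1"
  proof -
    show "1 < q" "q \<le> p" "q \<le> p'" using p by (auto simp: q_def)
    have "q \<le> 1 + 1 / (2 * ?N)" by (simp add: q_def)
    then have "?N * (q - 1) \<le> ?N * (1 / (2 * ?N))" by (intro mult_left_mono) auto
    then show "?N * (q - 1) < 1" by simp
  qed
  show thesis
  proof (rule local_maximal_bound[OF p \<phi> q], goal_cases)
    case (1 C1)
    note C1 = this
    obtain C3 where C3: "C3 > 0" "\<And>g :: real ^ 'N \<Rightarrow> real.
      g \<in> borel_measurable borel \<Longrightarrow> (\<And>x. 0 \<le> g x) \<Longrightarrow> (\<integral>\<^sup>+x. ennreal (g x powr q) \<partial>lborel) < top \<Longrightarrow>
      (AE x in lborel. maximal_fun g x < top) \<and>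
      (\<integral>\<^sup>+x. ennreal (enn2real (maximal_fun g x) powr q) \<partial>lborel) \<le> ennreal C3 * (\<integral>\<^sup>+x. ennreal (g x powr q) \<partial>lborel)"
      using maximal_fun_strong_type[OF q(1)] by metis
    \<comment> \<open>The 4 stems from the bound \<open>4 * (B + D)\<close> for the norm of
      \<open>norm (w y) + norm (g y)\<close> in \<open>un\<close>.\<close>
    define C where "C = C1 * (C3 powr (1 / p) * C3 powr (1 / p') * 4)"
    have C: "C > 0" using C1(1) C3(1) by (simp add: C_def)
    show thesis
    proof (rule that[OF C])
      fix V w :: "real ^ 'N \<Rightarrow> complex ^ 'n" and g :: "real ^ 'N \<Rightarrow> complex ^ 'n ^ 'n" and A B D :: real
      assume [measurable]: "V \<in> borel_measurable borel" "w \<in> borel_measurable borel" "g \<in> borel_measurable borel"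
        and ABD: "0 \<le> A" "0 \<le> B" "0 \<le> D"
        and Vn: "(\<integral>\<^sup>+x. ennreal (norm (V x) powr p) \<partial>lborel) \<le> ennreal (A powr p)"
        and wn: "(\<integral>\<^sup>+x. ennreal (norm (w x) powr p') \<partial>lborel) \<le> ennreal (B powr p')"
        and gn: "(\<integral>\<^sup>+x. ennreal (norm (g x) powr p') \<partial>lborel) \<le> ennreal (D powr p')"
        and weak: "weak_curl w g" "div_free V"
      let ?u = "\<lambda>y. norm (w y) + norm (g y)"
      let ?MV = "maximal_fun (\<lambda>y. ennreal (norm (V y) powr (p / q)))"
      let ?MU = "maximal_fun (\<lambda>y. ennreal (?u y powr (p' / q)))"
      have un: "(\<integral>\<^sup>+x. ennreal (?u x powr p') \<partial>lborel) \<le> ennreal ((4 * (B + D)) powr p')"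
      proof -
        have "(\<integral>\<^sup>+x. ennreal (?u x powr p') \<partial>lborel) \<le> ennreal (2 powr p') * ((\<integral>\<^sup>+x. ennreal (norm (w x) powr p') \<partial>lborel) + (\<integral>\<^sup>+x. ennreal (norm (g x) powr p') \<partial>lborel))"
          by (rule nn_integral_powr_add_le) (use p in auto)
        also have "\<dots> \<le> ennreal (2 powr p') * (ennreal (B powr p') + ennreal (D powr p'))"
          by (intro mult_left_mono add_mono wn gn) simp
        also have "\<dots> = ennreal (2 powr p' * (B powr p' + D powr p'))"
          by (simp add: ennreal_mult' ennreal_plus[symmetric] del: ennreal_plus)
        also have "\<dots> \<le> ennreal ((4 * (B + D)) powr p')"
        proof (rule ennreal_leI)
          have "B powr p' \<le> (B + D) powr p'" "D powr p' \<le> (B + D) powr p'"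
            using ABD p by (auto intro!: powr_mono2)
          moreover have "(2::real) powr 1 \<le> 2 powr p'" using p by (intro powr_mono) auto
          ultimately have "B powr p' + D powr p' \<le> 2 powr p' * (B + D) powr p'"
            using mult_right_mono[of 2 "2 powr p'" "(B + D) powr p'"] by simp
          then have "2 powr p' * (B powr p' + D powr p') \<le> 2 powr p' * (2 powr p' * (B + D) powr p')"
            by (rule mult_left_mono) simp
          also have "\<dots> = (2 * (2 * (B + D))) powr p'" using ABD by (simp only: powr_mult)
          finally show "2 powr p' * (B powr p' + D powr p') \<le> (4 * (B + D)) powr p'" by simp
        qed
        finally show ?thesis .
      qed
      have pq: "(norm (V x) powr (p / q)) powr q = norm (V x) powr p" "(?u x powr (p' / q)) powr q = ?u x powr p'" for x
        using q by (simp_all add: powr_powr)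
      have S1: "AE x in lborel. ?MV x < top" "(\<integral>\<^sup>+x. ennreal (enn2real (?MV x) powr q) \<partial>lborel) \<le> ennreal C3 * ennreal (A powr p)"
      proof -
        have *: "(AE x in lborel. ?MV x < top) \<and>
          (\<integral>\<^sup>+x. ennreal (enn2real (?MV x) powr q) \<partial>lborel) \<le> ennreal C3 * (\<integral>\<^sup>+x. ennreal ((norm (V x) powr (p / q)) powr q) \<partial>lborel)"
          by (rule C3(2)) (use Vn in \<open>auto simp: pq intro: le_less_trans\<close>)
        then show "AE x in lborel. ?MV x < top" by blast
        show "(\<integral>\<^sup>+x. ennreal (enn2real (?MV x) powr q) \<partial>lborel) \<le> ennreal C3 * ennreal (A powr p)"
          using conjunct2[OF *] unfolding pq by (rule order_trans) (intro mult_left_mono Vn, simp)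
      qed
      have S2: "AE x in lborel. ?MU x < top" "(\<integral>\<^sup>+x. ennreal (enn2real (?MU x) powr q) \<partial>lborel) \<le> ennreal C3 * ennreal ((4 * (B + D)) powr p')"
      proof -
        have *: "(AE x in lborel. ?MU x < top) \<and>
          (\<integral>\<^sup>+x. ennreal (enn2real (?MU x) powr q) \<partial>lborel) \<le> ennreal C3 * (\<integral>\<^sup>+x. ennreal ((?u x powr (p' / q)) powr q) \<partial>lborel)"
          by (rule C3(2)) (use un in \<open>auto simp: pq intro: le_less_trans\<close>)
        then show "AE x in lborel. ?MU x < top" by blast
        show "(\<integral>\<^sup>+x. ennreal (enn2real (?MU x) powr q) \<partial>lborel) \<le> ennreal C3 * ennreal ((4 * (B + D)) powr p')"
          using conjunct2[OF *] unfolding pq by (rule order_trans) (intro mult_left_mono un, simp)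
      qed
      have fin: "(\<integral>\<^sup>+x. ennreal (norm (V x) powr p) \<partial>lborel) < top" "(\<integral>\<^sup>+x. ennreal (norm (w x) powr p') \<partial>lborel) < top"
        "(\<integral>\<^sup>+x. ennreal (norm (g x) powr p') \<partial>lborel) < top"
        using Vn wn gn by (auto intro: le_less_trans)
      let ?f = "\<lambda>x. enn2real (?MV x) powr (q / p)" and ?h = "\<lambda>x. enn2real (?MU x) powr (q / p')"
      have "(\<integral>\<^sup>+x. (SUP t\<in>{0<..<1}. ennreal (norm (LINT y|lborel. (\<Sum>j\<in>UNIV. V y $ j * w y $ j) * dilate t \<phi> (x - y)))) \<partial>lborel)
        \<le> (\<integral>\<^sup>+x. ennreal C1 * ennreal (?f x * ?h x) \<partial>lborel)"
      proof (rule nn_integral_mono_AE)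
        show "AE x in lborel. (SUP t\<in>{0<..<1}. ennreal (norm (LINT y|lborel. (\<Sum>j\<in>UNIV. V y $ j * w y $ j) * dilate t \<phi> (x - y)))) \<le> ennreal C1 * ennreal (?f x * ?h x)"
          using S1(1) S2(1)
        proof eventually_elim
          case (elim x)
          show ?case
          proof (rule SUP_least)
            fix t :: real assume t: "t \<in> {0<..<1}"
            have "norm (LINT y|lborel. (\<Sum>j\<in>UNIV. V y $ j * w y $ j) * dilate t \<phi> (x - y)) \<le> C1 * ?f x * ?h x"
              by (rule C1(2)) (use fin weak t elim in auto)
            then show "ennreal (norm (LINT y|lborel. (\<Sum>j\<in>UNIV. V y $ j * w y $ j) * dilate t \<phi> (x - y))) \<le> ennreal C1 * ennreal (?f x * ?h x)"
              using C1(1) by (simp add: ennreal_mult'[symmetric] ennreal_leI mult.assoc)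
          qed
        qed
      qed
      also have "\<dots> = ennreal C1 * (\<integral>\<^sup>+x. ennreal (?f x * ?h x) \<partial>lborel)"
        by (rule nn_integral_cmult) measurable
      also have "\<dots> \<le> ennreal C1 * ennreal ((C3 powr (1 / p) * A) * (C3 powr (1 / p') * (4 * (B + D))))"
      proof (rule mult_left_mono, rule nn_integral_Hoelder[OF _ _ _ _ _ _ p])
        have "?f x powr p = enn2real (?MV x) powr q" "?h x powr p' = enn2real (?MU x) powr q" for x
          using p by (simp_all add: powr_powr)
        moreover have "(C3 powr (1 / p) * A) powr p = C3 * A powr p" "(C3 powr (1 / p') * (4 * (B + D))) powr p' = C3 * (4 * (B + D)) powr p'"
          using p C3(1) ABD by (simp_all add: powr_mult powr_powr)
        ultimately show "(\<integral>\<^sup>+x. ennreal (?f x powr p) \<partial>lborel) \<le> ennreal ((C3 powr (1 / p) * A) powr p)"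
            "(\<integral>\<^sup>+x. ennreal (?h x powr p') \<partial>lborel) \<le> ennreal ((C3 powr (1 / p') * (4 * (B + D))) powr p')"
          using S1(2) S2(2) C3(1) by (simp_all add: ennreal_mult')
      qed (use ABD C3(1) in auto)
      also have "\<dots> = ennreal (C * A * (B + D))"
      proof -
        have "C1 * ((C3 powr (1 / p) * A) * (C3 powr (1 / p') * (4 * (B + D)))) = C * A * (B + D)"
          by (simp only: C_def mult_ac)
        then show ?thesis using C1(1) by (simp only: ennreal_mult'[OF less_imp_le, symmetric])
      qed
      finally show "(\<integral>\<^sup>+x. (SUP t\<in>{0<..<1}. ennreal (norm (LINT y|lborel. (\<Sum>j\<in>UNIV. V y $ j * w y $ j) * dilate t \<phi> (x - y)))) \<partial>lborel)
        \<le> ennreal (C * A * (B + D))" .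
    qed
  qed
qed

end

text \<open>The definitions speak of Lebesgue measurable functions and the completed measure,
  whereas Fubini and maximal functions are used over \<open>lborel\<close>. Borel representatives of
  the coordinates provide the passage.\<close>

lemma lebesgue_measurable_ex_borel:
  fixes f :: "'a::euclidean_space \<Rightarrow> 'b::euclidean_space"
  assumes "f \<in> borel_measurable lebesgue"
  obtains f' where "f' \<in> borel_measurable borel" "AE x in lborel. f x = f' x"
proof -
  have "\<exists>h \<in> borel_measurable lborel. AE x in lborel. f x \<bullet> b = h x" for b
    by (rule completion_ex_borel_measurable_real) (use assms in measurable)
  then obtain h where h: "\<And>b. h b \<in> borel_measurable lborel" "\<And>b. AE x in lborel. f x \<bullet> b = h b x"
    by metis
  show thesis
  proof (rule that[of "\<lambda>x. \<Sum>b\<in>Basis. h b x *\<^sub>R b"])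
    show "(\<lambda>x. \<Sum>b\<in>Basis. h b x *\<^sub>R b) \<in> borel_measurable borel"
      using h(1) by simp
    have "AE x in lborel. \<forall>b\<in>Basis. f x \<bullet> b = h b x"
      by (intro AE_finite_allI h(2)) simp
    then show "AE x in lborel. f x = (\<Sum>b\<in>Basis. h b x *\<^sub>R b)"
    proof eventually_elim
      case (elim x)
      have "f x = (\<Sum>b\<in>Basis. (f x \<bullet> b) *\<^sub>R b)" by (simp add: euclidean_representation)
      then show ?case using elim by simp
    qed
  qed
qed

lemma lebesgue_integral_eq_lborel:
  fixes f g :: "'a::euclidean_space \<Rightarrow> 'b::{banach, second_countable_topology}"
  assumes "f \<in> borel_measurable lebesgue" "g \<in> borel_measurable borel" "AE x in lborel. f x = g x"
  shows "(LINT x|lebesgue. f x) = (LINT x|lborel. g x)"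
proof -
  have "(LINT x|lebesgue. f x) = (LINT x|lebesgue. g x)"
    using assms by (intro integral_cong_AE) (auto intro: measurable_completion AE_completion)
  then show ?thesis using assms by (simp add: integral_completion)
qed

lemma in_Lp_borel:
  fixes f f' :: "real ^ 'N \<Rightarrow> 'b::euclidean_space"
  assumes f: "in_Lp p f" and f': "f' \<in> borel_measurable borel" "AE x in lborel. f x = f' x" and p: "p > 0"
  shows "(\<integral>\<^sup>+x. ennreal (norm (f' x) powr p) \<partial>lborel) = ennreal (Lp_norm p f powr p)"
proof -
  have "(\<integral>\<^sup>+x. ennreal (norm (f' x) powr p) \<partial>lborel) = (\<integral>\<^sup>+x. ennreal (norm (f x) powr p) \<partial>lborel)"
    using f'(2) by (intro nn_integral_cong_AE) (auto elim: eventually_mono)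
  also have "\<dots> = (\<integral>\<^sup>+x. ennreal (norm (f x) powr p) \<partial>lebesgue)" by (simp add: nn_integral_completion)
  also have "\<dots> = ennreal (LINT x|lebesgue. norm (f x) powr p)"
    using f by (intro nn_integral_eq_integral) (auto simp: in_Lp_def)
  also have "(LINT x|lebesgue. norm (f x) powr p) = Lp_norm p f powr p"
    using p by (simp add: Lp_norm_def powr_powr)
  finally show ?thesis .
qed

theorem theorem1p3:
  fixes L :: "complex ^ 'N ^ 'n"
    and p p' :: real
    and \<phi> :: "real ^ 'N \<Rightarrow> complex"
  assumes "CARD('N) \<ge> 2" and "CARD('n) \<ge> 2"
    and "elliptic_system L" and "lin_indep_system L"
    and "1 < p" and "1 / p + 1 / p' = 1"
    and "schwartz \<phi>" and "(LINT x|lebesgue. \<phi> x) \<noteq> 0"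
  shows "\<exists>C>0. \<forall>W G. in_Lp p' W \<and> curl_is L W G \<and> in_Lp p' G \<longrightarrow>
           (\<forall>V. in_Lp p V \<and> dist_eq (div_adj L V) (\<lambda>_. 0) \<longrightarrow>
              h1_norm \<phi> (regular (\<lambda>x. herm_prod (V x) (W x)))
                \<le> ennreal (C * Lp_norm p V * (Lp_norm p' W + Lp_norm p' G)))"
proof -
  \<comment> \<open>\<open>div_adj\<close> involves the conjugated coefficients of \<open>L\<close>.
    With \<open>m\<close> and the conjugate of \<open>W\<close>, the divergence condition, the curl
    condition and the product all become bilinear and refer to the same vector fields.\<close>
  define m :: "complex ^ 'N ^ 'n" where "m = (\<chi> j k. cnj (L $ j $ k))"
  have m: "m $ j $ k = cnj (L $ j $ k)" for j k by (simp add: m_def)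
  have ell: "elliptic_system m"
    unfolding elliptic_system_def
  proof (intro allI impI)
    fix \<xi> :: "real ^ 'N" assume *: "\<forall>j. (\<Sum>k\<in>UNIV. m $ j $ k * of_real (\<xi> $ k)) = 0"
    have "(\<Sum>k\<in>UNIV. L $ j $ k * of_real (\<xi> $ k)) = cnj (\<Sum>k\<in>UNIV. m $ j $ k * of_real (\<xi> $ k))" for j
      by (simp add: m)
    then show "\<xi> = 0" using assms(3) * unfolding elliptic_system_def by simp
  qed
  interpret elliptic m by standard (rule ell)
  have "0 < 1 / p" "1 / p < 1" using assms(5) by simp_all
  then have "1 / p' > 0" "1 / p' < 1" using assms(6) by linarith+
  then have p': "1 < p'" by (simp add: divide_less_eq_1)
  note p = assms(5) p' assms(6)
  show ?thesis
  proof (rule maximal_integral_bound[OF p assms(7)], goal_cases)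
    case (1 C)
    have "h1_norm \<phi> (regular (\<lambda>x. herm_prod (V x) (W x))) \<le> ennreal (C * Lp_norm p V * (Lp_norm p' W + Lp_norm p' G))"
      if W: "in_Lp p' W" and curl: "curl_is L W G" and G: "in_Lp p' G" and V: "in_Lp p V" and div: "dist_eq (div_adj L V) (\<lambda>_. 0)"
      for V W G
    proof -
      have [measurable]: "V \<in> borel_measurable lebesgue" "W \<in> borel_measurable lebesgue" "G \<in> borel_measurable lebesgue"
        using V W G by (auto simp: in_Lp_def)
      obtain V' where V'[measurable]: "V' \<in> borel_measurable borel" and VV: "AE x in lborel. V x = V' x"
        by (rule lebesgue_measurable_ex_borel[of V]) auto
      obtain W' where W'[measurable]: "W' \<in> borel_measurable borel" and WW: "AE x in lborel. W x = W' x"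
        by (rule lebesgue_measurable_ex_borel[of W]) auto
      obtain G' where G'[measurable]: "G' \<in> borel_measurable borel" and GG: "AE x in lborel. G x = G' x"
        by (rule lebesgue_measurable_ex_borel[of G]) auto
      \<comment> \<open>Conjugation turns \<open>herm_prod\<close> into a bilinear sum and the curl
        of \<open>W\<close> for \<open>L\<close> into the curl of \<open>w\<close> for
        \<open>m\<close>; the norms are unchanged.\<close>
      define w where "w x = (\<chi> j. cnj (W' x $ j))" for x
      define g where "g x = (\<chi> i j. cnj (G' x $ i $ j))" for x
      have nw: "norm (w x) = norm (W' x)" and ng: "norm (g x) = norm (G' x)" for x
        by (simp_all add: w_def g_def norm_vec_def)
      have cont_cnj: "(\<lambda>v. \<chi> j. cnj (v $ j)) \<in> borel_measurable (borel :: (complex ^ 'n) measure)"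
        "(\<lambda>v. \<chi> i j. cnj (v $ i $ j)) \<in> borel_measurable (borel :: (complex ^ 'n ^ 'n) measure)"
        by (intro borel_measurable_continuous_onI continuous_intros)+
      have w[measurable]: "w \<in> borel_measurable borel" and g[measurable]: "g \<in> borel_measurable borel"
        unfolding w_def[abs_def] g_def[abs_def]
        by (rule measurable_compose[OF W' cont_cnj(1)] measurable_compose[OF G' cont_cnj(2)])+
      have Vn: "(\<integral>\<^sup>+x. ennreal (norm (V' x) powr p) \<partial>lborel) = ennreal (Lp_norm p V powr p)"
        and wn: "(\<integral>\<^sup>+x. ennreal (norm (w x) powr p') \<partial>lborel) = ennreal (Lp_norm p' W powr p')"
        and gn: "(\<integral>\<^sup>+x. ennreal (norm (g x) powr p') \<partial>lborel) = ennreal (Lp_norm p' G powr p')"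
        unfolding nw ng using in_Lp_borel[OF V V' VV] in_Lp_borel[OF W W' WW] in_Lp_borel[OF G G' GG] p by auto
      have comp: "cmod (V' y $ j) \<le> 1 * norm (V' y)" "cmod (w y $ j) \<le> 1 * norm (w y)" for y j
        unfolding mult_1 by (rule Finite_Cartesian_Product.norm_nth_le)+
      have loc: "loc_int (\<lambda>x. V' x $ j)" "loc_int (\<lambda>x. w x $ j)" for j
      proof -
        have fV: "(\<integral>\<^sup>+x. ennreal (norm (V' x $ j) powr p) \<partial>lborel) < top"
          by (rule nn_integral_powr_le_finite[OF _ comp(1)]) (use p Vn in simp_all)
        have fw: "(\<integral>\<^sup>+x. ennreal (norm (w x $ j) powr p') \<partial>lborel) < top"
          by (rule nn_integral_powr_le_finite[OF _ comp(2)]) (use p wn in simp_all)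
        show "loc_int (\<lambda>x. V' x $ j)" "loc_int (\<lambda>x. w x $ j)"
          by (rule loc_int_Lp[OF _ p(1) fV] loc_int_Lp[OF _ p(2) fw], measurable)+
      qed
      have LV: "(LINT x|lebesgue. V x $ j * h x) = (LINT x|lborel. V' x $ j * h x)"
        and LW: "(LINT x|lebesgue. W x $ j * h x) = (LINT x|lborel. W' x $ j * h x)"
        and LG: "(LINT x|lebesgue. G x $ i $ j * h x) = (LINT x|lborel. G' x $ i $ j * h x)"
        if [measurable]: "h \<in> borel_measurable borel" for h i j
      proof -
        have [measurable]: "h \<in> borel_measurable lebesgue" by (auto intro: measurable_completion)
        show "(LINT x|lebesgue. V x $ j * h x) = (LINT x|lborel. V' x $ j * h x)"
          by (rule lebesgue_integral_eq_lborel) (measurable, use VV in \<open>auto elim: eventually_mono\<close>)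
        show "(LINT x|lebesgue. W x $ j * h x) = (LINT x|lborel. W' x $ j * h x)"
          by (rule lebesgue_integral_eq_lborel) (measurable, use WW in \<open>auto elim: eventually_mono\<close>)
        show "(LINT x|lebesgue. G x $ i $ j * h x) = (LINT x|lborel. G' x $ i $ j * h x)"
          by (rule lebesgue_integral_eq_lborel) (measurable, use GG in \<open>auto elim: eventually_mono\<close>)
      qed
      have bp: "partial k \<eta> \<in> borel_measurable borel" if "test_function \<eta>" for k and \<eta> :: "real ^ 'N \<Rightarrow> complex"
        by (rule smooth_borel[OF smooth_partial[OF test_function_smooth[OF that]]])
      \<comment> \<open>In \<open>vf_apply\<close> the sum over coordinates stands outside the
        integral, in \<open>vf_deriv\<close> inside; integrability of each term is what allows the
        exchange.\<close>
      have vf_sum: "(LINT y|lborel. f y * vf_deriv a \<eta> y) = (\<Sum>k\<in>UNIV. a $ k * (LINT y|lborel. f y * partial k \<eta> y))"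
        if "loc_int f" "test_function \<eta>" for f a and \<eta> :: "real ^ 'N \<Rightarrow> complex"
      proof -
        have int: "integrable lborel (\<lambda>y. a $ k * (f y * partial k \<eta> y))" for k
          using that test_function_partial[OF that(2)] by (simp add: loc_int_def)
        have "(LINT y|lborel. f y * vf_deriv a \<eta> y) = (LINT y|lborel. (\<Sum>k\<in>UNIV. a $ k * (f y * partial k \<eta> y)))"
          by (simp add: vf_deriv_def sum_distrib_left mult_ac)
        also have "\<dots> = (\<Sum>k\<in>UNIV. LINT y|lborel. a $ k * (f y * partial k \<eta> y))"
          by (rule Bochner_Integration.integral_sum) (rule int)
        finally show ?thesis by simp
      qed
      have divV: "div_free V'"
        unfolding div_free_def
      proof (intro allI impI)
        fix \<eta> :: "real ^ 'N \<Rightarrow> complex" assume \<eta>: "test_function \<eta>"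
        \<comment> \<open>The minus sign of the formal adjoint and that of the distributional
          derivative cancel.\<close>
        have "(\<Sum>j\<in>UNIV. LINT y|lborel. V' y $ j * vf_deriv (m $ j) \<eta> y) = div_adj L V \<eta>"
          by (simp add: vf_sum[OF loc(1) \<eta>] div_adj_def vf_apply_def vf_adjoint_def dist_partial_def regular_def LV[OF bp[OF \<eta>]] m)
        also have "\<dots> = 0" using div \<eta> by (simp add: dist_eq_def)
        finally show "(\<Sum>j\<in>UNIV. LINT y|lborel. V' y $ j * vf_deriv (m $ j) \<eta> y) = 0" .
      qed
      have curlw: "weak_curl w g"
        unfolding weak_curl_def
      proof (intro allI impI)
        fix \<eta> :: "real ^ 'N \<Rightarrow> complex" and i j assume \<eta>: "test_function \<eta>"
        \<comment> \<open>The distributional pairing is bilinear, so conjugating the weak equation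
          for \<open>W\<close> conjugates the test function too; the equation is therefore tested
          with the conjugate of \<eta>.\<close>
        let ?c = "\<lambda>x. cnj (\<eta> x)"
        have c: "test_function ?c" by (rule test_function_cnj[OF \<eta>])
        have pc: "partial k ?c x = cnj (partial k \<eta> x)" for k x
          by (rule partial_cnj[OF smooth_differentiable[OF test_function_smooth[OF \<eta>]]])
        have Lw: "(LINT z|lborel. w z $ l * vf_deriv (m $ k) \<eta> z) = - cnj (vf_apply (L $ k) (regular (\<lambda>x. W x $ l)) ?c)" for k l
        proof -
          have "cnj (LINT x|lborel. W' x $ l * partial k' ?c x) = (LINT x|lborel. w x $ l * partial k' \<eta> x)" for k'
            by (subst Bochner_Integration.integral_cnj[symmetric]) (simp add: w_def pc del: Bochner_Integration.integral_cnj)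
          then show ?thesis
            by (simp add: vf_sum[OF loc(2) \<eta>] vf_apply_def dist_partial_def regular_def LW[OF bp[OF c]] m sum_negf)
        qed
        have Lg: "(LINT z|lborel. g z $ i $ j * \<eta> z) = cnj (regular (\<lambda>x. G x $ i $ j) ?c)"
          unfolding regular_def LG[OF smooth_borel[OF test_function_smooth[OF c]]]
          by (subst Bochner_Integration.integral_cnj[symmetric]) (simp add: g_def del: Bochner_Integration.integral_cnj)
        have "curl L W i j ?c = regular (\<lambda>x. G x $ i $ j) ?c"
          using curl c by (simp add: curl_is_def dist_eq_def)
        then show "(LINT z|lborel. w z $ j * vf_deriv (m $ i) \<eta> z) - (LINT z|lborel. w z $ i * vf_deriv (m $ j) \<eta> z)
            = - (LINT z|lborel. g z $ i $ j * \<eta> z)"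
          unfolding Lw Lg curl_def by (metis (no_types) complex_cnj_diff minus_diff_minus)
      qed
      have "regular (\<lambda>x. herm_prod (V x) (W x)) (\<lambda>y. dilate t \<phi> (x - y))
        = (LINT y|lborel. (\<Sum>j\<in>UNIV. V' y $ j * w y $ j) * dilate t \<phi> (x - y))" for t x
      proof -
        have \<phi>m[measurable]: "\<phi> \<in> borel_measurable borel" using assms(7) smooth_borel by (auto simp: schwartz_def)
        have dm[measurable]: "(\<lambda>y. dilate t \<phi> (x - y)) \<in> borel_measurable borel" unfolding dilate_def by measurable
        have [measurable]: "(\<lambda>y. dilate t \<phi> (x - y)) \<in> borel_measurable lebesgue"
          by (rule measurable_completion) (use dm in simp)
        have cw: "(\<lambda>y. cnj (W y $ j)) \<in> borel_measurable lebesgue" for j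
          by (rule measurable_compose[OF borel_measurable_vec_nth borel_measurable_continuous_onI])
             (auto intro: continuous_on_cnj continuous_on_id)
        have "AE y in lborel. herm_prod (V y) (W y) * dilate t \<phi> (x - y) = (\<Sum>j\<in>UNIV. V' y $ j * w y $ j) * dilate t \<phi> (x - y)"
          using VV WW by eventually_elim (simp add: herm_prod_def w_def)
        then show ?thesis
          unfolding regular_def
          by (intro lebesgue_integral_eq_lborel) (auto simp: herm_prod_def intro!: borel_measurable_times borel_measurable_sum cw)
      qed
      then have "h1_norm \<phi> (regular (\<lambda>x. herm_prod (V x) (W x)))
        = (\<integral>\<^sup>+x. (SUP t\<in>{0<..<1}. ennreal (norm (LINT y|lborel. (\<Sum>j\<in>UNIV. V' y $ j * w y $ j) * dilate t \<phi> (x - y)))) \<partial>lborel)"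
        by (simp add: h1_norm_def local_maximal_def nn_integral_completion)
      also have "\<dots> \<le> ennreal (C * Lp_norm p V * (Lp_norm p' W + Lp_norm p' G))"
        by (rule 1(2)) (use Vn wn gn curlw divV in \<open>auto simp: Lp_norm_def\<close>)
      finally show ?thesis .
    qed
    then show ?case using 1(1) by blast
  qed
qed

end
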